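(* In either of the two WKB problems described in the context, for $P,Q\in\widetilde X$ let $$\nu_{PQ}=\limsup_{t\to\infty}\frac1t\log\|T_{PQ}(t)\|,\qquad \nu^{\omega}_{PQ}=\lim_{\omega}\frac1t\log\|T_{PQ}(t)\|$$ be the WKB exponent and, for an ultrafilter $\omega$, the ultrafilter exponent. Then $$\nu^{\omega}_{PQ}\le\nu_{PQ}.$$ Furthermore, they are equal in some cases: (a) for any fixed choice of $P,Q$, there exists a choice of ultrafilter $\omega$ such that $\nu^{\omega}_{PQ}=\nu_{PQ}$; (b) if $\limsup_{t}\frac1t\log\|T_{PQ}(t)\|=\lim_t\frac1t\log\|T_{PQ}(t)\|$ (i.e. the limit as $t\to\infty$ exists), then it is the same as $\lim_\omega\frac1t\log\|T_{PQ}(t)\|$, so $\nu^{\omega}_{PQ}=\nu_{PQ}$. This applies in particular in the local WKB case, described in the context.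
   Context: Let $X$ be a Riemann surface with universal cover $\widetilde X$, $\mathcal{E}$ a rank $r$ holomorphic vector bundle on $X$ with trivial determinant and $\varphi$ a trace-zero Higgs field on $\mathcal{E}$ with reduced spectral curve; locally away from the branch points of the spectral curve, $\phi_1,\dots,\phi_r$ denote the eigen-$1$-forms of $\varphi$. Complex (Riemann–Hilbert) WKB problem: $\nabla_t=\nabla_0+t\varphi$, $t\in\mathbb{R}_{\ge0}$, for a fixed connection $\nabla_0$ on $\mathcal{E}$, and a fixed Hermitian metric $h$ on $\mathcal{E}$. $T_{PQ}(t):\mathcal{E}_P\to\mathcal{E}_Q$ is the transport matrix of $\nabla_t$ along the unique homotopy class of paths in $\widetilde X$ from $P$ to $Q$, and $\|T_{PQ}(t)\|$ its operator norm with respect to $h_P,h_Q$. Hitchin WKB problem: $X$ is compact, or one has some other control over the behavior at infinity; $(\mathcal{E},\varphi)$ is a stable Higgs bundle, $h_t$ is the Hitchin Hermitian–Yang–Mills metric on $(\mathcal{E},t\varphi)$, $\nabla_t$ is the associated flat connection, $T_{PQ}(t)$ its transport matrix, with operator norm taken with respect to $h_{t,P},h_{t,Q}$. Local WKB case: the complex WKB problem with $P=\gamma(0)$, $Q=\gamma(1)$ the endpoints of a noncritical path $\gamma:[0,1]\to\widetilde X$ avoiding the points over branch points, i.e. a path such that the $\gamma^*\mathrm{Re}\,\phi_i$ are distinct at every point of $[0,1]$. Ultrafilters $\omega$ are non-principal ultrafilters on the set of parameters $t$; $\lim_\omega f(t)=a$ means that $\{t:f(t)\in U\}\in\omega$ for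 each neighbourhood $U$ of $a$.
   Formalization: The ultrafilters are required not only to be non-principal but also to contain every set {t > M}; for a non-principal ultrafilter with a bounded member (for example one converging to t = 1) the inequality can fail. *)

theory Defs
  imports "HOL-Complex_Analysis.Complex_Analysis"
begin

section \<open>Riemann surfaces and universal covers\<close>

type_synonym 'x chart = "'x set \<times> ('x \<Rightarrow> complex)"

text \<open>Second countability is not imposed: it is automatic by Rado's theorem.\<close>

definition riemann_surface :: "'x::t2_space chart set \<Rightarrow> bool" where
  "riemann_surface A \<longleftrightarrow>
     connected (UNIV :: 'x set) \<and> \<Union> (fst ` A) = UNIV \<and>
     (\<forall>(U, z) \<in> A. open U \<and> open (z ` U) \<and> homeomorphism U (z ` U) z (inv_into U z)) \<and>
     (\<forall>(U, z) \<in> A. \<forall>(U', z') \<in> A. (z' \<circ> inv_into U z) holomorphic_on (z ` (U \<inter> U')))"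

definition holomorphic_fun :: "'x::t2_space chart set \<Rightarrow> 'x set \<Rightarrow> ('x \<Rightarrow> complex) \<Rightarrow> bool" where
  "holomorphic_fun A W f \<longleftrightarrow>
     (\<forall>(U, z) \<in> A. (f \<circ> inv_into U z) holomorphic_on (z ` (U \<inter> W)))"

definition universal_cover :: "('y::topological_space \<Rightarrow> 'x::topological_space) \<Rightarrow> bool" where
  "universal_cover p \<longleftrightarrow>
     covering_space (UNIV :: 'y set) p (UNIV :: 'x set) \<and> simply_connected (UNIV :: 'y set)"

section \<open>Holomorphic vector bundles\<close>

text \<open>A bundle is given by its total space (the type \<open>'e\<close>), its projection \<open>pr\<close> and a trivialising
  atlas. A trivialisation over \<open>V\<close> maps each fibre over \<open>V\<close> bijectively to the model space; the
  vector space structure of the fibres is the one transported by the trivialisations, which does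
  not depend on the choice since the changes of trivialisation are linear.\<close>

type_synonym ('x, 'e, 'r) triv = "'x set \<times> ('e \<Rightarrow> complex ^ 'r)"

definition fibre :: "('e \<Rightarrow> 'x) \<Rightarrow> 'x \<Rightarrow> 'e set" where
  "fibre pr x = pr -` {x}"

definition transition ::
  "('e \<Rightarrow> 'x) \<Rightarrow> ('x, 'e, 'r::finite) triv \<Rightarrow> ('x, 'e, 'r) triv \<Rightarrow> 'x \<Rightarrow> complex ^ 'r ^ 'r" where
  "transition pr b b' x = matrix (\<lambda>v. snd b' (inv_into (fibre pr x) (snd b) v))"

definition compatible ::
  "'x::t2_space chart set \<Rightarrow> ('e \<Rightarrow> 'x) \<Rightarrow> ('x, 'e, 'r::finite) triv \<Rightarrow> ('x, 'e, 'r) triv \<Rightarrow> bool" where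
  "compatible A pr b b' \<longleftrightarrow>
     (\<forall>e. pr e \<in> fst b \<inter> fst b' \<longrightarrow> snd b' e = transition pr b b' (pr e) *v snd b e) \<and>
     (\<forall>i j. holomorphic_fun A (fst b \<inter> fst b') (\<lambda>x. transition pr b b' x $ i $ j))"

definition fibrewise_bijective :: "('e \<Rightarrow> 'x::t2_space) \<Rightarrow> ('x, 'e, 'r::finite) triv \<Rightarrow> bool" where
  "fibrewise_bijective pr b \<longleftrightarrow> open (fst b) \<and> (\<forall>x \<in> fst b. bij_betw (snd b) (fibre pr x) UNIV)"

definition holomorphic_bundle ::
  "'x::t2_space chart set \<Rightarrow> ('e \<Rightarrow> 'x) \<Rightarrow> ('x, 'e, 'r::finite) triv set \<Rightarrow> bool" where
  "holomorphic_bundle A pr B \<longleftrightarrow>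
     \<Union> (fst ` B) = UNIV \<and> (\<forall>b \<in> B. fibrewise_bijective pr b) \<and>
     (\<forall>b \<in> B. \<forall>b' \<in> B. compatible A pr b b')"

text \<open>The members of the maximal trivialising atlas generated by \<open>B\<close>.\<close>

definition holomorphic_triv ::
  "'x::t2_space chart set \<Rightarrow> ('e \<Rightarrow> 'x) \<Rightarrow> ('x, 'e, 'r::finite) triv set \<Rightarrow> ('x, 'e, 'r) triv \<Rightarrow> bool" where
  "holomorphic_triv A pr B b \<longleftrightarrow>
     fibrewise_bijective pr b \<and> (\<forall>b' \<in> B. compatible A pr b b' \<and> compatible A pr b' b)"

text \<open>A nowhere vanishing holomorphic section of the determinant line bundle, whose cocycle is the
  determinant of the cocycle of the bundle.\<close>

definition trivial_determinant ::
  "'x::t2_space chart set \<Rightarrow> ('e \<Rightarrow> 'x) \<Rightarrow> ('x, 'e, 'r::finite) triv set \<Rightarrow> bool" where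
  "trivial_determinant A pr B \<longleftrightarrow>
     (\<exists>\<sigma>. (\<forall>b \<in> B. holomorphic_fun A (fst b) (\<sigma> b) \<and> (\<forall>x \<in> fst b. \<sigma> b x \<noteq> 0)) \<and>
          (\<forall>b \<in> B. \<forall>b' \<in> B. \<forall>x \<in> fst b \<inter> fst b'. \<sigma> b' x = det (transition pr b b' x) * \<sigma> b x))"

section \<open>Higgs fields and connections\<close>

text \<open>\<open>\<Phi> c b\<close> is the matrix \<open>M\<close> of coefficients of the local expression \<open>M dz\<close> of an
  endomorphism-valued form, for the chart \<open>c = (U, z)\<close> and the trivialisation \<open>b\<close>.\<close>

type_synonym ('x, 'e, 'r) coeffs = "'x chart \<Rightarrow> ('x, 'e, 'r) triv \<Rightarrow> 'x \<Rightarrow> complex ^ 'r ^ 'r"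

definition holomorphic_coeffs ::
  "'x::t2_space chart set \<Rightarrow> ('x, 'e, 'r::finite) triv set \<Rightarrow> ('x, 'e, 'r) coeffs \<Rightarrow> bool" where
  "holomorphic_coeffs A B M \<longleftrightarrow>
     (\<forall>c \<in> A. \<forall>b \<in> B. \<forall>i j. holomorphic_fun A (fst c \<inter> fst b) (\<lambda>x. M c b x $ i $ j))"

text \<open>The derivative \<open>dz'/dz\<close> at \<open>x\<close>, for \<open>c = (U, z)\<close> and \<open>c' = (U', z')\<close>.\<close>

definition chart_deriv :: "'x chart \<Rightarrow> 'x chart \<Rightarrow> 'x \<Rightarrow> complex" where
  "chart_deriv c c' x = deriv (snd c' \<circ> inv_into (fst c) (snd c)) (snd c x)"

text \<open>\<open>M' dz' = g (M dz) g\<^sup>-\<^sup>1\<close>, with \<open>g\<close> the transition matrix.\<close>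

definition higgs_field ::
  "'x::t2_space chart set \<Rightarrow> ('e \<Rightarrow> 'x) \<Rightarrow> ('x, 'e, 'r::finite) triv set \<Rightarrow> ('x, 'e, 'r) coeffs \<Rightarrow> bool" where
  "higgs_field A pr B \<Phi> \<longleftrightarrow> holomorphic_coeffs A B \<Phi> \<and>
     (\<forall>c \<in> A. \<forall>c' \<in> A. \<forall>b \<in> B. \<forall>b' \<in> B. \<forall>x \<in> fst c \<inter> fst c' \<inter> fst b \<inter> fst b'.
        mat (chart_deriv c c' x) ** \<Phi> c' b' x ** transition pr b b' x
          = transition pr b b' x ** \<Phi> c b x)"

definition trace_zero ::
  "'x chart set \<Rightarrow> ('x, 'e, 'r::finite) triv set \<Rightarrow> ('x, 'e, 'r) coeffs \<Rightarrow> bool" where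
  "trace_zero A B \<Phi> \<longleftrightarrow> (\<forall>c \<in> A. \<forall>b \<in> B. \<forall>x \<in> fst c \<inter> fst b. trace (\<Phi> c b x) = 0)"

text \<open>A holomorphic connection, locally \<open>d + \<alpha> dz\<close>: \<open>\<alpha>' dz' = g (\<alpha> dz) g\<^sup>-\<^sup>1 - dg g\<^sup>-\<^sup>1\<close>.\<close>

definition holomorphic_connection ::
  "'x::t2_space chart set \<Rightarrow> ('e \<Rightarrow> 'x) \<Rightarrow> ('x, 'e, 'r::finite) triv set \<Rightarrow> ('x, 'e, 'r) coeffs \<Rightarrow> bool" where
  "holomorphic_connection A pr B \<alpha> \<longleftrightarrow> holomorphic_coeffs A B \<alpha> \<and>
     (\<forall>c \<in> A. \<forall>c' \<in> A. \<forall>b \<in> B. \<forall>b' \<in> B. \<forall>x \<in> fst c \<inter> fst c' \<inter> fst b \<inter> fst b'.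
        mat (chart_deriv c c' x) ** \<alpha> c' b' x ** transition pr b b' x
          = transition pr b b' x ** \<alpha> c b x
            - (\<chi> i j. deriv (\<lambda>w. transition pr b b' (inv_into (fst c) (snd c) w) $ i $ j) (snd c x)))"

subsection \<open>Reducedness of the spectral curve\<close>

text \<open>The spectral curve is cut out in the cotangent bundle, with local coordinates \<open>(w, \<eta>)\<close>
  standing for the covector \<open>\<eta> dz\<close> at the point \<open>z = w\<close>, by \<open>det (\<eta> - \<Phi>) = 0\<close>. It is reduced if no
  local ring of holomorphic germs modulo this equation has a nonzero nilpotent.\<close>

definition holomorphic2_on :: "(complex \<times> complex \<Rightarrow> complex) \<Rightarrow> (complex \<times> complex) set \<Rightarrow> bool" where
  "holomorphic2_on g N \<longleftrightarrow> (\<forall>q \<in> N. \<exists>a b. (g has_derivative (\<lambda>(u, v). a * u + b * v)) (at q))"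

definition germ_dvd ::
  "complex \<times> complex \<Rightarrow> (complex \<times> complex \<Rightarrow> complex) \<Rightarrow> (complex \<times> complex \<Rightarrow> complex) \<Rightarrow> bool" where
  "germ_dvd q F g \<longleftrightarrow>
     (\<exists>N k. open N \<and> q \<in> N \<and> holomorphic2_on k N \<and> (\<forall>q' \<in> N. g q' = k q' * F q'))"

definition spectral_fun ::
  "('x, 'e, 'r::finite) coeffs \<Rightarrow> 'x chart \<Rightarrow> ('x, 'e, 'r) triv \<Rightarrow> complex \<times> complex \<Rightarrow> complex" where
  "spectral_fun \<Phi> c b = (\<lambda>(w, \<eta>). det (mat \<eta> - \<Phi> c b (inv_into (fst c) (snd c) w)))"

definition reduced_spectral_curve ::
  "'x chart set \<Rightarrow> ('x, 'e, 'r::finite) triv set \<Rightarrow> ('x, 'e, 'r) coeffs \<Rightarrow> bool" where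
  "reduced_spectral_curve A B \<Phi> \<longleftrightarrow>
     (\<forall>c \<in> A. \<forall>b \<in> B. \<forall>x \<in> fst c \<inter> fst b. \<forall>\<eta>.
        let q = (snd c x, \<eta>); F = spectral_fun \<Phi> c b in
        F q = 0 \<longrightarrow>
          (\<forall>g N n. open N \<and> q \<in> N \<and> holomorphic2_on g N \<and> germ_dvd q F (\<lambda>q'. g q' ^ n)
             \<longrightarrow> germ_dvd q F g))"

section \<open>Hermitian metrics\<close>

primrec Ck_on :: "nat \<Rightarrow> complex set \<Rightarrow> (complex \<Rightarrow> complex) \<Rightarrow> bool" where
  "Ck_on 0 S f \<longleftrightarrow> continuous_on S f"
| "Ck_on (Suc k) S f \<longleftrightarrow> (\<forall>w \<in> S. f differentiable (at w)) \<and>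
     Ck_on k S (\<lambda>w. frechet_derivative f (at w) 1) \<and>
     Ck_on k S (\<lambda>w. frechet_derivative f (at w) \<i>)"

definition smooth_on :: "complex set \<Rightarrow> (complex \<Rightarrow> complex) \<Rightarrow> bool" where
  "smooth_on S f \<longleftrightarrow> (\<forall>k. Ck_on k S f)"

text \<open>The Gram matrix \<open>H\<close> in a trivialisation \<open>\<psi>\<close>, with the convention that metrics are
  antilinear in the second argument: \<open>h e e' = (\<psi> e')\<^sup>* H (\<psi> e)\<close>.\<close>

definition gram ::
  "('e \<Rightarrow> 'x) \<Rightarrow> ('e \<Rightarrow> 'e \<Rightarrow> complex) \<Rightarrow> ('x, 'e, 'r::finite) triv \<Rightarrow> 'x \<Rightarrow> complex ^ 'r ^ 'r" where
  "gram pr h b x = (\<chi> i j. h (inv_into (fibre pr x) (snd b) (axis j 1))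
                             (inv_into (fibre pr x) (snd b) (axis i 1)))"

definition hermitian_metric ::
  "'x::t2_space chart set \<Rightarrow> ('e \<Rightarrow> 'x) \<Rightarrow> ('x, 'e, 'r::finite) triv set \<Rightarrow> ('e \<Rightarrow> 'e \<Rightarrow> complex) \<Rightarrow> bool" where
  "hermitian_metric A pr B h \<longleftrightarrow>
     (\<forall>b \<in> B. \<forall>x \<in> fst b.
        (\<forall>e \<in> fibre pr x. \<forall>e' \<in> fibre pr x.
           h e e' = (\<Sum>i\<in>UNIV. \<Sum>j\<in>UNIV. cnj (snd b e' $ i) * gram pr h b x $ i $ j * snd b e $ j) \<and>
           h e' e = cnj (h e e')) \<and>
        (\<forall>e \<in> fibre pr x. snd b e \<noteq> 0 \<longrightarrow> Re (h e e) > 0)) \<and>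
     (\<forall>(U, z) \<in> A. \<forall>b \<in> B. \<forall>i j.
        smooth_on (z ` (U \<inter> fst b)) (\<lambda>w. gram pr h b (inv_into U z w) $ i $ j))"

definition hnorm :: "('e \<Rightarrow> 'e \<Rightarrow> complex) \<Rightarrow> 'e \<Rightarrow> real" where
  "hnorm h e = sqrt (Re (h e e))"

subsection \<open>The Hermitian-Yang-Mills equation\<close>

definition d_z :: "(complex \<Rightarrow> complex) \<Rightarrow> complex \<Rightarrow> complex" where
  "d_z f w = (frechet_derivative f (at w) 1 - \<i> * frechet_derivative f (at w) \<i>) / 2"

definition d_zbar :: "(complex \<Rightarrow> complex) \<Rightarrow> complex \<Rightarrow> complex" where
  "d_zbar f w = (frechet_derivative f (at w) 1 + \<i> * frechet_derivative f (at w) \<i>) / 2"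

text \<open>The Chern connection is \<open>d + H\<^sup>-\<^sup>1 \<partial>H\<close> in a holomorphic trivialisation, and its curvature is
  the \<open>d_zbar\<close>-derivative of the coefficient \<open>H\<^sup>-\<^sup>1 d_z H\<close>, times \<open>dzbar \<and> dz\<close>.\<close>

definition chern_coeffs ::
  "('e \<Rightarrow> 'x) \<Rightarrow> ('e \<Rightarrow> 'e \<Rightarrow> complex) \<Rightarrow> ('x, 'e, 'r::finite) coeffs" where
  "chern_coeffs pr h c b x =
     matrix_inv (gram pr h b x) **
       (\<chi> i j. d_z (\<lambda>w. gram pr h b (inv_into (fst c) (snd c) w) $ i $ j) (snd c x))"

definition chern_curvature ::
  "('e \<Rightarrow> 'x) \<Rightarrow> ('e \<Rightarrow> 'e \<Rightarrow> complex) \<Rightarrow> ('x, 'e, 'r::finite) coeffs" where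
  "chern_curvature pr h c b x =
     (\<chi> i j. d_zbar (\<lambda>w. chern_coeffs pr h c b (inv_into (fst c) (snd c) w) $ i $ j) (snd c x))"

text \<open>Coefficients, with respect to \<open>dzbar\<close>, of the \<open>h\<close>-adjoint of \<open>\<Phi> dz\<close>.\<close>

definition adjoint_coeffs ::
  "('e \<Rightarrow> 'x) \<Rightarrow> ('e \<Rightarrow> 'e \<Rightarrow> complex) \<Rightarrow> ('x, 'e, 'r::finite) coeffs \<Rightarrow> ('x, 'e, 'r) coeffs" where
  "adjoint_coeffs pr h \<Phi> c b x =
     matrix_inv (gram pr h b x) ** (\<chi> i j. cnj (\<Phi> c b x $ j $ i)) ** gram pr h b x"

text \<open>The equation is \<open>F\<^sub>h + [\<phi>, \<phi>\<^sup>*] = 0\<close>. Here \<open>F\<^sub>h\<close> has the coefficient \<open>chern_curvature\<close> with respect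
  to \<open>dzbar \<and> dz\<close>, and \<open>[\<phi>, \<phi>\<^sup>*]\<close> has the coefficient \<open>\<Phi> \<Phi>\<^sup>* - \<Phi>\<^sup>* \<Phi>\<close> with respect to \<open>dz \<and> dzbar\<close>.\<close>

definition hermitian_yang_mills ::
  "'x::t2_space chart set \<Rightarrow> ('e \<Rightarrow> 'x) \<Rightarrow> ('x, 'e, 'r::finite) triv set \<Rightarrow> ('x, 'e, 'r) coeffs
     \<Rightarrow> ('e \<Rightarrow> 'e \<Rightarrow> complex) \<Rightarrow> bool" where
  "hermitian_yang_mills A pr B \<Phi> h \<longleftrightarrow> hermitian_metric A pr B h \<and>
     (\<forall>c \<in> A. \<forall>b \<in> B. \<forall>x \<in> fst c \<inter> fst b.
        chern_curvature pr h c b x =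
          \<Phi> c b x ** adjoint_coeffs pr h \<Phi> c b x - adjoint_coeffs pr h \<Phi> c b x ** \<Phi> c b x)"

section \<open>Stability\<close>

text \<open>A trivialisation of the bundle is adapted to \<open>F\<close> if it identifies \<open>F\<close> with the
  constant subbundle spanned by the coordinates in \<open>K\<close>; thus \<open>F\<close> has rank \<open>card K\<close>.\<close>

definition adapted_triv ::
  "'x::t2_space chart set \<Rightarrow> ('e \<Rightarrow> 'x) \<Rightarrow> ('x, 'e, 'r::finite) triv set \<Rightarrow> 'r set \<Rightarrow> 'e set
     \<Rightarrow> ('x, 'e, 'r) triv \<Rightarrow> bool" where
  "adapted_triv A pr B K F b \<longleftrightarrow> holomorphic_triv A pr B b \<and>
     (\<forall>x \<in> fst b. snd b ` (F \<inter> fibre pr x) = {v. \<forall>i. i \<notin> K \<longrightarrow> v $ i = 0})"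

definition subbundle ::
  "'x::t2_space chart set \<Rightarrow> ('e \<Rightarrow> 'x) \<Rightarrow> ('x, 'e, 'r::finite) triv set \<Rightarrow> 'r set \<Rightarrow> 'e set \<Rightarrow> bool" where
  "subbundle A pr B K F \<longleftrightarrow> (\<forall>x. \<exists>b. adapted_triv A pr B K F b \<and> x \<in> fst b)"

definition higgs_invariant ::
  "'x chart set \<Rightarrow> ('e \<Rightarrow> 'x) \<Rightarrow> ('x, 'e, 'r::finite) triv set \<Rightarrow> ('x, 'e, 'r) coeffs \<Rightarrow> 'e set \<Rightarrow> bool" where
  "higgs_invariant A pr B \<Phi> F \<longleftrightarrow>
     (\<forall>c \<in> A. \<forall>b \<in> B. \<forall>x \<in> fst c \<inter> fst b. \<forall>e \<in> F \<inter> fibre pr x.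
        \<exists>e' \<in> F \<inter> fibre pr x. snd b e' = \<Phi> c b x *v snd b e)"

text \<open>The principal minor with index set \<open>K\<close>. Between adapted trivialisations the transition
  matrices preserve the coordinate subspace \<open>K\<close>, so these minors form the cocycle of \<open>det F\<close>.\<close>

definition minor_det :: "'r set \<Rightarrow> complex ^ 'r ^ 'r::finite \<Rightarrow> complex" where
  "minor_det K M =
     det ((\<chi> i j. if i \<in> K \<and> j \<in> K then M $ i $ j else if i = j then 1 else 0) :: complex ^ 'r ^ 'r)"

text \<open>A meromorphic section of \<open>det F\<close> that does not vanish identically. The values of
  \<open>\<sigma>\<close> at its poles are irrelevant, whence the comparison on punctured neighbourhoods.\<close>

definition meromorphic_det_section ::
  "'x::t2_space chart set \<Rightarrow> ('e \<Rightarrow> 'x) \<Rightarrow> ('x, 'e, 'r::finite) triv set \<Rightarrow> 'r set \<Rightarrow> 'e set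
     \<Rightarrow> (('x, 'e, 'r) triv \<Rightarrow> 'x \<Rightarrow> complex) \<Rightarrow> bool" where
  "meromorphic_det_section A pr B K F \<sigma> \<longleftrightarrow>
     (\<forall>b. adapted_triv A pr B K F b \<longrightarrow>
        (\<forall>(U, z) \<in> A. (\<sigma> b \<circ> inv_into U z) meromorphic_on (z ` (U \<inter> fst b))) \<and>
        (\<forall>x \<in> fst b. \<not> (\<forall>\<^sub>F y in at x. \<sigma> b y = 0))) \<and>
     (\<forall>b b'. adapted_triv A pr B K F b \<and> adapted_triv A pr B K F b' \<longrightarrow>
        (\<forall>x \<in> fst b \<inter> fst b'. \<forall>\<^sub>F y in at x. \<sigma> b' y = minor_det K (transition pr b b' y) * \<sigma> b y))"

text \<open>\<open>deg F\<close> is the number of zeros minus the number of poles of such a section.\<close>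

definition has_degree ::
  "'x::t2_space chart set \<Rightarrow> ('e \<Rightarrow> 'x) \<Rightarrow> ('x, 'e, 'r::finite) triv set \<Rightarrow> 'r set \<Rightarrow> 'e set \<Rightarrow> int \<Rightarrow> bool" where
  "has_degree A pr B K F d \<longleftrightarrow>
     (\<exists>\<sigma> ord. meromorphic_det_section A pr B K F \<sigma> \<and>
        (\<forall>b. adapted_triv A pr B K F b \<longrightarrow>
           (\<forall>(U, z) \<in> A. \<forall>x \<in> U \<inter> fst b. ord x = zorder (\<sigma> b \<circ> inv_into U z) (z x))) \<and>
        finite {x. ord x \<noteq> 0} \<and> d = (\<Sum>x | ord x \<noteq> 0. ord x))"

definition stable_higgs ::
  "'x::t2_space chart set \<Rightarrow> ('e \<Rightarrow> 'x) \<Rightarrow> ('x, 'e, 'r::finite) triv set \<Rightarrow> ('x, 'e, 'r) coeffs \<Rightarrow> bool" where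
  "stable_higgs A pr B \<Phi> \<longleftrightarrow>
     (\<forall>K F d d'. K \<noteq> {} \<and> K \<noteq> UNIV \<and> subbundle A pr B K F \<and> higgs_invariant A pr B \<Phi> F \<and>
        has_degree A pr B K F d \<and> has_degree A pr B UNIV UNIV d' \<longrightarrow>
        real_of_int d / real (card K) < real_of_int d' / real CARD('r))"

section \<open>Transport\<close>

text \<open>The pair \<open>(\<alpha>, \<beta>)\<close> stands for the connection given locally by \<open>d + \<alpha> dz + \<beta> dzbar\<close>.\<close>

type_synonym ('x, 'e, 'r) conn = "('x, 'e, 'r) coeffs \<times> ('x, 'e, 'r) coeffs"

definition path_speed ::
  "('y \<Rightarrow> 'x) \<Rightarrow> 'x chart \<Rightarrow> (real \<Rightarrow> 'y) \<Rightarrow> real \<Rightarrow> complex" where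
  "path_speed p c \<gamma> \<tau> = vector_derivative (snd c \<circ> p \<circ> \<gamma>) (at \<tau> within {0..1})"

definition C1_path ::
  "'x chart set \<Rightarrow> ('y::topological_space \<Rightarrow> 'x) \<Rightarrow> (real \<Rightarrow> 'y) \<Rightarrow> bool" where
  "C1_path A p \<gamma> \<longleftrightarrow> continuous_on {0..1} \<gamma> \<and>
     (\<forall>c \<in> A. let I = {\<tau> \<in> {0..1}. p (\<gamma> \<tau>) \<in> fst c} in
        (\<forall>\<tau> \<in> I. (snd c \<circ> p \<circ> \<gamma>) differentiable (at \<tau> within {0..1})) \<and>
        continuous_on I (path_speed p c \<gamma>))"

text \<open>Parallel sections \<open>s\<close> of the pulled back bundle along \<open>\<gamma>\<close>.\<close>

definition parallel_along ::
  "'x chart set \<Rightarrow> ('e \<Rightarrow> 'x) \<Rightarrow> ('x, 'e, 'r::finite) triv set \<Rightarrow> ('y \<Rightarrow> 'x) \<Rightarrow> ('x, 'e, 'r) conn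
     \<Rightarrow> (real \<Rightarrow> 'y) \<Rightarrow> (real \<Rightarrow> 'e) \<Rightarrow> bool" where
  "parallel_along A pr B p D \<gamma> s \<longleftrightarrow>
     (\<forall>\<tau> \<in> {0..1}. pr (s \<tau>) = p (\<gamma> \<tau>)) \<and>
     (\<forall>c \<in> A. \<forall>b \<in> B. \<forall>\<tau> \<in> {0..1}. p (\<gamma> \<tau>) \<in> fst c \<inter> fst b \<longrightarrow>
        ((snd b \<circ> s) has_vector_derivative
           - ((mat (path_speed p c \<gamma> \<tau>) ** fst D c b (p (\<gamma> \<tau>))
               + mat (cnj (path_speed p c \<gamma> \<tau>)) ** snd D c b (p (\<gamma> \<tau>))) *v snd b (s \<tau>)))
          (at \<tau> within {0..1}))"

text \<open>Transport along the unique homotopy class of paths from \<open>P\<close> to \<open>Q\<close> in the universal cover. For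
  a flat connection, every path from \<open>P\<close> to \<open>Q\<close> yields the same vector.\<close>

definition transport ::
  "'x chart set \<Rightarrow> ('e \<Rightarrow> 'x) \<Rightarrow> ('x, 'e, 'r::finite) triv set \<Rightarrow> ('y::topological_space \<Rightarrow> 'x)
     \<Rightarrow> ('x, 'e, 'r) conn \<Rightarrow> 'y \<Rightarrow> 'y \<Rightarrow> 'e \<Rightarrow> 'e" where
  "transport A pr B p D P Q e =
     (THE e'. \<exists>\<gamma> s. C1_path A p \<gamma> \<and> \<gamma> 0 = P \<and> \<gamma> 1 = Q \<and>
        parallel_along A pr B p D \<gamma> s \<and> s 0 = e \<and> s 1 = e')"

definition op_norm ::
  "('e \<Rightarrow> 'x) \<Rightarrow> ('y \<Rightarrow> 'x) \<Rightarrow> ('e \<Rightarrow> 'e \<Rightarrow> complex) \<Rightarrow> 'y \<Rightarrow> ('e \<Rightarrow> 'e) \<Rightarrow> real" where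
  "op_norm pr p h P T = (SUP e \<in> {e \<in> fibre pr (p P). hnorm h e \<le> 1}. hnorm h (T e))"

section \<open>The WKB problems\<close>

text \<open>In both problems \<open>D t\<close> is the connection and \<open>m t\<close> the Hermitian metric for the parameter \<open>t\<close>.\<close>

definition complex_wkb ::
  "'x::t2_space chart set \<Rightarrow> ('e \<Rightarrow> 'x) \<Rightarrow> ('x, 'e, 'r::finite) triv set \<Rightarrow> ('x, 'e, 'r) coeffs
     \<Rightarrow> (real \<Rightarrow> ('x, 'e, 'r) conn) \<Rightarrow> (real \<Rightarrow> 'e \<Rightarrow> 'e \<Rightarrow> complex) \<Rightarrow> bool" where
  "complex_wkb A pr B \<Phi> D m \<longleftrightarrow>
     (\<exists>\<alpha>0 h. holomorphic_connection A pr B \<alpha>0 \<and> hermitian_metric A pr B h \<and>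
        (\<forall>t \<ge> 0. D t = ((\<lambda>c b x. \<alpha>0 c b x + t *\<^sub>R \<Phi> c b x), (\<lambda>c b x. 0)) \<and> m t = h))"

text \<open>Control at infinity on a noncompact surface serves to select the metrics \<open>m t\<close>, so that an
  arbitrary family of solutions is admitted there. For \<open>t = 0\<close> there need not be any solution.\<close>

definition hitchin_wkb ::
  "'x::t2_space chart set \<Rightarrow> ('e \<Rightarrow> 'x) \<Rightarrow> ('x, 'e, 'r::finite) triv set \<Rightarrow> ('x, 'e, 'r) coeffs
     \<Rightarrow> (real \<Rightarrow> ('x, 'e, 'r) conn) \<Rightarrow> (real \<Rightarrow> 'e \<Rightarrow> 'e \<Rightarrow> complex) \<Rightarrow> bool" where
  "hitchin_wkb A pr B \<Phi> D m \<longleftrightarrow>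
     (compact (UNIV :: 'x set) \<longrightarrow> stable_higgs A pr B \<Phi>) \<and>
     (\<forall>t > 0. let \<Phi>t = (\<lambda>c b x. t *\<^sub>R \<Phi> c b x) in
        hermitian_yang_mills A pr B \<Phi>t (m t) \<and>
        D t = ((\<lambda>c b x. chern_coeffs pr (m t) c b x + \<Phi>t c b x), adjoint_coeffs pr (m t) \<Phi>t))"

definition log_growth ::
  "'x chart set \<Rightarrow> ('e \<Rightarrow> 'x) \<Rightarrow> ('x, 'e, 'r::finite) triv set \<Rightarrow> ('y::topological_space \<Rightarrow> 'x)
     \<Rightarrow> (real \<Rightarrow> ('x, 'e, 'r) conn) \<Rightarrow> (real \<Rightarrow> 'e \<Rightarrow> 'e \<Rightarrow> complex) \<Rightarrow> 'y \<Rightarrow> 'y \<Rightarrow> real \<Rightarrow> real" where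
  "log_growth A pr B p D m P Q t =
     1 / t * ln (op_norm pr p (m t) P (transport A pr B p (D t) P Q))"

definition wkb_exponent :: "(real \<Rightarrow> real) \<Rightarrow> ereal" where
  "wkb_exponent f = Limsup at_top (\<lambda>t. ereal (f t))"

text \<open>Ultrafilters on the set of parameters, in the terminology of filters: a set \<open>S\<close> belongs to
  \<open>\<omega>\<close> iff \<open>t \<in> S\<close> holds eventually. As \<open>t\<close> is a continuous parameter tending to infinity,
  nonprincipality has to exclude the ultrafilters with a bounded member too.\<close>

definition wkb_ultrafilter :: "real filter \<Rightarrow> bool" where
  "wkb_ultrafilter \<omega> \<longleftrightarrow> \<omega> \<noteq> bot \<and>
     (\<forall>S. eventually (\<lambda>t. t \<in> S) \<omega> \<or> eventually (\<lambda>t. t \<notin> S) \<omega>) \<and>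
     (\<forall>a. \<not> eventually (\<lambda>t. t = a) \<omega>) \<and> \<omega> \<le> at_top"

definition ultrafilter_exponent :: "real filter \<Rightarrow> (real \<Rightarrow> real) \<Rightarrow> ereal" where
  "ultrafilter_exponent \<omega> f = Lim \<omega> (\<lambda>t. ereal (f t))"

lemma tendsto_ultrafilter_exponent:
  assumes "wkb_ultrafilter \<omega>"
  shows "((\<lambda>t. ereal (f t)) \<longlongrightarrow> ultrafilter_exponent \<omega> f) \<omega>"
proof -
  let ?g = "\<lambda>t. ereal (f t)"
  have nb: "\<omega> \<noteq> bot" and
    ult: "eventually (\<lambda>t. t \<in> S) \<omega> \<or> eventually (\<lambda>t. t \<notin> S) \<omega>" for S
    using assms unfolding wkb_ultrafilter_def by auto
  have "filtermap ?g \<omega> \<noteq> bot"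
    using nb by (simp add: filtermap_bot_iff)
  then obtain l where l: "inf (nhds l) (filtermap ?g \<omega>) \<noteq> bot"
    using compact_UNIV[where 'a = ereal] unfolding compact_filter by fastforce
  have "(?g \<longlongrightarrow> l) \<omega>"
  proof (rule topological_tendstoI)
    fix S assume S: "open S" "l \<in> S"
    show "eventually (\<lambda>t. ?g t \<in> S) \<omega>"
    proof (rule ccontr)
      assume "\<not> ?thesis"
      with ult[of "?g -` S"] have "eventually (\<lambda>y. y \<notin> S) (filtermap ?g \<omega>)"
        by (auto simp: eventually_filtermap)
      moreover have "eventually (\<lambda>y. y \<in> S) (nhds l)"
        using S by (auto simp: eventually_nhds)
      ultimately have "eventually (\<lambda>y. False) (inf (nhds l) (filtermap ?g \<omega>))"
        unfolding eventually_inf by blast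
      with l show False by (simp add: trivial_limit_def)
    qed
  qed
  with nb show ?thesis
    unfolding ultrafilter_exponent_def by (simp add: tendsto_Lim)
qed

subsection \<open>Noncritical paths\<close>

definition eigenvalues :: "complex ^ 'r ^ 'r::finite \<Rightarrow> complex set" where
  "eigenvalues M = {l. \<exists>v. v \<noteq> 0 \<and> M *v v = l *s v}"

text \<open>If \<open>l\<close> runs over the eigenvalues of the coefficient matrix, then \<open>l dz\<close> are the values of the
  eigen-1-forms, and \<open>Re (l z')\<close> the coefficients of the pullbacks of their real parts to \<open>[0, 1]\<close>. That
  all \<open>r\<close> of these are distinct implies that the eigenvalues are.\<close>

definition noncritical ::
  "'x chart set \<Rightarrow> ('x, 'e, 'r::finite) triv set \<Rightarrow> ('y::topological_space \<Rightarrow> 'x) \<Rightarrow> ('x, 'e, 'r) coeffs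
     \<Rightarrow> (real \<Rightarrow> 'y) \<Rightarrow> bool" where
  "noncritical A B p \<Phi> \<gamma> \<longleftrightarrow> C1_path A p \<gamma> \<and>
     (\<forall>\<tau> \<in> {0..1}. \<forall>c \<in> A. \<forall>b \<in> B. p (\<gamma> \<tau>) \<in> fst c \<inter> fst b \<longrightarrow>
        card (eigenvalues (\<Phi> c b (p (\<gamma> \<tau>)))) = CARD('r) \<and>
        inj_on (\<lambda>l. Re (l * path_speed p c \<gamma> \<tau>)) (eigenvalues (\<Phi> c b (p (\<gamma> \<tau>)))))"

end

theory Submission
  imports Defs
begin

text \<open>Every ultrafilter containing the neighbourhoods of infinity picks out a cluster value of the exponent,
  which gives the inequality and (b); for (a) one refines the filter of the sets where the exponent
  exceeds numbers below its limit superior.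

  In the local WKB case the transport of \<open>\<nabla>\<^sub>0 + t \<phi>\<close> is independent of the path, because holomorphic
  connections on a Riemann surface are flat: their local flat sections, obtained by Picard iteration,
  form a local system, which has no monodromy on the simply connected cover. Along the given path the
  transport solves \<open>v' = (t M + N) v\<close>, where the eigenvalues of \<open>M\<close> are minus those of \<open>\<phi>\<close> times the speed
  and have distinct real parts. Let \<open>\<mu>\<close> be the largest real part. At each time, diagonal quadratic forms
  in an eigenbasis satisfy \<open>q' > 2 t (\<mu> - \<delta>) q\<close> (signature \<open>(1, r - 1)\<close>, positive on the leading
  eigenline) and \<open>q' > 2 t (\<mu> + \<delta>) q\<close> (negative definite) strictly, for \<open>t\<close> large. These are open convex
  conditions on \<open>q\<close>, so constant local solutions can be glued by a partition of unity along the path;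
  integrating yields \<open>exp (t (\<integral>\<mu> - \<delta>))\<close> and \<open>exp (t (\<integral>\<mu> + \<delta>))\<close> as lower and upper bounds for the norm, up
  to constants. Hence the limit exists and equals \<open>\<integral>\<mu>\<close>.\<close>

text \<open>The classical WKB argument diagonalises \<phi> along the path by a gauge transformation
  and absorbs the derivative of the gauge into the error. Here the path is only continuously
  differentiable, so the coefficient matrix is only continuous, and in general so is any eigenframe.
  Quadratic forms avoid the difficulty: a form built from the eigenbasis at one frozen time keeps
  its strict inequality at nearby times, and apart from the solution only the bump functions get
  differentiated. Their derivatives cost O(1) while strictness gains a multiple of \<open>t\<close>,
  hence the restriction to large \<open>t\<close>. The forms are functions on the fibres, so pieces
  written in different trivialisations can be added. A lower bound for an operator norm needs one
  vector only; the indefinite form supplies it, since a solution starting in its positive cone stays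
  there and grows. Path independence cannot be bypassed: \<open>transport\<close> is a definite
  description ranging over all paths with the given end points, so its value is unknown until
  uniqueness is proved.\<close>

no_notation fps_nth (infixl "$" 75)

section \<open>Ultrafilter limits\<close>

text \<open>Ultrafilters are the minimal proper filters. Zorn's lemma gives a minimal one below
  \<open>F\<close>; if it does not contain the complement of \<open>T\<close>, its restriction to
  \<open>T\<close> is again proper, so by minimality it is the same filter.\<close>

lemma exists_ultrafilter_below:
  fixes F :: "'a filter"
  assumes "F \<noteq> bot"
  obtains U where "U \<le> F" "U \<noteq> bot"
    "\<And>S. eventually (\<lambda>x. x \<in> S) U \<or> eventually (\<lambda>x. x \<notin> S) U"
proof -
  define S where "S = {G. G \<noteq> bot \<and> G \<le> F}"
  have "\<exists>U\<in>S. \<forall>G\<in>S. G \<le> U \<longrightarrow> G = U"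
  proof (rule predicate_Zorn[where P = "\<lambda>G H. H \<le> G", simplified])
    show "partial_order_on S (relation_of (\<lambda>G H. H \<le> G) S)"
      by (rule partial_order_on_relation_ofI) auto
  next
    fix C assume C: "C \<in> Chains (relation_of (\<lambda>G H. H \<le> G) S)"
    then have CS: "C \<subseteq> S"
      by (rule Chains_relation_of)
    have ch: "G \<le> H \<or> H \<le> G" if "G \<in> C" "H \<in> C" for G H
      using C that by (auto simp: Chains_def relation_of_def)
    show "\<exists>L\<in>S. \<forall>G\<in>C. L \<le> G"
    proof (cases "C = {}")
      case True
      then show ?thesis using assms by (auto simp: S_def)
    next
      case False
      \<comment> \<open>What holds eventually for the infimum of a chain of filters already holds
        eventually for some member, so a contradiction would show up in a proper filter.\<close>
      have "Inf C \<noteq> bot"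
        unfolding trivial_limit_def
      proof
        assume "eventually (\<lambda>x. False) (Inf C)"
        then obtain G where "G \<in> C" "eventually (\<lambda>x. False) G"
          using eventually_Inf_base[OF False, of "\<lambda>x. False"] ch by (meson inf.order_iff inf.bounded_iff order_refl)
        then show False using CS by (auto simp: S_def trivial_limit_def)
      qed
      moreover have "Inf C \<le> F"
      proof -
        obtain G where "G \<in> C" using False by auto
        then show ?thesis using CS Inf_lower[of G C] unfolding S_def by (auto intro: order_trans)
      qed
      ultimately show ?thesis
        by (intro bexI[of _ "Inf C"]) (auto simp: S_def intro: Inf_lower)
    qed
  qed
  then obtain U where U: "U \<noteq> bot" "U \<le> F" and max: "\<And>G. G \<noteq> bot \<Longrightarrow> G \<le> U \<Longrightarrow> G = U"
    unfolding S_def by (auto intro: order_trans)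
  have "eventually (\<lambda>x. x \<in> T) U \<or> eventually (\<lambda>x. x \<notin> T) U" for T
  proof (rule disjCI)
    assume "\<not> eventually (\<lambda>x. x \<notin> T) U"
    then have "inf U (principal T) \<noteq> bot"
      by (simp add: trivial_limit_def eventually_inf_principal)
    then have "inf U (principal T) = U" by (rule max) simp
    moreover have "eventually (\<lambda>x. x \<in> T) (inf U (principal T))"
      by (simp add: eventually_inf_principal)
    ultimately show "eventually (\<lambda>x. x \<in> T) U" by simp
  qed
  with U that show ?thesis by blast
qed

text \<open>A limit is also a limit superior, and the limit superior can only drop when
  \<open>at_top\<close> is refined to \<omega>.\<close>

lemma ultrafilter_exponent_le:
  assumes "wkb_ultrafilter \<omega>"
  shows "ultrafilter_exponent \<omega> f \<le> wkb_exponent f"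
proof -
  have "\<omega> \<noteq> bot" "\<omega> \<le> at_top"
    using assms by (auto simp: wkb_ultrafilter_def)
  then have "ultrafilter_exponent \<omega> f = Limsup \<omega> (\<lambda>t. ereal (f t))"
    using lim_imp_Limsup tendsto_ultrafilter_exponent[OF assms] by metis
  also have "\<dots> \<le> wkb_exponent f"
    unfolding wkb_exponent_def Limsup_def
    by (rule INF_superset_mono) (use \<open>\<omega> \<le> at_top\<close> in \<open>auto dest: filter_leD\<close>)
  finally show ?thesis .
qed

lemma ultrafilter_exponent_eqI:
  assumes "wkb_ultrafilter \<omega>" "((\<lambda>t. ereal (f t)) \<longlongrightarrow> L) at_top"
  shows "ultrafilter_exponent \<omega> f = L" "wkb_exponent f = L"
proof -
  have "\<omega> \<noteq> bot" "\<omega> \<le> at_top"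
    using assms by (auto simp: wkb_ultrafilter_def)
  then show "ultrafilter_exponent \<omega> f = L"
    using tendsto_unique tendsto_ultrafilter_exponent[OF assms(1)] tendsto_mono assms(2) by metis
  show "wkb_exponent f = L"
    unfolding wkb_exponent_def using assms(2) by (intro lim_imp_Limsup) auto
qed

text \<open>The ultrafilter refines the filter generated by the sets \<open>{t. f t > y}\<close> with \<open>y\<close> below the
  limit superior.\<close>

lemma ultrafilter_exponent_attained:
  "\<exists>\<omega>. wkb_ultrafilter \<omega> \<and> ultrafilter_exponent \<omega> f = wkb_exponent f"
proof -
  define L where "L = wkb_exponent f"
  define G where "G y = inf at_top (principal {t. y < ereal (f t)})" for y
  \<comment> \<open>The extra \<open>at_top\<close> matters for \<open>L = -\<infinity>\<close>: the
    index set is then empty and its infimum is the greatest filter, while any ultrafilter tending to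
    infinity attains the value.\<close>
  define F where "F = inf at_top (INF y\<in>{..<L}. G y)"
  have "F \<noteq> bot"
  proof (cases "L = -\<infinity>")
    case False
    have "G y \<noteq> bot" if "y < L" for y
    proof
      assume "G y = bot"
      then have "eventually (\<lambda>t. ereal (f t) \<le> y) at_top"
        by (simp add: G_def trivial_limit_def eventually_inf_principal not_less)
      then have "L \<le> y"
        unfolding L_def wkb_exponent_def by (rule Limsup_bounded)
      with that show False by simp
    qed
    moreover have mono: "G b \<le> G a" if "a \<le> b" for a b
      unfolding G_def using that by (intro inf_mono) auto
    have "\<exists>z\<in>{..<L}. G z \<le> inf (G x) (G y)" if "x \<in> {..<L}" "y \<in> {..<L}" for x y
      using that by (intro bexI[of _ "max x y"]) (auto intro: mono)
    ultimately have "(INF y\<in>{..<L}. G y) \<noteq> bot"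
      by (subst INF_filter_bot_base) auto
    moreover have "(INF y\<in>{..<L}. G y) \<le> at_top"
    proof -
      have "-\<infinity> \<in> {..<L}" using False by (simp add: less_le)
      then show ?thesis unfolding G_def by (meson INF_lower2 inf_le1)
    qed
    ultimately show ?thesis by (simp add: F_def inf_absorb2)
  qed (simp add: F_def lessThan_def)
  then obtain \<omega> where \<omega>: "\<omega> \<le> F" "\<omega> \<noteq> bot"
    "\<And>S. eventually (\<lambda>x. x \<in> S) \<omega> \<or> eventually (\<lambda>x. x \<notin> S) \<omega>"
    by (rule exists_ultrafilter_below) blast
  have top: "\<omega> \<le> at_top"
    using \<omega>(1) unfolding F_def by simp
  have "\<not> eventually (\<lambda>t. t = a) \<omega>" for a
  proof
    assume "eventually (\<lambda>t. t = a) \<omega>"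
    moreover have "eventually (\<lambda>t. t > a) \<omega>"
      using top eventually_gt_at_top filter_leD by blast
    ultimately have "eventually (\<lambda>t. False) \<omega>" by eventually_elim auto
    with \<omega>(2) show False by (simp add: trivial_limit_def)
  qed
  then have w: "wkb_ultrafilter \<omega>"
    using \<omega> top by (auto simp: wkb_ultrafilter_def)
  have "y \<le> ultrafilter_exponent \<omega> f" if "y < L" for y
  proof -
    have "\<omega> \<le> G y"
      using \<omega>(1) that unfolding F_def by (auto simp: le_INF_iff)
    then have "eventually (\<lambda>t. y \<le> ereal (f t)) \<omega>"
      by (rule filter_leD) (simp add: G_def eventually_inf_principal less_imp_le)
    with \<omega>(2) tendsto_ultrafilter_exponent[OF w] show ?thesis
      by (metis tendsto_lowerbound)
  qed
  then have "L \<le> ultrafilter_exponent \<omega> f" by (rule dense_le)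
  with w ultrafilter_exponent_le[OF w, of f] show ?thesis
    by (auto simp: L_def intro!: antisym)
qed

section \<open>Local systems\<close>

lemma continuous_on_nhd:
  assumes "continuous_on Z H" "open M" "z \<in> Z" "H z \<in> M"
  obtains N where "open N" "z \<in> N" "\<And>z'. z' \<in> N \<Longrightarrow> z' \<in> Z \<Longrightarrow> H z' \<in> M"
proof -
  obtain N where "open N" "N \<inter> Z = H -` M \<inter> Z"
    using assms(1,2) unfolding continuous_on_open_invariant by metis
  with assms(3,4) that[of N] show ?thesis by blast
qed

text \<open>An abstract form of the covering space of germs of flat sections. The total space
  \<open>'e\<close> carries no topology; \<open>flat\<close> takes its place.
  \<open>flat_exists\<close> provides a full set of sections over a small set, and
  \<open>flat_unique\<close> says that near a common point agreement somewhere is agreement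
  everywhere. The usual proofs of path and homotopy lifting then apply, without reference to
  connections.\<close>

locale local_system =
  fixes pr :: "'e \<Rightarrow> 'x::topological_space"
    and flat :: "'x set \<Rightarrow> ('x \<Rightarrow> 'e) \<Rightarrow> bool"
  assumes flat_section: "flat V g \<Longrightarrow> x \<in> V \<Longrightarrow> pr (g x) = x"
    and flat_exists: "\<exists>V. open V \<and> x0 \<in> V \<and> (\<forall>x \<in> V. \<forall>e. pr e = x \<longrightarrow> (\<exists>g. flat V g \<and> g x = e))"
    and flat_unique: "flat V g \<Longrightarrow> flat V' g' \<Longrightarrow> x \<in> V \<inter> V' \<Longrightarrow>
      \<exists>N. open N \<and> x \<in> N \<and> N \<subseteq> V \<inter> V' \<and> (\<forall>a\<in>N. \<forall>b\<in>N. g a = g' a \<longrightarrow> g b = g' b)"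
begin

text \<open>Stands in for continuity into \<open>'e\<close>: near each point a single flat section,
  evaluated along \<open>H\<close>, describes \<sigma>. The domain is arbitrary because both
  intervals and squares are lifted.\<close>

definition is_lift :: "'z::topological_space set \<Rightarrow> ('z \<Rightarrow> 'x) \<Rightarrow> ('z \<Rightarrow> 'e) \<Rightarrow> bool" where
  "is_lift Z H \<sigma> \<longleftrightarrow> (\<forall>z \<in> Z. \<exists>V g N. flat V g \<and> open N \<and> z \<in> N \<and>
     (\<forall>z' \<in> N \<inter> Z. H z' \<in> V \<and> \<sigma> z' = g (H z')))"

lemma is_liftE:
  assumes "is_lift Z H \<sigma>" "z \<in> Z"
  obtains V g N where "flat V g" "open N" "z \<in> N"
    "\<And>z'. z' \<in> N \<Longrightarrow> z' \<in> Z \<Longrightarrow> H z' \<in> V" "\<And>z'. z' \<in> N \<Longrightarrow> z' \<in> Z \<Longrightarrow> \<sigma> z' = g (H z')"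
  using bspec[OF assms(1)[unfolded is_lift_def] assms(2)] by auto

lemma is_liftI:
  assumes "\<And>z. z \<in> Z \<Longrightarrow> \<exists>V g N. flat V g \<and> open N \<and> z \<in> N \<and>
     (\<forall>z' \<in> N \<inter> Z. H z' \<in> V \<and> \<sigma> z' = g (H z'))"
  shows "is_lift Z H \<sigma>"
  unfolding is_lift_def using assms by (rule ballI)

lemma lift_projection:
  assumes "is_lift Z H \<sigma>" "z \<in> Z"
  shows "pr (\<sigma> z) = H z"
  using is_liftE[OF assms] assms(2) flat_section by metis

lemma lift_subset:
  assumes "is_lift Z H \<sigma>" "Z' \<subseteq> Z"
  shows "is_lift Z' H \<sigma>"
proof (rule is_liftI)
  fix z assume "z \<in> Z'"
  with assms(2) have "z \<in> Z" by auto
  then obtain V g N where "flat V g" "open N" "z \<in> N"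
      "\<And>z'. z' \<in> N \<Longrightarrow> z' \<in> Z \<Longrightarrow> H z' \<in> V" "\<And>z'. z' \<in> N \<Longrightarrow> z' \<in> Z \<Longrightarrow> \<sigma> z' = g (H z')"
    using is_liftE[OF assms(1)] by metis
  then show "\<exists>V g N. flat V g \<and> open N \<and> z \<in> N \<and> (\<forall>z' \<in> N \<inter> Z'. H z' \<in> V \<and> \<sigma> z' = g (H z'))"
    using assms(2) by (intro exI[of _ V] exI[of _ g] exI[of _ N]) auto
qed

lemma lift_cong:
  assumes "is_lift Z H \<sigma>" "\<And>z. z \<in> Z \<Longrightarrow> H z = H' z"
  shows "is_lift Z H' \<sigma>"
proof -
  have "(\<forall>z' \<in> N \<inter> Z. H z' \<in> V \<and> \<sigma> z' = g (H z')) \<longleftrightarrow> (\<forall>z' \<in> N \<inter> Z. H' z' \<in> V \<and> \<sigma> z' = g (H' z'))"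
    for N V g using assms(2) by auto
  with assms(1) show ?thesis unfolding is_lift_def by simp
qed

lemma lift_compose:
  assumes "is_lift Z H \<sigma>" "continuous_on Z' k" "k ` Z' \<subseteq> Z"
  shows "is_lift Z' (H \<circ> k) (\<sigma> \<circ> k)"
proof (rule is_liftI)
  fix z assume z: "z \<in> Z'"
  then have "k z \<in> Z" using assms by auto
  then obtain V g N where N: "flat V g" "open N" "k z \<in> N"
      "\<And>z'. z' \<in> N \<Longrightarrow> z' \<in> Z \<Longrightarrow> H z' \<in> V" "\<And>z'. z' \<in> N \<Longrightarrow> z' \<in> Z \<Longrightarrow> \<sigma> z' = g (H z')"
    using is_liftE[OF assms(1)] by metis
  obtain N' where N': "open N'" "z \<in> N'" "\<And>z'. z' \<in> N' \<Longrightarrow> z' \<in> Z' \<Longrightarrow> k z' \<in> N"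
    using continuous_on_nhd[OF assms(2) N(2) z N(3)] by metis
  show "\<exists>V g N. flat V g \<and> open N \<and> z \<in> N \<and>
     (\<forall>z' \<in> N \<inter> Z'. (H \<circ> k) z' \<in> V \<and> (\<sigma> \<circ> k) z' = g ((H \<circ> k) z'))"
    using N N' assms(3) by (intro exI[of _ V] exI[of _ g] exI[of _ N']) auto
qed

text \<open>By \<open>flat_unique\<close> every point of \<open>Z\<close> has a neighbourhood on
  which the two lifts agree everywhere or nowhere, and \<open>Z\<close> is connected.\<close>

lemma lift_unique:
  fixes Z :: "'z::topological_space set"
  assumes "connected Z" "continuous_on Z H" "is_lift Z H \<sigma>" "is_lift Z H \<sigma>'"
    and "a \<in> Z" "\<sigma> a = \<sigma>' a" "b \<in> Z"
  shows "\<sigma> b = \<sigma>' b"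
proof (rule connected_induction_simple[OF assms(1) assms(5) assms(7), where P = "\<lambda>z. \<sigma> z = \<sigma>' z"])
  fix z assume z: "z \<in> Z"
  obtain V g N where N: "flat V g" "open N" "z \<in> N"
      "\<And>z'. z' \<in> N \<Longrightarrow> z' \<in> Z \<Longrightarrow> H z' \<in> V" "\<And>z'. z' \<in> N \<Longrightarrow> z' \<in> Z \<Longrightarrow> \<sigma> z' = g (H z')"
    using is_liftE[OF assms(3) z] by metis
  obtain V' g' N' where N': "flat V' g'" "open N'" "z \<in> N'"
      "\<And>z'. z' \<in> N' \<Longrightarrow> z' \<in> Z \<Longrightarrow> H z' \<in> V'" "\<And>z'. z' \<in> N' \<Longrightarrow> z' \<in> Z \<Longrightarrow> \<sigma>' z' = g' (H z')"
    using is_liftE[OF assms(4) z] by metis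
  have "H z \<in> V \<inter> V'" using N N' z by auto
  then obtain M where M: "open M" "H z \<in> M" "\<forall>a\<in>M. \<forall>b\<in>M. g a = g' a \<longrightarrow> g b = g' b"
    using flat_unique[OF N(1) N'(1)] by metis
  obtain M' where M': "open M'" "z \<in> M'" "\<And>z'. z' \<in> M' \<Longrightarrow> z' \<in> Z \<Longrightarrow> H z' \<in> M"
    using continuous_on_nhd[OF assms(2) M(1) z M(2)] by metis
  show "\<exists>T. openin (top_of_set Z) T \<and> z \<in> T \<and> (\<forall>x \<in> T. \<forall>y \<in> T. \<sigma> x = \<sigma>' x \<longrightarrow> \<sigma> y = \<sigma>' y)"
  proof (intro exI[of _ "Z \<inter> (N \<inter> N' \<inter> M')"] conjI ballI impI)
    show "openin (top_of_set Z) (Z \<inter> (N \<inter> N' \<inter> M'))"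
      using N N' M' by (intro openin_open_Int open_Int)
    show "z \<in> Z \<inter> (N \<inter> N' \<inter> M')" using z N(3) N'(3) M'(2) by simp
    fix x y assume *: "x \<in> Z \<inter> (N \<inter> N' \<inter> M')" "y \<in> Z \<inter> (N \<inter> N' \<inter> M')" "\<sigma> x = \<sigma>' x"
    then have eqs: "\<sigma> x = g (H x)" "\<sigma>' x = g' (H x)" "\<sigma> y = g (H y)" "\<sigma>' y = g' (H y)"
      by (simp_all only: N(5) N'(5) Int_iff)
    have "H x \<in> M" "H y \<in> M" using M'(3) *(1,2) by blast+
    moreover have "g (H x) = g' (H x)" using *(3) by (simp only: eqs)
    ultimately have "g (H y) = g' (H y)" using M(3) by blast
    then show "\<sigma> y = \<sigma>' y" by (simp only: eqs)
  qed
qed (use assms in auto)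

text \<open>The value may be prescribed at any point, not only at a base point. This makes the
  property stable under gluing: the value reached on the overlap becomes the prescription for the
  other piece.\<close>

definition liftable :: "('z::topological_space \<Rightarrow> 'x) \<Rightarrow> 'z set \<Rightarrow> bool" where
  "liftable H Z \<longleftrightarrow> (\<forall>z \<in> Z. \<forall>e. pr e = H z \<longrightarrow> (\<exists>\<sigma>. is_lift Z H \<sigma> \<and> \<sigma> z = e))"

text \<open>Connectedness of the overlap forces the two partial lifts to agree on all of it;
  closedness lets a point of one piece alone have a neighbourhood that misses the other
  piece.\<close>

lemma liftable_Un_aux:
  fixes A B :: "'z::topological_space set"
  assumes "closed A" "closed B" "connected (A \<inter> B)" "A \<inter> B \<noteq> {}" "continuous_on (A \<union> B) H"
    and "liftable H A" "liftable H B" "z \<in> A" "pr e = H z"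
  shows "\<exists>\<sigma>. is_lift (A \<union> B) H \<sigma> \<and> \<sigma> z = e"
proof -
  obtain \<sigma>A where A: "is_lift A H \<sigma>A" "\<sigma>A z = e"
    using assms by (auto simp: liftable_def)
  obtain z1 where z1: "z1 \<in> A \<inter> B" using assms by auto
  then have "pr (\<sigma>A z1) = H z1" using lift_projection A by auto
  then obtain \<sigma>B where B: "is_lift B H \<sigma>B" "\<sigma>B z1 = \<sigma>A z1"
    using assms(7) z1 by (auto simp: liftable_def)
  have eq: "\<sigma>A y = \<sigma>B y" if "y \<in> A \<inter> B" for y
    by (rule lift_unique[OF assms(3) continuous_on_subset[OF assms(5)]
          lift_subset[OF A(1)] lift_subset[OF B(1)] z1 B(2)[symmetric] that]) auto
  define \<sigma> where "\<sigma> y = (if y \<in> A then \<sigma>A y else \<sigma>B y)" for y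
  have \<sigma>B: "\<sigma> y = \<sigma>B y" if "y \<in> B" for y using eq that by (auto simp: \<sigma>_def)
  have "is_lift (A \<union> B) H \<sigma>"
  proof (rule is_liftI)
    fix y assume y: "y \<in> A \<union> B"
    let ?goal = "\<exists>V g N. flat V g \<and> open N \<and> y \<in> N \<and>
       (\<forall>z' \<in> N \<inter> (A \<union> B). H z' \<in> V \<and> \<sigma> z' = g (H z'))"
    consider "y \<in> A" "y \<notin> B" | "y \<in> B" "y \<notin> A" | "y \<in> A" "y \<in> B" using y by auto
    then show ?goal
    proof cases
      case 1
      obtain V g N where "flat V g" "open N" "y \<in> N"
          "\<And>z'. z' \<in> N \<Longrightarrow> z' \<in> A \<Longrightarrow> H z' \<in> V" "\<And>z'. z' \<in> N \<Longrightarrow> z' \<in> A \<Longrightarrow> \<sigma>A z' = g (H z')"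
        using is_liftE[OF A(1) 1(1)] by metis
      then show ?thesis using 1 assms(2)
        by (intro exI[of _ V] exI[of _ g] exI[of _ "N \<inter> - B"]) (auto simp: \<sigma>_def)
    next
      case 2
      obtain V g N where "flat V g" "open N" "y \<in> N"
          "\<And>z'. z' \<in> N \<Longrightarrow> z' \<in> B \<Longrightarrow> H z' \<in> V" "\<And>z'. z' \<in> N \<Longrightarrow> z' \<in> B \<Longrightarrow> \<sigma>B z' = g (H z')"
        using is_liftE[OF B(1) 2(1)] by metis
      then show ?thesis using 2 assms(1)
        by (intro exI[of _ V] exI[of _ g] exI[of _ "N \<inter> - A"]) (auto simp: \<sigma>_def)
    next
      case 3
      obtain V g N where N: "flat V g" "open N" "y \<in> N"
          "\<And>z'. z' \<in> N \<Longrightarrow> z' \<in> A \<Longrightarrow> H z' \<in> V" "\<And>z'. z' \<in> N \<Longrightarrow> z' \<in> A \<Longrightarrow> \<sigma>A z' = g (H z')"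
        using is_liftE[OF A(1) 3(1)] by metis
      obtain V' g' N' where N': "flat V' g'" "open N'" "y \<in> N'"
          "\<And>z'. z' \<in> N' \<Longrightarrow> z' \<in> B \<Longrightarrow> H z' \<in> V'" "\<And>z'. z' \<in> N' \<Longrightarrow> z' \<in> B \<Longrightarrow> \<sigma>B z' = g' (H z')"
        using is_liftE[OF B(1) 3(2)] by metis
      \<comment> \<open>The flat sections describing the two partial lifts agree at
        \<open>H y\<close>, hence near it, so \<open>g\<close> alone describes both.\<close>
      have "H y \<in> V \<inter> V'" using N N' 3 by auto
      then obtain M where M: "open M" "H y \<in> M" "M \<subseteq> V \<inter> V'" "\<forall>a\<in>M. \<forall>b\<in>M. g a = g' a \<longrightarrow> g b = g' b"
        using flat_unique[OF N(1) N'(1)] by metis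
      have "g (H y) = g' (H y)" using N(5)[OF N(3) 3(1)] N'(5)[OF N'(3) 3(2)] eq[of y] 3 by (metis IntI)
      with M(2,4) have gg: "g a = g' a" if "a \<in> M" for a using that by blast
      obtain M' where M': "open M'" "y \<in> M'" "\<And>z'. z' \<in> M' \<Longrightarrow> z' \<in> A \<union> B \<Longrightarrow> H z' \<in> M"
        using continuous_on_nhd[OF assms(5) M(1) y M(2)] by metis
      have *: "H z' \<in> V \<and> \<sigma> z' = g (H z')" if z': "z' \<in> N" "z' \<in> N'" "z' \<in> M'" "z' \<in> A \<union> B" for z'
      proof (cases "z' \<in> A")
        case True
        then show ?thesis using N(4,5) z' by (simp add: \<sigma>_def)
      next
        case False
        then have "z' \<in> B" using z' by simp
        then have "\<sigma> z' = g' (H z')" using N'(5)[OF z'(2)] \<sigma>B[of z'] by simp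
        moreover have "H z' \<in> M" using M'(3) z' by blast
        ultimately show ?thesis using gg[of "H z'"] M(3) by auto
      qed
      show ?thesis
        by (rule exI[of _ V], rule exI[of _ g], rule exI[of _ "N \<inter> N' \<inter> M'"])
          (use N(1-3) N'(2,3) M'(1,2) * in auto)
    qed
  qed
  then show ?thesis using A assms(8) by (auto simp: \<sigma>_def)
qed

lemma liftable_Un:
  fixes A B :: "'z::topological_space set"
  assumes "closed A" "closed B" "connected (A \<inter> B)" "A \<inter> B \<noteq> {}" "continuous_on (A \<union> B) H"
    and "liftable H A" "liftable H B"
  shows "liftable H (A \<union> B)"
proof -
  have BA: "connected (B \<inter> A)" "B \<inter> A \<noteq> {}" "continuous_on (B \<union> A) H"
    using assms(3-5) by (simp_all add: Int_commute Un_commute)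
  have "\<exists>\<sigma>. is_lift (A \<union> B) H \<sigma> \<and> \<sigma> z = e" if "z \<in> A \<union> B" "pr e = H z" for z e
  proof (cases "z \<in> A")
    case True
    then show ?thesis using liftable_Un_aux[OF assms] that(2) by simp
  next
    case False
    then have "z \<in> B" using that(1) by simp
    from liftable_Un_aux[OF assms(2,1) BA assms(7,6) this that(2)] show ?thesis
      by (simp add: Un_commute)
  qed
  then show ?thesis by (simp add: liftable_def)
qed

section \<open>Lifting of squares and paths, trivial monodromy\<close>

lemma liftable_locally:
  assumes "continuous_on Z H" "z \<in> Z"
  obtains N where "open N" "z \<in> N" "\<And>Z'. Z' \<subseteq> N \<inter> Z \<Longrightarrow> liftable H Z'"
proof -
  obtain V where V: "open V" "H z \<in> V" "\<forall>x \<in> V. \<forall>e. pr e = x \<longrightarrow> (\<exists>g. flat V g \<and> g x = e)"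
    using flat_exists[of "H z"] by blast
  obtain N where N: "open N" "z \<in> N" "\<And>z'. z' \<in> N \<Longrightarrow> z' \<in> Z \<Longrightarrow> H z' \<in> V"
    using continuous_on_nhd[OF assms(1) V(1) assms(2) V(2)] by metis
  have "liftable H Z'" if "Z' \<subseteq> N \<inter> Z" for Z'
    unfolding liftable_def
  proof (intro ballI allI impI)
    fix z e assume z: "z \<in> Z'" "pr e = H z"
    have HV: "H z' \<in> V" if "z' \<in> Z'" for z' using that \<open>Z' \<subseteq> N \<inter> Z\<close> N(3) by auto
    obtain g where g: "flat V g" "g (H z) = e" using V(3) HV[OF z(1)] z(2) by blast
    have "is_lift Z' H (g \<circ> H)"
      by (rule is_liftI, rule exI[of _ V], rule exI[of _ g], rule exI[of _ UNIV]) (use g HV in auto)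
    then show "\<exists>\<sigma>. is_lift Z' H \<sigma> \<and> \<sigma> z = e" using g by (intro exI[of _ "g \<circ> H"]) auto
  qed
  with that N(1,2) show ?thesis by metis
qed

text \<open>The subdivision argument of homotopy lifting as two nested bisections by
  \<open>Bolzano\<close>: the inner one builds a thin strip of full height, the outer one joins
  strips.\<close>

lemma liftable_square:
  fixes H :: "real \<times> real \<Rightarrow> 'x"
  assumes cont: "continuous_on ({0..1} \<times> {0..1}) H"
  shows "liftable H ({0..1} \<times> {0..1})"
proof -
  \<comment> \<open>\<open>Bolzano\<close> also presents intervals that stick out of the unit
    interval; for these the statement is vacuous.\<close>
  define P where "P a b \<longleftrightarrow> (0 \<le> a \<and> b \<le> 1 \<longrightarrow> liftable H ({a..b} \<times> {0..1}))" for a b :: real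
  have glue1: "liftable H ({a..b} \<times> {c..e})"
    if "liftable H ({a..b} \<times> {c..d})" "liftable H ({a..b} \<times> {d..e})" "c \<le> d" "d \<le> e" "0 \<le> c" "e \<le> 1"
      "0 \<le> a" "b \<le> 1" "a \<le> b"
    for a b c d e :: real
  proof -
    have [simp]: "{a..b} \<times> {c..d} \<inter> {a..b} \<times> {d..e} = {a..b} \<times> {d}"
        "{a..b} \<times> {c..d} \<union> {a..b} \<times> {d..e} = {a..b} \<times> {c..e}"
      using that by auto
    have "liftable H ({a..b} \<times> {c..d} \<union> {a..b} \<times> {d..e})"
      using that by (intro liftable_Un)
        (auto intro!: closed_Times connected_Times continuous_on_subset[OF cont])
    then show ?thesis by simp
  qed
  have glue2: "liftable H ({a..c} \<times> {0..1})"
    if "liftable H ({a..b} \<times> {0..1})" "liftable H ({b..c} \<times> {0..1})" "a \<le> b" "b \<le> c" "0 \<le> a" "c \<le> 1"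
    for a b c :: real
  proof -
    have [simp]: "{a..b} \<times> {0..1::real} \<inter> {b..c} \<times> {0..1} = {b} \<times> {0..1}"
        "{a..b} \<times> {0..1::real} \<union> {b..c} \<times> {0..1} = {a..c} \<times> {0..1}"
      using that by auto
    have "liftable H ({a..b} \<times> {0..1} \<union> {b..c} \<times> {0..1})"
      using that by (intro liftable_Un)
        (auto intro!: closed_Times connected_Times continuous_on_subset[OF cont])
    then show ?thesis by simp
  qed
  have strip: "\<exists>d>0. \<forall>a b. a \<le> s \<and> s \<le> b \<and> b - a < d \<longrightarrow> P a b" if s: "0 \<le> s" "s \<le> 1" for s
  proof -
    \<comment> \<open>The admissible width \<open>d\<close> may depend on \<open>c\<close> and
      \<open>e\<close>. Joining two pieces takes the smaller width, so a positive one survives up to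
      full height.\<close>
    define Q where "Q c e \<longleftrightarrow> (0 \<le> c \<and> e \<le> 1 \<longrightarrow> (\<exists>d>0. \<forall>a b. a \<le> s \<and> s \<le> b \<and> b - a < d \<and> 0 \<le> a \<and> b \<le> 1
         \<longrightarrow> liftable H ({a..b} \<times> {c..e})))" for c e :: real
    have "Q 0 1"
    proof (rule Bolzano)
      fix c d e :: real assume *: "Q c d" "Q d e" "c \<le> d" "d \<le> e"
      show "Q c e"
        unfolding Q_def
      proof
        assume ce: "0 \<le> c \<and> e \<le> 1"
        obtain d1 where d1: "d1 > 0" "\<forall>a b. a \<le> s \<and> s \<le> b \<and> b - a < d1 \<and> 0 \<le> a \<and> b \<le> 1
            \<longrightarrow> liftable H ({a..b} \<times> {c..d})"
          using * ce unfolding Q_def by force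
        obtain d2 where d2: "d2 > 0" "\<forall>a b. a \<le> s \<and> s \<le> b \<and> b - a < d2 \<and> 0 \<le> a \<and> b \<le> 1
            \<longrightarrow> liftable H ({a..b} \<times> {d..e})"
          using * ce unfolding Q_def by force
        show "\<exists>d>0. \<forall>a b. a \<le> s \<and> s \<le> b \<and> b - a < d \<and> 0 \<le> a \<and> b \<le> 1 \<longrightarrow> liftable H ({a..b} \<times> {c..e})"
          using d1 d2 * ce by (intro exI[of _ "min d1 d2"]) (auto intro!: glue1[of _ _ c d e])
      qed
    next
      fix \<tau> :: real assume \<tau>: "0 \<le> \<tau>" "\<tau> \<le> 1"
      obtain N where N: "open N" "(s, \<tau>) \<in> N"
          "\<And>Z'. Z' \<subseteq> N \<inter> ({0..1} \<times> {0..1}) \<Longrightarrow> liftable H Z'"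
        using liftable_locally[OF cont, of "(s,\<tau>)"] s \<tau> by auto
      obtain \<epsilon> where \<epsilon>: "\<epsilon> > 0" "ball (s, \<tau>) \<epsilon> \<subseteq> N"
        using N openE by blast
      show "\<exists>d>0. \<forall>c e. c \<le> \<tau> \<and> \<tau> \<le> e \<and> e - c < d \<longrightarrow> Q c e"
      proof (intro exI[of _ "\<epsilon>/2"] conjI allI impI)
        fix c e assume ce: "c \<le> \<tau> \<and> \<tau> \<le> e \<and> e - c < \<epsilon>/2"
        have "liftable H ({a..b} \<times> {c..e})" if "0 \<le> c" "e \<le> 1" "a \<le> s \<and> s \<le> b \<and> b - a < \<epsilon>/2 \<and> 0 \<le> a \<and> b \<le> 1" for a b
        proof (rule N(3))
          have "dist (s, \<tau>) (x, y) < \<epsilon>" if "x \<in> {a..b}" "y \<in> {c..e}" for x y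
          proof -
            have "dist (s, \<tau>) (x, y) \<le> dist s x + dist \<tau> y"
              unfolding dist_prod_def by (simp add: sqrt_sum_squares_le_sum)
            also have "\<dots> < \<epsilon>"
              using that ce \<open>a \<le> s \<and> _\<close> by (auto simp: dist_real_def abs_real_def)
            finally show ?thesis .
          qed
          then show "{a..b} \<times> {c..e} \<subseteq> N \<inter> ({0..1} \<times> {0..1})"
            using \<epsilon>(2) that by (auto simp: subset_iff)
        qed
        then show "Q c e" unfolding Q_def using \<epsilon>(1) by (auto intro!: exI[of _ "\<epsilon>/2"])
      qed (use \<epsilon> in auto)
    qed auto
    then obtain d where "d > 0" "\<forall>a b. a \<le> s \<and> s \<le> b \<and> b - a < d \<and> 0 \<le> a \<and> b \<le> 1
         \<longrightarrow> liftable H ({a..b} \<times> {0..1})"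
      unfolding Q_def by auto
    then show ?thesis unfolding P_def by blast
  qed
  have "P 0 1"
  proof (rule Bolzano)
    fix a b c assume "P a b" "P b c" "a \<le> b" "b \<le> c"
    then show "P a c" unfolding P_def using glue2[of a b c] by auto
  qed (use strip in auto)
  then show ?thesis by (simp add: P_def)
qed

text \<open>A path is a square that is constant in its first coordinate; restricting the lift of the
  square to an edge saves a second subdivision argument.\<close>

lemma path_lift_exists:
  assumes "continuous_on {0..1} \<gamma>" "pr e = \<gamma> 0"
  obtains \<sigma> where "is_lift {0..1::real} \<gamma> \<sigma>" "\<sigma> 0 = e"
proof -
  have "continuous_on ({0..1} \<times> {0..1}) (\<gamma> \<circ> snd)"
    by (intro continuous_on_compose continuous_intros) (rule continuous_on_subset[OF assms(1)], auto)
  from liftable_square[OF this] obtain \<sigma> :: "real \<times> real \<Rightarrow> _"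
    where \<sigma>: "is_lift ({0..1} \<times> {0..1}) (\<gamma> \<circ> snd) \<sigma>" "\<sigma> (0, 0) = e"
    using assms(2) unfolding liftable_def by (force dest!: bspec[of _ _ "(0, 0)"])
  have "is_lift {0..1} ((\<gamma> \<circ> snd) \<circ> (\<lambda>\<tau>. (0::real, \<tau>))) (\<sigma> \<circ> (\<lambda>\<tau>. (0, \<tau>)))"
    by (rule lift_compose[OF \<sigma>(1)]) (auto intro!: continuous_on_Pair continuous_on_const continuous_on_id)
  then have "is_lift {0..1} \<gamma> (\<sigma> \<circ> (\<lambda>\<tau>. (0, \<tau>)))"
    by (rule lift_cong) simp
  then show ?thesis using that \<sigma>(2) by simp
qed

text \<open>The lifted homotopy is read backwards. Over its constant end the lift is constant, so
  the lifts of the sides \<open>x \<mapsto> (x, 0)\<close> and \<open>x \<mapsto> (x, 1)\<close>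
  agree at 1. All stages being loops, both sides lie over the same path, so their lifts agree at 0
  too, where they are the end values of \<sigma>.\<close>

lemma trivial_monodromy:
  assumes h: "homotopic_loops S \<gamma> (\<lambda>_. a)" and p: "continuous_on S p"
    and \<sigma>: "is_lift {0..1} (p \<circ> \<gamma>) \<sigma>"
  shows "\<sigma> 0 = \<sigma> 1"
proof -
  obtain H :: "real \<times> real \<Rightarrow> _" where H: "continuous_on ({0..1} \<times> {0..1}) H" "H \<in> ({0..1} \<times> {0..1}) \<rightarrow> S"
      "\<And>x. x \<in> {0..1} \<Longrightarrow> H (0, x) = \<gamma> x" "\<And>x. x \<in> {0..1} \<Longrightarrow> H (1, x) = a"
      "\<And>t. t \<in> {0..1} \<Longrightarrow> H (t, 1) = H (t, 0)"
    using h unfolding homotopic_loops by (auto simp: pathfinish_def pathstart_def)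
  let ?sq = "{0..1::real} \<times> {0..1::real}"
  have cont: "continuous_on ?sq (p \<circ> H)"
    by (rule continuous_on_compose[OF H(1) continuous_on_subset[OF p]]) (use H(2) in auto)
  obtain \<Sigma> where \<Sigma>: "is_lift ?sq (p \<circ> H) \<Sigma>" "\<Sigma> (0,0) = \<sigma> 0"
  proof -
    have "pr (\<sigma> 0) = (p \<circ> H) (0,0)"
      using lift_projection[OF \<sigma>, of 0] H(3)[of 0] by simp
    then show ?thesis using liftable_square[OF cont] that unfolding liftable_def by fastforce
  qed
  have edge: "is_lift {0..1} (p \<circ> H \<circ> k) (\<Sigma> \<circ> k)" "continuous_on {0..1} (p \<circ> H \<circ> k)"
    if "continuous_on {0..1::real} k" "k ` {0..1} \<subseteq> ?sq" for k
    using lift_compose[OF \<Sigma>(1) that] continuous_on_compose[OF that(1) continuous_on_subset[OF cont that(2)]] by auto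
  have c0: "continuous_on {0..1::real} (\<lambda>x. (c, x))" "continuous_on {0..1::real} (\<lambda>x. (x, c))" for c :: real
    by (auto intro!: continuous_on_Pair continuous_on_const continuous_on_id)
  have im: "(\<lambda>x. (c, x)) ` {0..1} \<subseteq> ?sq" "(\<lambda>x. (x, c)) ` {0..1} \<subseteq> ?sq"
    if "c \<in> {0..1}" for c :: real
    using that by auto
  have "\<Sigma> (1, 0) = \<Sigma> (1, 1)"
  proof -
    have "is_lift {0..1} (p \<circ> H \<circ> (\<lambda>x. (1, x))) (\<Sigma> \<circ> (\<lambda>x. (1,0)))"
      by (rule lift_cong[OF lift_compose[OF \<Sigma>(1)]]) (auto simp: H(4))
    from lift_unique[OF connected_Icc edge(2)[OF c0(1) im(1)] edge(1)[OF c0(1) im(1)] this, of 0 1] show ?thesis by auto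
  qed
  moreover have "is_lift {0..1} (p \<circ> H \<circ> (\<lambda>x. (x, 0))) (\<Sigma> \<circ> (\<lambda>x. (x, 1)))"
    by (rule lift_cong[OF edge(1)[OF c0(2)]]) (auto simp: H(5))
  from lift_unique[OF connected_Icc edge(2)[OF c0(2) im(2)] edge(1)[OF c0(2) im(2)] this, of 1 0]
  have "\<Sigma> (1, 0) = \<Sigma> (1, 1) \<Longrightarrow> \<Sigma> (0, 0) = \<Sigma> (0, 1)" by auto
  moreover have "is_lift {0..1} (p \<circ> H \<circ> (\<lambda>x. (0, x))) \<sigma>"
    by (rule lift_cong[OF \<sigma>]) (auto simp: H(3))
  from lift_unique[OF connected_Icc edge(2)[OF c0(1) im(1)] edge(1)[OF c0(1) im(1)] this, of 0 1] \<Sigma>(2)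
  have "\<Sigma> (0, 1) = \<sigma> 1" by auto
  ultimately show ?thesis using \<Sigma>(2) by simp
qed

text \<open>The loop \<Gamma> follows \<open>\<gamma>1\<close> and returns along
  \<open>\<gamma>2\<close>. Its lift closes up by trivial monodromy, and the value at the midpoint
  is reached from either end.\<close>

theorem lift_homotopy_invariant:
  assumes sc: "simply_connected S" and p: "continuous_on S p"
    and "path \<gamma>1" "path_image \<gamma>1 \<subseteq> S" "path \<gamma>2" "path_image \<gamma>2 \<subseteq> S" 
    and "\<gamma>1 0 = \<gamma>2 0" "\<gamma>1 1 = \<gamma>2 1"
    and l: "is_lift {0..1} (p \<circ> \<gamma>1) \<sigma>1" "is_lift {0..1} (p \<circ> \<gamma>2) \<sigma>2" "\<sigma>1 0 = \<sigma>2 0"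
  shows "\<sigma>1 1 = \<sigma>2 1"
proof -
  define \<Gamma> where "\<Gamma> = \<gamma>1 +++ reversepath \<gamma>2"
  have path: "path \<Gamma>" "path_image \<Gamma> \<subseteq> S" "pathfinish \<Gamma> = pathstart \<Gamma>"
  proof -
    have ends: "pathfinish \<gamma>1 = pathstart (reversepath \<gamma>2)" "pathstart \<gamma>1 = pathstart \<gamma>2"
      using assms(7,8) by (simp_all add: pathfinish_def pathstart_def reversepath_def)
    show "path \<Gamma>" unfolding \<Gamma>_def
      using assms(3,5) ends(1) by (intro path_join_imp) auto
    show "path_image \<Gamma> \<subseteq> S" unfolding \<Gamma>_def
      using assms(4,6) by (intro subset_path_image_join) auto
    show "pathfinish \<Gamma> = pathstart \<Gamma>" unfolding \<Gamma>_def using ends(2) by simp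
  qed
  have "homotopic_loops S \<Gamma> (\<lambda>_. \<Gamma> 0)"
    using sc path unfolding simply_connected_def
    by (auto simp: path_def path_image_def pathstart_def pathfinish_def image_subset_iff)
  note mono = trivial_monodromy[OF this p]
  have c\<Gamma>: "continuous_on {0..1} (p \<circ> \<Gamma>)"
    using path by (intro continuous_on_compose[OF _ continuous_on_subset[OF p]]) (auto simp: path_def path_image_def)
  have c1: "continuous_on {0..1} (p \<circ> \<gamma>1)" "continuous_on {0..1} (p \<circ> \<gamma>2)"
    by (rule continuous_on_compose[OF _ continuous_on_subset[OF p]];
        use assms(3-6) in \<open>simp add: path_def path_image_def\<close>)+
  have "pr (\<sigma>1 0) = (p \<circ> \<Gamma>) 0"
    using lift_projection[OF l(1), of 0] by (simp add: \<Gamma>_def joinpaths_def)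
  then obtain \<Sigma> where \<Sigma>: "is_lift {0..1} (p \<circ> \<Gamma>) \<Sigma>" "\<Sigma> 0 = \<sigma>1 0"
    using path_lift_exists[OF c\<Gamma>] by blast
  have "is_lift {0..1} (p \<circ> \<gamma>1) (\<Sigma> \<circ> (\<lambda>x. x/2))"
    by (rule lift_cong[OF lift_compose[OF \<Sigma>(1)]]) (auto simp: \<Gamma>_def joinpaths_def intro!: continuous_intros)
  from lift_unique[OF connected_Icc c1(1) this l(1), of 0 1] \<Sigma>(2) have 1: "\<Sigma> (1/2) = \<sigma>1 1" by auto
  \<comment> \<open>The second half of the lift, run backwards from parameter 1. At
    \<open>x = 1\<close> the parameter is 1/2, where \<Gamma> still follows
    \<open>\<gamma>1\<close>; there the equality of the end points enters.\<close>
  have "is_lift {0..1} (p \<circ> \<gamma>2) (\<Sigma> \<circ> (\<lambda>x. 1 - x/2))"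
  proof (rule lift_cong[OF lift_compose[OF \<Sigma>(1)]])
    fix x :: real assume "x \<in> {0..1}"
    then show "(p \<circ> \<Gamma> \<circ> (\<lambda>x. 1 - x/2)) x = (p \<circ> \<gamma>2) x"
      using assms(8) by (cases "x = 1") (auto simp: \<Gamma>_def joinpaths_def reversepath_def)
  qed (auto intro!: continuous_intros)
  from lift_unique[OF connected_Icc c1(2) this l(2), of 0 1] mono[OF \<Sigma>(1)] \<Sigma>(2) l(3)
  have "\<Sigma> (1/2) = \<sigma>2 1" by auto
  with 1 show ?thesis by simp
qed

end

section \<open>Linear differential equations\<close>

lemma has_vector_derivative_vecI:
  fixes f :: "real \<Rightarrow> 'a::real_normed_vector ^ 'n"
  assumes "\<And>i. ((\<lambda>x. f x $ i) has_vector_derivative f' $ i) (at x within S)"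
  shows "(f has_vector_derivative f') (at x within S)"
  unfolding has_vector_derivative_def has_derivative_within
proof (intro conjI bounded_linear_scaleR_left vec_tendstoI)
  fix i
  show "((\<lambda>y. ((1 / norm (y - x)) *\<^sub>R (f y - (f x + (y - x) *\<^sub>R f'))) $ i) \<longlongrightarrow> 0 $ i) (at x within S)"
    using assms[of i] unfolding has_vector_derivative_def has_derivative_within
    by simp
qed

lemma mono_of_derivative_nonneg:
  fixes g :: "real \<Rightarrow> real"
  assumes "\<And>\<tau>. \<tau> \<in> {a..b} \<Longrightarrow> (g has_real_derivative g' \<tau>) (at \<tau> within {a..b})"
    and "\<And>\<tau>. \<tau> \<in> {a..b} \<Longrightarrow> g' \<tau> \<ge> 0" and "a \<le> x" "x \<le> y" "y \<le> b"
  shows "g x \<le> g y"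
proof (cases "x = y")
  case False
  then have "x < y" using assms by simp
  have "\<exists>\<xi>\<in>{x<..<y}. g y - g x = g' \<xi> * (y - x)"
  proof (rule mvt_simple[OF \<open>x < y\<close>])
    fix \<tau> assume "x \<le> \<tau>" "\<tau> \<le> y"
    then show "(g has_derivative (*) (g' \<tau>)) (at \<tau> within {x..y})"
      using assms(1)[of \<tau>] assms(3,5) unfolding has_field_derivative_def
      by (auto intro: has_derivative_subset)
  qed
  then obtain \<xi> where "\<xi> \<in> {x<..<y}" "g y - g x = g' \<xi> * (y - x)" by blast
  moreover have "g' \<xi> \<ge> 0" using assms \<open>\<xi> \<in> _\<close> by auto
  ultimately show ?thesis using \<open>x < y\<close> by (metis diff_ge_0_iff_ge less_imp_le mult_nonneg_nonneg)
qed simp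

text \<open>Gronwall's argument for the squared norm \<psi>, which is differentiable even at zeros:
  \<open>\<psi> s * exp (- 2 * K * s)\<close> decreases and
  \<open>\<psi> s * exp (2 * K * s)\<close> increases, so the zero at \<open>c\<close> spreads to
  the right and to the left.\<close>

lemma linear_ode_zero:
  fixes \<phi> :: "real \<Rightarrow> 'a::real_inner"
  assumes deriv: "\<And>\<tau>. \<tau> \<in> {a..b} \<Longrightarrow> (\<phi> has_vector_derivative \<phi>' \<tau>) (at \<tau> within {a..b})"
    and bound: "\<And>\<tau>. \<tau> \<in> {a..b} \<Longrightarrow> norm (\<phi>' \<tau>) \<le> K * norm (\<phi> \<tau>)"
    and zero: "c \<in> {a..b}" "\<phi> c = 0" and \<tau>: "\<tau> \<in> {a..b}"
  shows "\<phi> \<tau> = 0"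
proof -
  define \<psi> where "\<psi> s = \<phi> s \<bullet> \<phi> s" for s
  have d\<psi>: "(\<psi> has_real_derivative 2 * (\<phi> s \<bullet> \<phi>' s)) (at s within {a..b})" if "s \<in> {a..b}" for s
    unfolding \<psi>_def has_real_derivative_iff_has_vector_derivative has_vector_derivative_def
    by (rule has_derivative_eq_rhs[OF has_derivative_inner[OF
            deriv[OF that, unfolded has_vector_derivative_def] deriv[OF that, unfolded has_vector_derivative_def]]])
      (auto simp: inner_commute algebra_simps)
  have b: "\<bar>2 * (\<phi> s \<bullet> \<phi>' s)\<bar> \<le> 2 * K * \<psi> s" if "s \<in> {a..b}" for s
  proof -
    have "\<bar>\<phi> s \<bullet> \<phi>' s\<bar> \<le> norm (\<phi> s) * norm (\<phi>' s)" by (rule Cauchy_Schwarz_ineq2)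
    also have "\<dots> \<le> norm (\<phi> s) * (K * norm (\<phi> s))"
      using bound[OF that] by (intro mult_left_mono) auto
    finally show ?thesis by (simp add: \<psi>_def dot_square_norm power2_eq_square algebra_simps)
  qed
  have "\<psi> \<tau> \<le> 0"
  proof (cases "c \<le> \<tau>")
    case True
    have "- (\<psi> c * exp (- 2 * K * c)) \<le> - (\<psi> \<tau> * exp (- 2 * K * \<tau>))"
    proof (rule mono_of_derivative_nonneg[where a = a and b = b and g = "\<lambda>s. - (\<psi> s * exp (- 2 * K * s))"])
      fix s assume s: "s \<in> {a..b}"
      show "((\<lambda>s. - (\<psi> s * exp (- 2 * K * s))) has_real_derivative
          (2 * K * \<psi> s - 2 * (\<phi> s \<bullet> \<phi>' s)) * exp (- 2 * K * s)) (at s within {a..b})"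
        by (rule derivative_eq_intros d\<psi>[OF s] refl)+ (simp add: algebra_simps)
      show "(2 * K * \<psi> s - 2 * (\<phi> s \<bullet> \<phi>' s)) * exp (- 2 * K * s) \<ge> 0"
        using b[OF s] by simp
    qed (use zero \<tau> True in auto)
    then show ?thesis using zero by (simp add: \<psi>_def mult_le_0_iff)
  next
    case False
    have "\<psi> \<tau> * exp (2 * K * \<tau>) \<le> \<psi> c * exp (2 * K * c)"
    proof (rule mono_of_derivative_nonneg[where a = a and b = b and g = "\<lambda>s. \<psi> s * exp (2 * K * s)"])
      fix s assume s: "s \<in> {a..b}"
      show "((\<lambda>s. \<psi> s * exp (2 * K * s)) has_real_derivative
          (2 * K * \<psi> s + 2 * (\<phi> s \<bullet> \<phi>' s)) * exp (2 * K * s)) (at s within {a..b})"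
        by (rule derivative_eq_intros d\<psi>[OF s] refl)+ (simp add: algebra_simps)
      show "(2 * K * \<psi> s + 2 * (\<phi> s \<bullet> \<phi>' s)) * exp (2 * K * s) \<ge> 0"
        using b[OF s] by simp
    qed (use zero \<tau> False in auto)
    then show ?thesis using zero by (simp add: \<psi>_def mult_le_0_iff)
  qed
  then show ?thesis using inner_ge_zero[of "\<phi> \<tau>"] unfolding \<psi>_def by (metis antisym inner_eq_zero_iff)
qed

text \<open>A crude matrix norm, visibly continuous in the entries. It dominates the operator norm
  for the maximum norm on vectors, used in the Picard estimate, as well as for the Euclidean
  norm.\<close>

definition entry_sum :: "complex ^ 'n ^ 'm \<Rightarrow> real" where
  "entry_sum A = (\<Sum>i\<in>UNIV. \<Sum>j\<in>UNIV. norm (A $ i $ j))"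

lemma entry_sum_nonneg: "entry_sum A \<ge> 0"
  by (simp add: entry_sum_def sum_nonneg)

lemma norm_matrix_vector_component:
  fixes x :: "complex ^ 'n"
  assumes "\<And>j. norm (x $ j) \<le> e"
  shows "norm ((A *v x) $ i) \<le> entry_sum A * e"
proof -
  have e: "e \<ge> 0" using assms norm_ge_zero order_trans by blast
  have "norm ((A *v x) $ i) \<le> (\<Sum>j\<in>UNIV. norm (A $ i $ j) * e)"
    unfolding matrix_vector_mult_def
    by (auto intro!: sum_norm_le simp: norm_mult mult_left_mono assms)
  also have "\<dots> = (\<Sum>j\<in>UNIV. norm (A $ i $ j)) * e" by (simp add: sum_distrib_right)
  also have "\<dots> \<le> entry_sum A * e"
    unfolding entry_sum_def using e
    by (intro mult_right_mono member_le_sum) (auto simp: sum_nonneg)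
  finally show ?thesis .
qed

lemma norm_matrix_vector_le: "norm (A *v x) \<le> entry_sum A * norm (x :: complex ^ 'n)"
proof -
  have "norm (A *v x) \<le> (\<Sum>i\<in>UNIV. norm ((A *v x) $ i))"
    unfolding norm_vec_def by (rule L2_set_le_sum) simp
  also have "\<dots> \<le> (\<Sum>i\<in>UNIV. \<Sum>j\<in>UNIV. norm (A $ i $ j) * norm x)"
    unfolding matrix_vector_mult_def
    by (auto intro!: sum_mono sum_norm_le mult_left_mono simp: norm_mult Finite_Cartesian_Product.norm_nth_le)
  also have "\<dots> = entry_sum A * norm x" by (simp add: entry_sum_def sum_distrib_right)
  finally show ?thesis .
qed

lemma continuous_on_entry_sum:
  assumes "\<And>i j. continuous_on S (\<lambda>x. A x $ i $ j)"
  shows "continuous_on S (\<lambda>x. entry_sum (A x))"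
  unfolding entry_sum_def by (intro continuous_intros assms)

lemma norm_vector_scalar_mult: "norm (c *s (x :: complex ^ 'n)) = norm c * norm x"
  by (simp add: norm_vec_def vector_scalar_mult_def norm_mult L2_set_right_distrib)

text \<open>On the segment from \<open>z0\<close> to \<open>z\<close> the claim becomes the real one
  of \<open>linear_ode_zero\<close>, with the constant multiplied by the length of the
  segment.\<close>

lemma holomorphic_linear_ode_unique:
  fixes w :: "complex \<Rightarrow> complex ^ 'n"
  assumes S: "convex S" "z0 \<in> S" "z \<in> S"
    and deriv: "\<And>z i. z \<in> S \<Longrightarrow> ((\<lambda>z. w z $ i) has_field_derivative (w' z $ i)) (at z)"
    and bound: "\<And>z. z \<in> S \<Longrightarrow> norm (w' z) \<le> K * norm (w z)" and zero: "w z0 = 0"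
  shows "w z = 0"
proof -
  define k where "k s = z0 + of_real s * (z - z0)" for s :: real
  have k: "k s \<in> S" if "s \<in> {0..1}" for s
  proof -
    have "k s = (1 - s) *\<^sub>R z0 + s *\<^sub>R z" by (simp add: k_def scaleR_conv_of_real algebra_simps)
    then show ?thesis using convexD[OF S, of "1 - s" s] that by simp
  qed
  have d: "((\<lambda>s. w (k s)) has_vector_derivative (z - z0) *s w' (k s)) (at s within {0..1})" if s: "s \<in> {0..1}" for s
  proof (rule has_vector_derivative_vecI)
    fix i
    have dk: "(k has_vector_derivative (z - z0)) (at s within {0..1})"
      unfolding k_def by (auto intro!: derivative_eq_intros)
    show "((\<lambda>x. w (k x) $ i) has_vector_derivative ((z - z0) *s w' (k s)) $ i) (at s within {0..1})"
      using field_vector_diff_chain_within[OF dk has_field_derivative_at_within[OF deriv[OF k[OF s]]], of i]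
      unfolding o_def vector_smult_component .
  qed
  have b: "norm ((z - z0) *s w' (k s)) \<le> (norm (z - z0) * K) * norm (w (k s))" if s: "s \<in> {0..1}" for s
    using bound[OF k[OF s]] by (simp only: norm_vector_scalar_mult mult.assoc mult_left_mono norm_ge_zero)
  have "w (k 1) = 0"
    by (rule linear_ode_zero[OF d b, where c = 0]) (auto simp: k_def zero)
  then show ?thesis by (simp add: k_def)
qed

subsection \<open>Picard iteration\<close>

text \<open>Replaces the contour integral from \<open>z1\<close> in Picard's scheme.\<close>

definition primitive :: "complex set \<Rightarrow> complex \<Rightarrow> (complex \<Rightarrow> complex) \<Rightarrow> complex \<Rightarrow> complex" where
  "primitive S z1 f = (SOME F. F z1 = 0 \<and> (\<forall>z \<in> S. (F has_field_derivative f z) (at z)))"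

lemma primitive:
  assumes "convex S" "open S" "f holomorphic_on S"
  shows "primitive S z1 f z1 = 0" "z \<in> S \<Longrightarrow> (primitive S z1 f has_field_derivative f z) (at z)"
proof -
  obtain g where g: "\<And>x. x \<in> S \<Longrightarrow> (g has_field_derivative f x) (at x within S)"
    using holomorphic_convex_primitive'[OF assms] by blast
  then have "\<forall>x\<in>S. ((\<lambda>z. g z - g z1) has_field_derivative f x) (at x)"
    using at_within_open[OF _ assms(2)] by (auto intro!: derivative_eq_intros)
  then have "\<exists>F. F z1 = 0 \<and> (\<forall>z \<in> S. (F has_field_derivative f z) (at z))"
    by (intro exI[of _ "\<lambda>z. g z - g z1"]) auto
  from someI_ex[OF this] show "primitive S z1 f z1 = 0"
      "z \<in> S \<Longrightarrow> (primitive S z1 f has_field_derivative f z) (at z)"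
    by (auto simp: primitive_def)
qed

primrec picard :: "complex set \<Rightarrow> complex \<Rightarrow> (complex \<Rightarrow> complex ^ 'n ^ 'n) \<Rightarrow> complex ^ 'n \<Rightarrow> nat
    \<Rightarrow> complex \<Rightarrow> complex ^ 'n" where
  "picard S z1 a v1 0 = (\<lambda>z. v1)"
| "picard S z1 a v1 (Suc k) = (\<lambda>z. \<chi> i. v1 $ i + primitive S z1 (\<lambda>z. (a z *v picard S z1 a v1 k z) $ i) z)"

text \<open>The condition \<open>K * d \<le> 1/2\<close> makes each Picard step halve the bound for
  the difference of consecutive iterates. They converge uniformly on all of \<open>S\<close>, and
  uniform limits of holomorphic functions may be differentiated termwise. By linearity the condition
  does not involve the initial vector.\<close>

lemma holomorphic_linear_ode_exists:
  fixes a :: "complex \<Rightarrow> complex ^ 'n ^ 'n"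
  assumes S: "convex S" "open S" "z1 \<in> S" and d: "\<And>z. z \<in> S \<Longrightarrow> norm (z - z1) \<le> d"
    and hol: "\<And>i j. (\<lambda>z. a z $ i $ j) holomorphic_on S"
    and K: "\<And>z. z \<in> S \<Longrightarrow> entry_sum (a z) \<le> K" "K * d \<le> 1/2"
  obtains v where "v z1 = v1"
    "\<And>z i. z \<in> S \<Longrightarrow> ((\<lambda>z. v z $ i) has_field_derivative (a z *v v z) $ i) (at z)"
proof -
  let ?p = "picard S z1 a v1"
  have K0: "K \<ge> 0" using K(1)[OF S(3)] entry_sum_nonneg order_trans by blast
  have hp: "(\<lambda>z. ?p k z $ i) holomorphic_on S" and
    hap: "(\<lambda>z. (a z *v ?p k z) $ i) holomorphic_on S" for k i
  proof (induction k arbitrary: i)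
    case 0
    show "(\<lambda>z. ?p 0 z $ i) holomorphic_on S" for i by simp
    show "(\<lambda>z. (a z *v ?p 0 z) $ i) holomorphic_on S" for i
      unfolding matrix_vector_mult_def by (auto intro!: holomorphic_intros hol)
  next
    case (Suc k)
    have "primitive S z1 (\<lambda>z. (a z *v ?p k z) $ i) holomorphic_on S" for i
      using primitive(2)[OF S(1,2) Suc(2)] S(2) by (auto simp: holomorphic_on_open)
    then show 1: "(\<lambda>z. ?p (Suc k) z $ i) holomorphic_on S" for i
      by (auto intro!: holomorphic_on_add holomorphic_on_const)
    show "(\<lambda>z. (a z *v ?p (Suc k) z) $ i) holomorphic_on S" for i
      unfolding matrix_vector_mult_def
      by (simp del: picard.simps) (intro holomorphic_on_sum holomorphic_on_mult hol 1)
  qed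
  have dp: "((\<lambda>z. ?p (Suc k) z $ i) has_field_derivative (a z *v ?p k z) $ i) (at z)" if "z \<in> S" for k i z
    using primitive(2)[OF S(1,2) hap that] by (auto intro!: derivative_eq_intros)
  have p1: "?p k z1 = v1" for k
    by (cases k) (auto simp: primitive(1)[OF S(1,2) hap] vec_eq_iff)
  define M where "M = norm v1"
  have diff: "norm ((?p (Suc k) z - ?p k z) $ i) \<le> M * (1/2) ^ k" if "z \<in> S" for k i z
    using that
  proof (induction k arbitrary: i z)
    case 0
    have "norm (?p 1 z $ i - ?p 1 z1 $ i) \<le> (K * M) * norm (z - z1)"
    proof (rule field_differentiable_bound[OF S(1) _ _ 0 S(3)])
      fix z assume z: "z \<in> S"
      show "((\<lambda>z. ?p 1 z $ i) has_field_derivative (a z *v ?p 0 z) $ i) (at z within S)"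
        using dp[OF z, of 0] by (auto intro: has_field_derivative_at_within)
      have "norm ((a z *v ?p 0 z) $ i) \<le> entry_sum (a z) * M"
        by (rule norm_matrix_vector_component) (simp add: M_def Finite_Cartesian_Product.norm_nth_le)
      also have "\<dots> \<le> K * M" using K(1)[OF z] by (simp add: mult_right_mono M_def)
      finally show "norm ((a z *v ?p 0 z) $ i) \<le> K * M" .
    qed
    also have "\<dots> \<le> (K * M) * d" using d[OF 0] K0 by (intro mult_left_mono) (auto simp: M_def)
    also have "\<dots> \<le> 1/2 * M" using K(2) mult_right_mono[of "K * d" "1/2" M] by (simp add: M_def algebra_simps)
    also have "\<dots> \<le> M" by (simp add: M_def)
    finally show ?case by (simp add: primitive(1)[OF S(1,2) hap[of 0, simplified]])
  next
    case (Suc k)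
    define e where "e = M * (1/2) ^ k"
    have e: "e \<ge> 0" by (simp add: e_def M_def)
    let ?f = "\<lambda>z. ?p (Suc (Suc k)) z $ i - ?p (Suc k) z $ i"
    have "norm (?f z - ?f z1) \<le> (K * e) * norm (z - z1)"
    proof (rule field_differentiable_bound[OF S(1) _ _ Suc.prems S(3)])
      fix z assume z: "z \<in> S"
      show "(?f has_field_derivative (a z *v (?p (Suc k) z - ?p k z)) $ i) (at z within S)"
        using DERIV_diff[OF dp[OF z, of "Suc k" i] dp[OF z, of k i]]
        by (simp add: matrix_vector_mult_diff_distrib has_field_derivative_at_within)
      have "norm ((a z *v (?p (Suc k) z - ?p k z)) $ i) \<le> entry_sum (a z) * e"
        unfolding e_def by (rule norm_matrix_vector_component) (rule Suc.IH[OF z])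
      also have "\<dots> \<le> K * e" using K(1)[OF z] e by (simp add: mult_right_mono)
      finally show "norm ((a z *v (?p (Suc k) z - ?p k z)) $ i) \<le> K * e" .
    qed
    also have "\<dots> \<le> (K * e) * d" using d[OF Suc.prems] K0 e by (intro mult_left_mono) auto
    also have "\<dots> \<le> 1/2 * e" using K(2) e mult_right_mono[of "K * d" "1/2" e] by (simp add: algebra_simps)
    also have "\<dots> = M * (1/2) ^ Suc k" by (simp add: e_def)
    finally show ?case using p1[of "Suc k"] p1[of "Suc (Suc k)"] by (simp del: picard.simps)
  qed
  define v where "v z = (\<chi> i. v1 $ i + (\<Sum>k. (?p (Suc k) z - ?p k z) $ i))" for z
  have tel: "?p n z $ i = v1 $ i + (\<Sum>k<n. (?p (Suc k) z - ?p k z) $ i)" for n z i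
    by (induction n) (simp_all del: picard.simps(2))
  have ul: "uniform_limit S (\<lambda>n z. ?p n z $ i) (\<lambda>z. v z $ i) sequentially" for i
  proof -
    have "uniform_limit S (\<lambda>n z. \<Sum>k<n. (?p (Suc k) z - ?p k z) $ i)
        (\<lambda>z. \<Sum>k. (?p (Suc k) z - ?p k z) $ i) sequentially"
      by (rule Weierstrass_m_test[where M = "\<lambda>k. M * (1/2) ^ k"])
        (use diff in \<open>auto intro!: summable_mult summable_geometric\<close>)
    then have "uniform_limit S (\<lambda>n z. v1 $ i + (\<Sum>k<n. (?p (Suc k) z - ?p k z) $ i))
        (\<lambda>z. v1 $ i + (\<Sum>k. (?p (Suc k) z - ?p k z) $ i)) sequentially"
      by (intro uniform_limit_add uniform_limit_const)
    then show ?thesis by (subst tel) (simp add: v_def)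
  qed
  have dv: "((\<lambda>z. v z $ i) has_field_derivative (a z *v v z) $ i) (at z)" if z: "z \<in> S" for z i
  proof -
    have "\<exists>g'. \<forall>x \<in> S. ((\<lambda>z. v z $ i) has_field_derivative g' x) (at x) \<and>
        (\<lambda>n. (a x *v ?p n x) $ i) \<longlonglongrightarrow> g' x"
    proof (rule has_complex_derivative_uniform_sequence[OF S(2)])
      \<comment> \<open>The sequence is shifted by one because the derivative of the iterate
        \<open>Suc n\<close> is expressed through the iterate \<open>n\<close>.\<close>
      show "((\<lambda>z. ?p (Suc n) z $ i) has_field_derivative (a x *v ?p n x) $ i) (at x)" if "x \<in> S" for n x
        by (rule dp[OF that])
      fix x assume "x \<in> S"
      then obtain r where r: "r > 0" "cball x r \<subseteq> S" using S(2) open_contains_cball by blast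
      have "uniform_limit S (\<lambda>n z. ?p (Suc n) z $ i) (\<lambda>z. v z $ i) sequentially"
        using filterlim_compose[OF ul[of i] filterlim_Suc] by simp
      with r show "\<exists>d>0. cball x d \<subseteq> S \<and>
          uniform_limit (cball x d) (\<lambda>n z. ?p (Suc n) z $ i) (\<lambda>z. v z $ i) sequentially"
        using uniform_limit_on_subset by blast
    qed
    then obtain g' where g': "((\<lambda>z. v z $ i) has_field_derivative g') (at z)"
        "(\<lambda>n. (a z *v ?p n z) $ i) \<longlonglongrightarrow> g'"
      using z by blast
    have "(\<lambda>n. (a z *v ?p n z) $ i) \<longlonglongrightarrow> (a z *v v z) $ i"
      unfolding matrix_vector_mult_def
      by (simp del: picard.simps)
        (intro tendsto_sum tendsto_mult tendsto_const tendsto_uniform_limitI[OF ul z])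
    then have "g' = (a z *v v z) $ i" using g'(2) LIMSEQ_unique by blast
    with g'(1) show ?thesis by simp
  qed
  have "v z1 = v1"
    by (simp add: v_def p1 vec_eq_iff del: picard.simps)
  with dv that show ?thesis by blast
qed

section \<open>Flat sections of a holomorphic connection\<close>

abbreviation chart_inv :: "'x chart \<Rightarrow> complex \<Rightarrow> 'x" where
  "chart_inv c \<equiv> inv_into (fst c) (snd c)"

lemma holomorphic_funD:
  "holomorphic_fun A W f \<Longrightarrow> c \<in> A \<Longrightarrow> (\<lambda>w. f (chart_inv c w)) holomorphic_on snd c ` (fst c \<inter> W)"
  unfolding holomorphic_fun_def case_prod_unfold o_def by blast

lemma riemann_surface_unfold:
  fixes A :: "'x::t2_space chart set"
  shows "riemann_surface A \<longleftrightarrow>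
     connected (UNIV :: 'x set) \<and> \<Union> (fst ` A) = UNIV \<and>
     (\<forall>c \<in> A. open (fst c) \<and> open (snd c ` fst c) \<and>
        homeomorphism (fst c) (snd c ` fst c) (snd c) (chart_inv c)) \<and>
     (\<forall>c \<in> A. \<forall>c' \<in> A. (snd c' \<circ> chart_inv c) holomorphic_on (snd c ` (fst c \<inter> fst c')))"
  unfolding riemann_surface_def case_prod_unfold by (rule refl)

lemma matrix_vector_mult_component: "(A *v x) $ i = (\<Sum>j\<in>UNIV. A $ i $ j * x $ j)"
  by (simp add: matrix_vector_mult_def)

lemma mat_vector_mult: "mat (c::complex) *v x = c *s x"
  by (simp add: vec_eq_iff matrix_vector_mult_def mat_def if_distrib if_distribR cong: if_cong)

lemma matrix_mult_add_distrib_right: "(A + B) ** C = A ** C + B ** (C::complex^'n^'m)"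
  by (simp add: vec_eq_iff matrix_matrix_mult_def sum.distrib distrib_right)

lemma scaleR_matrix_mult_left: "(t *\<^sub>R A) ** B = t *\<^sub>R (A ** (B::complex^'n^'m))"
  by (simp add: vec_eq_iff matrix_matrix_mult_def scaleR_sum_right)

lemma scaleR_matrix_mult_right: "A ** (t *\<^sub>R B) = t *\<^sub>R (A ** (B::complex^'n^'m))"
  by (simp add: vec_eq_iff matrix_matrix_mult_def scaleR_sum_right)

section \<open>Charts of a Riemann surface\<close>

context
  fixes A :: "'x::t2_space chart set"
  assumes rs: "riemann_surface A"
begin

lemma chart_open: "c \<in> A \<Longrightarrow> open (fst c)"
  using rs unfolding riemann_surface_unfold by blast

lemma chart_homeo:
  "c \<in> A \<Longrightarrow> homeomorphism (fst c) (snd c ` fst c) (snd c) (chart_inv c)"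
  using rs unfolding riemann_surface_unfold by blast

lemma chart_image_open_full: "c \<in> A \<Longrightarrow> open (snd c ` fst c)"
  using rs unfolding riemann_surface_unfold by blast

lemma chart_inv_chart [simp]: "c \<in> A \<Longrightarrow> x \<in> fst c \<Longrightarrow> chart_inv c (snd c x) = x"
  using chart_homeo unfolding homeomorphism_def by blast

lemma chart_image_mem:
  assumes "c \<in> A" "y \<in> fst c" "snd c y \<in> snd c ` (fst c \<inter> W)"
  shows "y \<in> W"
proof -
  obtain y' where y': "y' \<in> fst c" "y' \<in> W" "snd c y = snd c y'" using assms(3) by blast
  have "y = chart_inv c (snd c y)" by (rule chart_inv_chart[OF assms(1,2), symmetric])
  also have "\<dots> = y'" unfolding y'(3) by (rule chart_inv_chart[OF assms(1) y'(1)])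
  finally show ?thesis using y'(2) by blast
qed

lemma chart_continuous: "c \<in> A \<Longrightarrow> continuous_on (fst c) (snd c)"
  using chart_homeo unfolding homeomorphism_def by blast

lemma chart_inv_continuous: "c \<in> A \<Longrightarrow> continuous_on (snd c ` fst c) (chart_inv c)"
  using chart_homeo unfolding homeomorphism_def by blast

lemma chart_image_open:
  assumes c: "c \<in> A" and W: "open W"
  shows "open (snd c ` (fst c \<inter> W))"
proof -
  have "openin (top_of_set (snd c ` fst c)) (snd c ` (fst c \<inter> W))"
    by (rule homeomorphism_imp_open_map[OF chart_homeo[OF c]]) (use W in auto)
  then show ?thesis using chart_image_open_full[OF c] openin_open_trans by blast
qed

lemma chart_preimage_open:
  assumes c: "c \<in> A" and "open D"
  shows "open {x \<in> fst c. snd c x \<in> D}"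
  using continuous_open_preimage[OF chart_continuous[OF c] chart_open[OF c] assms(2)]
  by (simp add: vimage_def Int_def conj_commute)

lemma chart_exists: obtains c where "c \<in> A" "x \<in> fst c"
  using rs unfolding riemann_surface_unfold by (metis UNIV_I UN_iff)

lemma chart_change_derivative:
  assumes c: "c \<in> A" "c' \<in> A" "x \<in> fst c \<inter> fst c'"
  shows "((snd c' \<circ> chart_inv c) has_field_derivative chart_deriv c c' x) (at (snd c x))"
proof -
  have "(snd c' \<circ> chart_inv c) holomorphic_on snd c ` (fst c \<inter> fst c')"
    using rs c unfolding riemann_surface_unfold by blast
  then show ?thesis unfolding chart_deriv_def
    using chart_image_open[OF c(1) chart_open[OF c(2)]] c(3)
    by (intro holomorphic_derivI) auto
qed

lemma eventually_chart:
  assumes c: "c \<in> A" and "open W" "x \<in> fst c \<inter> W"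
  shows "eventually (\<lambda>w. chart_inv c w \<in> fst c \<inter> W \<and> snd c (chart_inv c w) = w) (nhds (snd c x))"
  unfolding eventually_nhds
  using chart_image_open[OF assms(1,2)] assms c
  by (intro exI[of _ "snd c ` (fst c \<inter> W)"]) auto

text \<open>Chain rule for the two opposite chart changes, whose composite is the identity near the
  point.\<close>

lemma chart_deriv_inverse:
  assumes c: "c \<in> A" "c' \<in> A" "x \<in> fst c \<inter> fst c'"
  shows "chart_deriv c c' x * chart_deriv c' c x = 1"
proof -
  have 1: "((snd c' \<circ> chart_inv c) has_field_derivative chart_deriv c c' x) (at ((snd c \<circ> chart_inv c') (snd c' x)))"
    by (subst o_apply, subst chart_inv_chart[OF c(2) IntD2[OF c(3)]], rule chart_change_derivative[OF c])
  have "x \<in> fst c' \<inter> fst c" using c by auto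
  from DERIV_chain[OF 1 chart_change_derivative[OF c(2,1) this]]
  have D: "((snd c' \<circ> chart_inv c) \<circ> (snd c \<circ> chart_inv c') has_field_derivative
      chart_deriv c c' x * chart_deriv c' c x) (at (snd c' x))" .
  have ev: "eventually (\<lambda>w. ((snd c' \<circ> chart_inv c) \<circ> (snd c \<circ> chart_inv c')) w = w) (nhds (snd c' x))"
  proof (rule eventually_mono[OF eventually_chart[OF c(2) chart_open[OF c(1)] \<open>x \<in> fst c' \<inter> fst c\<close>]])
    fix w assume *: "chart_inv c' w \<in> fst c' \<inter> fst c \<and> snd c' (chart_inv c' w) = w"
    show "((snd c' \<circ> chart_inv c) \<circ> (snd c \<circ> chart_inv c')) w = w"
      by (subst o_apply)+ (subst chart_inv_chart[OF c(1) IntD2[OF conjunct1[OF *]]], rule conjunct2[OF *])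
  qed
  have "((\<lambda>w. w) has_field_derivative chart_deriv c c' x * chart_deriv c' c x) (at (snd c' x))"
    by (rule DERIV_cong_ev[OF refl ev refl, THEN iffD1, OF D])
  from DERIV_unique[OF this DERIV_ident] show ?thesis .
qed

lemma holomorphic_fun_derivative:
  assumes "holomorphic_fun A W f" "open W" "c \<in> A" "x \<in> fst c \<inter> W"
  shows "((\<lambda>w. f (chart_inv c w)) has_field_derivative deriv (\<lambda>w. f (chart_inv c w)) (snd c x)) (at (snd c x))"
proof -
  have "(\<lambda>w. f (chart_inv c w)) holomorphic_on snd c ` (fst c \<inter> W)"
    using holomorphic_funD assms by blast
  then show ?thesis using chart_image_open[OF assms(3,2)] assms(4)
    by (intro holomorphic_derivI) auto
qed

lemma holomorphic_fun_continuous: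
  assumes "holomorphic_fun A W f" "c \<in> A"
  shows "continuous_on (fst c \<inter> W) f"
proof -
  have "(\<lambda>w. f (chart_inv c w)) holomorphic_on snd c ` (fst c \<inter> W)"
    using holomorphic_funD assms by blast
  from continuous_on_compose2[OF holomorphic_on_imp_continuous_on[OF this]
      continuous_on_subset[OF chart_continuous[OF assms(2)] Int_lower1] order_refl]
  have "continuous_on (fst c \<inter> W) (\<lambda>x. f (chart_inv c (snd c x)))" .
  then show ?thesis
    by (rule continuous_on_eq) (subst chart_inv_chart[OF assms(2) IntD1], auto)
qed

section \<open>Trivialisations, transition matrices and flat sections\<close>

context
  fixes pr :: "'e \<Rightarrow> 'x" and B :: "('x, 'e, 'r::finite) triv set"
  assumes hb: "holomorphic_bundle A pr B"
begin

lemma triv_open: "b \<in> B \<Longrightarrow> open (fst b)"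
  using hb unfolding holomorphic_bundle_def fibrewise_bijective_def by blast

lemma triv_exists: obtains b where "b \<in> B" "x \<in> fst b"
  using hb unfolding holomorphic_bundle_def by blast

lemma triv_bij: "b \<in> B \<Longrightarrow> x \<in> fst b \<Longrightarrow> bij_betw (snd b) (fibre pr x) UNIV"
  using hb unfolding holomorphic_bundle_def fibrewise_bijective_def by blast

lemma triv_inj: "b \<in> B \<Longrightarrow> pr e \<in> fst b \<Longrightarrow> pr e' = pr e \<Longrightarrow> snd b e = snd b e' \<Longrightarrow> e = e'"
  using triv_bij[of b "pr e"] by (auto simp: bij_betw_def inj_on_def fibre_def)

definition triv_inv :: "('x, 'e, 'r) triv \<Rightarrow> 'x \<Rightarrow> complex ^ 'r \<Rightarrow> 'e" where
  "triv_inv b x = inv_into (fibre pr x) (snd b)"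

lemma triv_inv:
  assumes "b \<in> B" "x \<in> fst b"
  shows "pr (triv_inv b x v) = x" "snd b (triv_inv b x v) = v"
proof -
  have "snd b ` fibre pr x = UNIV" using triv_bij[OF assms] by (simp add: bij_betw_def)
  then have *: "v \<in> snd b ` fibre pr x" by simp
  show "snd b (triv_inv b x v) = v" unfolding triv_inv_def by (rule f_inv_into_f[OF *])
  show "pr (triv_inv b x v) = x" using inv_into_into[OF *] by (simp add: triv_inv_def fibre_def)
qed

lemma triv_change:
  assumes "b \<in> B" "b' \<in> B" "pr e \<in> fst b \<inter> fst b'"
  shows "snd b' e = transition pr b b' (pr e) *v snd b e"
  using hb assms unfolding holomorphic_bundle_def compatible_def by blast

lemma transition_holomorphic:
  "b \<in> B \<Longrightarrow> b' \<in> B \<Longrightarrow> holomorphic_fun A (fst b \<inter> fst b') (\<lambda>x. transition pr b b' x $ i $ j)"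
  using hb unfolding holomorphic_bundle_def compatible_def by blast

lemma transition_inverse:
  assumes "b \<in> B" "b' \<in> B" "x \<in> fst b \<inter> fst b'"
  shows "transition pr b' b x ** transition pr b b' x = mat 1"
proof -
  have "(transition pr b' b x ** transition pr b b' x) *v v = mat 1 *v v" for v
    using triv_change[OF assms(1,2), of "triv_inv b x v"] triv_change[OF assms(2,1), of "triv_inv b x v"]
      triv_inv[OF assms(1), of x v] assms
    by (simp add: matrix_vector_mul_assoc[symmetric])
  then show ?thesis by (simp add: matrix_eq)
qed

text \<open>The equation is demanded in all charts and trivialisations at once, so that users may
  pick any frame; the change of frame is computed once, in
  \<open>flat_section_exists\<close>.\<close>

definition flat_section :: "('x, 'e, 'r) coeffs \<Rightarrow> 'x set \<Rightarrow> ('x \<Rightarrow> 'e) \<Rightarrow> bool" where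
  "flat_section \<alpha> V g \<longleftrightarrow> open V \<and> (\<forall>x \<in> V. pr (g x) = x) \<and>
     (\<forall>c \<in> A. \<forall>b \<in> B. \<forall>x \<in> V \<inter> fst c \<inter> fst b. \<forall>i.
        ((\<lambda>w. snd b (g (chart_inv c w)) $ i) has_field_derivative (- (\<alpha> c b x *v snd b (g x))) $ i) (at (snd c x)))"

lemma coeffs_continuous:
  assumes "holomorphic_coeffs A B \<alpha>" "c \<in> A" "b \<in> B"
  shows "continuous_on (fst c \<inter> fst b) (\<lambda>x. \<alpha> c b x $ i $ j)"
proof -
  have "holomorphic_fun A (fst c \<inter> fst b) (\<lambda>x. \<alpha> c b x $ i $ j)"
    using assms by (auto simp: holomorphic_coeffs_def)
  from holomorphic_fun_continuous[OF this assms(2)] show ?thesis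
    by (auto simp: Int_assoc[symmetric])
qed

text \<open>Two points of a ball of radius \<open>r\<close> are less than \<open>2 * r\<close>
  apart. So the bound on \<open>K * (2 * r)\<close> lets Picard iteration started at any point of
  the ball converge on the whole ball.\<close>

lemma local_ball:
  assumes \<alpha>: "holomorphic_coeffs A B \<alpha>" and c: "c \<in> A" "b \<in> B" "x \<in> fst c \<inter> fst b" 
    and W: "open W" "x \<in> W"
  obtains K r where "r > 0" "K * (2 * r) \<le> 1/2" "ball (snd c x) r \<subseteq> snd c ` (fst c \<inter> (fst b \<inter> W))"
    "\<And>w. w \<in> ball (snd c x) r \<Longrightarrow> entry_sum (\<alpha> c b (chart_inv c w)) \<le> K"
proof -
  let ?D = "snd c ` (fst c \<inter> (fst b \<inter> W))"
  have D: "open ?D" using chart_image_open[OF c(1) open_Int[OF triv_open[OF c(2)] W(1)]] .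
  have xD: "snd c x \<in> ?D" using c W by auto
  let ?f = "\<lambda>w. entry_sum (\<alpha> c b (chart_inv c w))"
  have "continuous_on ?D ?f"
    by (rule continuous_on_entry_sum, rule continuous_on_compose2[OF coeffs_continuous[OF \<alpha> c(1,2)]
          continuous_on_subset[OF chart_inv_continuous[OF c(1)]]]) (use c in auto)
  then have "isCont ?f (snd c x)" using D xD continuous_on_eq_continuous_at by blast
  then have "eventually (\<lambda>w. ?f w < ?f (snd c x) + 1) (nhds (snd c x))"
    unfolding isCont_def by (intro order_tendstoD(2)[OF tendsto_at_iff_tendsto_nhds[THEN iffD1]]) auto
  moreover have "eventually (\<lambda>w. w \<in> ?D) (nhds (snd c x))"
    using D xD by (rule eventually_nhds_in_open)
  ultimately have "eventually (\<lambda>w. w \<in> ?D \<and> ?f w < ?f (snd c x) + 1) (nhds (snd c x))"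
    by (rule eventually_conj[rotated])
  then obtain r where r: "r > 0" "\<And>w. dist w (snd c x) < r \<Longrightarrow> w \<in> ?D \<and> ?f w < ?f (snd c x) + 1"
    unfolding eventually_nhds_metric by blast
  define K where "K = ?f (snd c x) + 1"
  have K: "K > 0" using entry_sum_nonneg[of "\<alpha> c b (chart_inv c (snd c x))"] by (simp add: K_def)
  define r' where "r' = min r (1 / (4 * K))"
  show ?thesis
  proof
    show "r' > 0" using r K by (simp add: r'_def)
    have "K * (2 * r') \<le> K * (2 * (1 / (4 * K)))"
      using K by (intro mult_left_mono) (auto simp: r'_def)
    then show "K * (2 * r') \<le> 1/2" using K by simp
    show "ball (snd c x) r' \<subseteq> ?D" using r(2) by (auto simp: r'_def dist_commute)
    show "?f w \<le> K" if "w \<in> ball (snd c x) r'" for w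
      using r(2)[of w] that by (auto simp: r'_def K_def dist_commute)
  qed
qed

text \<open>On a small chart ball the difference of two flat sections solves a homogeneous linear
  equation, so one zero in the ball makes it vanish throughout.\<close>

lemma flat_section_unique:
  assumes \<alpha>: "holomorphic_coeffs A B \<alpha>"
    and g: "flat_section \<alpha> V g" "flat_section \<alpha> V' g'" and x: "x \<in> V \<inter> V'"
  shows "\<exists>N. open N \<and> x \<in> N \<and> N \<subseteq> V \<inter> V' \<and> (\<forall>a\<in>N. \<forall>b\<in>N. g a = g' a \<longrightarrow> g b = g' b)"
proof -
  obtain c where c: "c \<in> A" "x \<in> fst c" by (rule chart_exists)
  obtain b where b: "b \<in> B" "x \<in> fst b" by (rule triv_exists)
  have V: "open (V \<inter> V')" using g unfolding flat_section_def by blast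
  obtain K r where r: "r > 0" "K * (2 * r) \<le> 1/2" "ball (snd c x) r \<subseteq> snd c ` (fst c \<inter> (fst b \<inter> (V \<inter> V')))"
    and K: "\<And>w. w \<in> ball (snd c x) r \<Longrightarrow> entry_sum (\<alpha> c b (chart_inv c w)) \<le> K"
    by (rule local_ball[OF \<alpha> c(1) b(1) IntI[OF c(2) b(2)] V x]) (rule that)
  define N where "N = {y \<in> fst c. snd c y \<in> ball (snd c x) r}"
  have N: "y \<in> fst c \<and> y \<in> fst b \<and> y \<in> V \<and> y \<in> V'" if "y \<in> N" for y
  proof -
    have "y \<in> fst c" "snd c y \<in> snd c ` (fst c \<inter> (fst b \<inter> (V \<inter> V')))"
      using that r(3) unfolding N_def by blast+
    then show ?thesis using chart_image_mem[OF c(1)] by blast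
  qed
  have agree: "g y = g' y" if a: "a \<in> N" "g a = g' a" and y: "y \<in> N" for a y
  proof -
    define w where "w \<zeta> = snd b (g (chart_inv c \<zeta>)) - snd b (g' (chart_inv c \<zeta>))" for \<zeta>
    have deriv: "((\<lambda>z. w z $ i) has_field_derivative (- (\<alpha> c b (chart_inv c \<zeta>) *v w \<zeta>)) $ i) (at \<zeta>)"
      if \<zeta>: "\<zeta> \<in> ball (snd c x) r" for \<zeta> i
    proof -
      obtain u where u: "u \<in> fst c" "u \<in> fst b" "u \<in> V" "u \<in> V'" "\<zeta> = snd c u" using r(3) \<zeta> by blast
      have "((\<lambda>w. snd b (g (chart_inv c w)) $ i) has_field_derivative (- (\<alpha> c b u *v snd b (g u))) $ i) (at \<zeta>)"
        "((\<lambda>w. snd b (g' (chart_inv c w)) $ i) has_field_derivative (- (\<alpha> c b u *v snd b (g' u))) $ i) (at \<zeta>)"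
        using g u c(1) b(1) unfolding flat_section_def by blast+
      from DERIV_diff[OF this] show ?thesis
        by (simp add: w_def u(5) chart_inv_chart[OF c(1) u(1)] matrix_vector_mult_diff_distrib)
    qed
    have bound: "norm (- (\<alpha> c b (chart_inv c \<zeta>) *v w \<zeta>)) \<le> K * norm (w \<zeta>)"
      if \<zeta>: "\<zeta> \<in> ball (snd c x) r" for \<zeta>
    proof -
      have "norm (\<alpha> c b (chart_inv c \<zeta>) *v w \<zeta>) \<le> entry_sum (\<alpha> c b (chart_inv c \<zeta>)) * norm (w \<zeta>)"
        by (rule norm_matrix_vector_le)
      also have "\<dots> \<le> K * norm (w \<zeta>)" using K[OF \<zeta>] by (simp add: mult_right_mono)
      finally show ?thesis by simp
    qed
    have ay: "snd c a \<in> ball (snd c x) r" "snd c y \<in> ball (snd c x) r" using a y unfolding N_def by blast+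
    have "w (snd c a) = 0" using a(2) N[OF a(1)] chart_inv_chart[OF c(1), of a] by (simp add: w_def)
    from holomorphic_linear_ode_unique[OF convex_ball ay deriv bound this]
    have "w (snd c y) = 0" .
    then have "snd b (g y) = snd b (g' y)" using N[OF y] c(1) by (simp add: w_def)
    moreover have "pr (g y) = y" "pr (g' y) = y" using g N[OF y] by (auto simp: flat_section_def)
    ultimately show ?thesis using triv_inj[OF b(1), of "g y" "g' y"] N[OF y] by simp
  qed
  have "open N" unfolding N_def by (rule chart_preimage_open[OF c(1) open_ball])
  moreover have "x \<in> N" using c(2) r(1) by (simp add: N_def)
  moreover have "N \<subseteq> V \<inter> V'" using N by blast
  ultimately show ?thesis using agree by blast
qed

text \<open>This is the flatness of holomorphic connections: in one complex dimension there is no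
  room for curvature, and the equation is an ordinary one in the chart coordinate. \<open>V\<close>
  is fixed before the point and the vector, as \<open>local_system\<close> demands.\<close>

lemma flat_section_exists:
  assumes \<alpha>: "holomorphic_connection A pr B \<alpha>"
  shows "\<exists>V. open V \<and> x0 \<in> V \<and> (\<forall>x \<in> V. \<forall>e. pr e = x \<longrightarrow> (\<exists>g. flat_section \<alpha> V g \<and> g x = e))"
proof -
  obtain c where c: "c \<in> A" "x0 \<in> fst c" by (rule chart_exists)
  obtain b where b: "b \<in> B" "x0 \<in> fst b" by (rule triv_exists)
  have hol: "holomorphic_coeffs A B \<alpha>" using \<alpha> by (simp add: holomorphic_connection_def)
  obtain K r where r: "r > 0" "K * (2 * r) \<le> 1/2" "ball (snd c x0) r \<subseteq> snd c ` (fst c \<inter> (fst b \<inter> UNIV))"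
    and K: "\<And>w. w \<in> ball (snd c x0) r \<Longrightarrow> entry_sum (\<alpha> c b (chart_inv c w)) \<le> K"
    by (rule local_ball[OF hol c(1) b(1) IntI[OF c(2) b(2)] open_UNIV UNIV_I]) (rule that)
  let ?S = "ball (snd c x0) r"
  define V where "V = {y \<in> fst c. snd c y \<in> ?S}"
  have Vb: "y \<in> fst c \<and> y \<in> fst b" if "y \<in> V" for y
  proof -
    have "y \<in> fst c" "snd c y \<in> snd c ` (fst c \<inter> (fst b \<inter> UNIV))"
      using that r(3) unfolding V_def by blast+
    then show ?thesis using chart_image_mem[OF c(1)] by blast
  qed
  have openV: "open V" unfolding V_def by (rule chart_preimage_open[OF c(1)]) simp
  have "\<exists>g. flat_section \<alpha> V g \<and> g x1 = e" if x1: "x1 \<in> V" and e: "pr e = x1" for x1 e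
  proof -
    have "snd c x1 \<in> ?S" using x1 by (simp add: V_def)
    have d: "norm (z - snd c x1) \<le> 2 * r" if "z \<in> ?S" for z
    proof -
      have "dist z (snd c x1) \<le> dist (snd c x0) z + dist (snd c x0) (snd c x1)"
        by (rule dist_triangle3)
      moreover have "dist (snd c x0) z < r" "dist (snd c x0) (snd c x1) < r"
        using that \<open>snd c x1 \<in> ?S\<close> by (simp_all only: mem_ball)
      ultimately show ?thesis unfolding dist_norm by linarith
    qed
    have h: "(\<lambda>z. (- \<alpha> c b (chart_inv c z)) $ i $ j) holomorphic_on ?S" for i j
    proof -
      have "holomorphic_fun A (fst c \<inter> fst b) (\<lambda>x. \<alpha> c b x $ i $ j)"
        using hol c b unfolding holomorphic_coeffs_def by blast
      then have "(\<lambda>z. \<alpha> c b (chart_inv c z) $ i $ j) holomorphic_on snd c ` (fst c \<inter> (fst c \<inter> fst b))"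
        using c(1) by (rule holomorphic_funD)
      then have "(\<lambda>z. \<alpha> c b (chart_inv c z) $ i $ j) holomorphic_on ?S"
        by (rule holomorphic_on_subset) (use r(3) in \<open>simp add: Int_absorb1\<close>)
      then show ?thesis by (simp add: holomorphic_on_minus)
    qed
    have k: "entry_sum (- \<alpha> c b (chart_inv c z)) \<le> K" if "z \<in> ?S" for z
      using K[OF that] by (simp add: entry_sum_def)
    obtain v where v: "v (snd c x1) = snd b e"
      "\<And>z i. z \<in> ?S \<Longrightarrow> ((\<lambda>z. v z $ i) has_field_derivative ((- \<alpha> c b (chart_inv c z)) *v v z) $ i) (at z)"
      by (rule holomorphic_linear_ode_exists[OF convex_ball open_ball \<open>snd c x1 \<in> ?S\<close> d h k r(2)], assumption, assumption, rule that)
    define g where "g x = triv_inv b x (v (snd c x))" for x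
    have g: "pr (g y) = y" "snd b (g y) = v (snd c y)" if "y \<in> V" for y
      using triv_inv[OF b(1)] Vb[OF that] by (auto simp: g_def)
    have "g x1 = e"
      by (rule triv_inj[OF b(1)]) (simp_all only: g[OF x1] v(1) e Vb[OF x1])
    moreover have "flat_section \<alpha> V g"
      unfolding flat_section_def
    proof (intro conjI ballI allI openV g)
      fix c' b' x i assume c': "c' \<in> A" and b': "b' \<in> B" and x: "x \<in> V \<inter> fst c' \<inter> fst b'"
      have xs: "x \<in> fst c \<inter> fst c'" "x \<in> fst b \<inter> fst b'" "x \<in> fst c' \<inter> (V \<inter> fst b')" using x Vb by auto
      let ?T = "\<lambda>x. transition pr b b' x"
      define dT where "dT = (\<chi> i j. deriv (\<lambda>w. ?T (chart_inv c w) $ i $ j) (snd c x))"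
      have dT: "((\<lambda>w. ?T (chart_inv c w) $ i $ j) has_field_derivative dT $ i $ j) (at (snd c x))" for i j
        unfolding dT_def vec_lambda_beta
        by (rule holomorphic_fun_derivative[OF transition_holomorphic[OF b(1) b']
              open_Int[OF triv_open[OF b(1)] triv_open[OF b']] c(1)]) (use xs in blast)
      have ix: "chart_inv c (snd c x) = x" by (rule chart_inv_chart[OF c(1) IntD1[OF xs(1)]])
      \<comment> \<open>The section in the trivialisation \<open>b'\<close> but in the old
        coordinate. The change of trivialisation is thus separated from the change of chart, which
        is a mere chain rule.\<close>
      define G where "G \<zeta> = ?T (chart_inv c \<zeta>) *v v \<zeta>" for \<zeta>
      define u where "u = v (snd c x)"
      have dG: "((\<lambda>\<zeta>. G \<zeta> $ i) has_field_derivative (dT *v u - ?T x *v (\<alpha> c b x *v u)) $ i) (at (snd c x))"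
      proof -
        have "snd c x \<in> ?S" using x unfolding V_def by blast
        then have "((\<lambda>z. v z $ j) has_field_derivative ((- \<alpha> c b x) *v u) $ j) (at (snd c x))" for j
          using v(2)[of "snd c x" j] unfolding ix u_def by blast
        from DERIV_mult[OF dT[of i] this]
        have "((\<lambda>\<zeta>. ?T (chart_inv c \<zeta>) $ i $ j * v \<zeta> $ j) has_field_derivative
           dT $ i $ j * u $ j + ((- \<alpha> c b x) *v u) $ j * ?T x $ i $ j) (at (snd c x))" for j
          unfolding ix u_def .
        then have "((\<lambda>\<zeta>. G \<zeta> $ i) has_field_derivative
           (\<Sum>j\<in>UNIV. dT $ i $ j * u $ j + ((- \<alpha> c b x) *v u) $ j * ?T x $ i $ j)) (at (snd c x))"
          unfolding G_def matrix_vector_mult_component by (intro DERIV_sum)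
        moreover have "(\<Sum>j\<in>UNIV. dT $ i $ j * u $ j + ((- \<alpha> c b x) *v u) $ j * ?T x $ i $ j)
            = (dT *v u - ?T x *v (\<alpha> c b x *v u)) $ i"
        proof -
          have "(- \<alpha> c b x) *v u = - (\<alpha> c b x *v u)"
            by (simp add: vec_eq_iff matrix_vector_mult_component sum_negf)
          then show ?thesis
            by (simp add: matrix_vector_mult_component sum.distrib sum_subtractf sum_negf mult.commute)
        qed
        ultimately show ?thesis by simp
      qed
      have conn: "mat (chart_deriv c c' x) ** \<alpha> c' b' x ** ?T x = ?T x ** \<alpha> c b x - dT"
        using \<alpha> c(1) c' b(1) b' xs unfolding holomorphic_connection_def dT_def by blast
      \<comment> \<open>The inhomogeneous term in the transformation law of the connection cancels
        the derivative of the transition matrix.\<close>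
      have "dT *v u - ?T x *v (\<alpha> c b x *v u) = - (chart_deriv c c' x *s (\<alpha> c' b' x *v (?T x *v u)))"
      proof -
        have "?T x *v (\<alpha> c b x *v u) - dT *v u = (mat (chart_deriv c c' x) ** \<alpha> c' b' x ** ?T x) *v u"
          unfolding conn by (simp add: matrix_vector_mult_diff_rdistrib matrix_vector_mul_assoc)
        also have "\<dots> = chart_deriv c c' x *s (\<alpha> c' b' x *v (?T x *v u))"
          by (simp add: matrix_vector_mul_assoc[symmetric] mat_vector_mult)
        finally show ?thesis by (simp add: algebra_simps)
      qed
      moreover have bgx: "snd b' (g x) = ?T x *v u"
      proof -
        have gx: "pr (g x) = x" "snd b (g x) = u" using g x unfolding u_def by blast+
        show ?thesis using triv_change[OF b(1) b', of "g x"] xs(2) unfolding gx by blast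
      qed
      ultimately have dG': "((\<lambda>\<zeta>. G \<zeta> $ i) has_field_derivative
          (- (chart_deriv c c' x *s (\<alpha> c' b' x *v snd b' (g x)))) $ i) (at ((snd c \<circ> chart_inv c') (snd c' x)))"
        using dG c' xs by simp
      have D: "((\<lambda>\<zeta>. G \<zeta> $ i) \<circ> (snd c \<circ> chart_inv c') has_field_derivative
          (- (chart_deriv c c' x *s (\<alpha> c' b' x *v snd b' (g x)))) $ i * chart_deriv c' c x) (at (snd c' x))"
        by (rule DERIV_chain[OF dG' chart_change_derivative[OF c' c(1)]]) (use xs in auto)
      have eq: "(- (chart_deriv c c' x *s (\<alpha> c' b' x *v snd b' (g x)))) $ i * chart_deriv c' c x
          = (- (\<alpha> c' b' x *v snd b' (g x))) $ i"
        using chart_deriv_inverse[OF c(1) c' xs(1)] by (simp add: mult.assoc mult.commute mult.left_commute)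
      have ev: "eventually (\<lambda>w. ((\<lambda>\<zeta>. G \<zeta> $ i) \<circ> (snd c \<circ> chart_inv c')) w = snd b' (g (chart_inv c' w)) $ i)
          (nhds (snd c' x))"
      proof (rule eventually_mono[OF eventually_chart[OF c' open_Int[OF openV triv_open[OF b']] xs(3)]])
        fix w assume w: "chart_inv c' w \<in> fst c' \<inter> (V \<inter> fst b') \<and> snd c' (chart_inv c' w) = w"
        define y where "y = chart_inv c' w"
        have "y \<in> V" "y \<in> fst b'" "y \<in> fst c" "y \<in> fst b" using w Vb by (auto simp: y_def)
        then show "((\<lambda>\<zeta>. G \<zeta> $ i) \<circ> (snd c \<circ> chart_inv c')) w = snd b' (g (chart_inv c' w)) $ i"
          using triv_change[OF b(1) b', of "g y"] g[of y] c(1) by (simp add: G_def y_def[symmetric])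
      qed
      show "((\<lambda>w. snd b' (g (chart_inv c' w)) $ i) has_field_derivative
          (- (\<alpha> c' b' x *v snd b' (g x))) $ i) (at (snd c' x))"
        by (rule DERIV_cong_ev[OF refl ev refl, THEN iffD1, OF D[unfolded eq]])
    qed
    ultimately show ?thesis by blast
  qed
  moreover have "x0 \<in> V" using c r by (simp add: V_def)
  ultimately show ?thesis using openV by blast
qed

lemma flat_local_system:
  assumes \<alpha>: "holomorphic_connection A pr B \<alpha>"
  shows "local_system pr (flat_section \<alpha>)"
proof
  show "pr (g x) = x" if "flat_section \<alpha> V g" "x \<in> V" for V g x
    using that by (simp add: flat_section_def)
  show "\<exists>V. open V \<and> x0 \<in> V \<and> (\<forall>x \<in> V. \<forall>e. pr e = x \<longrightarrow> (\<exists>g. flat_section \<alpha> V g \<and> g x = e))" for x0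
    by (rule flat_section_exists[OF \<alpha>])
qed (use \<alpha> flat_section_unique in \<open>auto simp: holomorphic_connection_def\<close>)

text \<open>Connections form an affine space over endomorphism-valued forms: the derivative of the
  transition matrix enters through \<alpha> only, and \<Phi> transforms linearly.\<close>

lemma holomorphic_connection_add_higgs:
  assumes \<alpha>: "holomorphic_connection A pr B \<alpha>" and \<Phi>: "higgs_field A pr B \<Phi>"
  shows "holomorphic_connection A pr B (\<lambda>c b x. \<alpha> c b x + t *\<^sub>R \<Phi> c b x)"
  unfolding holomorphic_connection_def
proof (intro conjI ballI)
  show "holomorphic_coeffs A B (\<lambda>c b x. \<alpha> c b x + t *\<^sub>R \<Phi> c b x)"
    unfolding holomorphic_coeffs_def holomorphic_fun_def case_prod_unfold o_def
  proof (intro ballI allI)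
    fix c b i j c' assume *: "c \<in> A" "b \<in> B" "c' \<in> A"
    have "holomorphic_fun A (fst c \<inter> fst b) (\<lambda>x. \<alpha> c b x $ i $ j)"
      "holomorphic_fun A (fst c \<inter> fst b) (\<lambda>x. \<Phi> c b x $ i $ j)"
      using \<alpha> \<Phi> * unfolding holomorphic_connection_def higgs_field_def holomorphic_coeffs_def by blast+
    from this[THEN holomorphic_funD, OF *(3)]
    show "(\<lambda>w. (\<alpha> c b (chart_inv c' w) + t *\<^sub>R \<Phi> c b (chart_inv c' w)) $ i $ j)
        holomorphic_on snd c' ` (fst c' \<inter> (fst c \<inter> fst b))"
      by (simp add: scaleR_conv_of_real holomorphic_on_add holomorphic_on_mult holomorphic_on_const)
  qed
  fix c c' b b' x
  assume *: "c \<in> A" "c' \<in> A" "b \<in> B" "b' \<in> B" "x \<in> fst c \<inter> fst c' \<inter> fst b \<inter> fst b'"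
  define dT where "dT = (\<chi> i j. deriv (\<lambda>w. transition pr b b' (chart_inv c w) $ i $ j) (snd c x))"
  have "mat (chart_deriv c c' x) ** \<alpha> c' b' x ** transition pr b b' x = transition pr b b' x ** \<alpha> c b x - dT"
    using \<alpha> * unfolding holomorphic_connection_def dT_def by blast
  moreover have "mat (chart_deriv c c' x) ** \<Phi> c' b' x ** transition pr b b' x = transition pr b b' x ** \<Phi> c b x"
    using \<Phi> * unfolding higgs_field_def by blast
  ultimately show "mat (chart_deriv c c' x) ** (\<alpha> c' b' x + t *\<^sub>R \<Phi> c' b' x) ** transition pr b b' x
      = transition pr b b' x ** (\<alpha> c b x + t *\<^sub>R \<Phi> c b x)
        - (\<chi> i j. deriv (\<lambda>w. transition pr b b' (chart_inv c w) $ i $ j) (snd c x))"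
    unfolding dT_def[symmetric]
    by (simp add: matrix_add_ldistrib matrix_mult_add_distrib_right scaleR_matrix_mult_left scaleR_matrix_mult_right)
qed

end

end

section \<open>Parallel transport\<close>

lemma continuous_on_real_nhd:
  fixes f :: "real \<Rightarrow> 'a::topological_space"
  assumes "continuous_on S f" "open M" "x \<in> S" "f x \<in> M"
  obtains d where "d > 0" "\<And>y. y \<in> S \<Longrightarrow> dist y x < d \<Longrightarrow> f y \<in> M"
proof -
  obtain N where N: "open N" "x \<in> N" "\<And>y. y \<in> N \<Longrightarrow> y \<in> S \<Longrightarrow> f y \<in> M"
    by (rule continuous_on_nhd[OF assms]) (rule that)
  obtain d where "d > 0" "\<And>y. dist y x < d \<Longrightarrow> y \<in> N"
    using N(1,2) unfolding open_dist by blast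
  with N(3) that show ?thesis by blast
qed

lemma path_speed_derivative:
  assumes "C1_path A p \<gamma>" "c \<in> A" "\<tau> \<in> {0..1}" "p (\<gamma> \<tau>) \<in> fst c"
  shows "((\<lambda>\<tau>. snd c (p (\<gamma> \<tau>))) has_vector_derivative path_speed p c \<gamma> \<tau>) (at \<tau> within {0..1})"
proof -
  have "(snd c \<circ> p \<circ> \<gamma>) differentiable (at \<tau> within {0..1})"
    using assms unfolding C1_path_def Let_def by blast
  from this[unfolded vector_derivative_works] show ?thesis
    unfolding path_speed_def o_def .
qed

lemma path_speed_continuous:
  assumes "C1_path A p \<gamma>" "c \<in> A"
  shows "continuous_on {\<tau> \<in> {0..1}. p (\<gamma> \<tau>) \<in> fst c} (path_speed p c \<gamma>)"
  using assms unfolding C1_path_def Let_def by blast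

context
  fixes A :: "'x::t2_space chart set" and pr :: "'e \<Rightarrow> 'x" and B :: "('x, 'e, 'r::finite) triv set"
    and p :: "'y::topological_space \<Rightarrow> 'x" and \<gamma> :: "real \<Rightarrow> 'y"
  assumes rs: "riemann_surface A" and hb: "holomorphic_bundle A pr B"
    and p: "continuous_on UNIV p" and \<gamma>: "C1_path A p \<gamma>"
begin

lemma path_continuous: "continuous_on {0..1} (\<lambda>\<tau>. p (\<gamma> \<tau>))"
  using \<gamma> p unfolding C1_path_def by (auto intro: continuous_on_compose2)

lemma coeffs_along_continuous:
  assumes \<alpha>: "holomorphic_coeffs A B \<alpha>" and cb: "c \<in> A" "b \<in> B"
  shows "continuous_on {\<tau> \<in> {0..1}. p (\<gamma> \<tau>) \<in> fst c \<inter> fst b} (\<lambda>\<tau>. \<alpha> c b (p (\<gamma> \<tau>)) $ i $ j)"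
  by (rule continuous_on_compose2[OF coeffs_continuous[OF rs hb \<alpha> cb]
        continuous_on_subset[OF path_continuous]]) auto

lemma speed_times_coeffs_continuous:
  assumes \<alpha>: "holomorphic_coeffs A B \<alpha>" and cb: "c \<in> A" "b \<in> B"
  shows "continuous_on {\<tau> \<in> {0..1}. p (\<gamma> \<tau>) \<in> fst c \<inter> fst b}
    (\<lambda>\<tau>. path_speed p c \<gamma> \<tau> * \<alpha> c b (p (\<gamma> \<tau>)) $ i $ j)"
  by (intro continuous_on_mult coeffs_along_continuous[OF \<alpha> cb]
      continuous_on_subset[OF path_speed_continuous[OF \<gamma> cb(1)]]) auto

lemma chart_nhd_along:
  assumes cb: "c \<in> A" "b \<in> B" and \<tau>: "\<tau> \<in> {0..1}" "p (\<gamma> \<tau>) \<in> fst c \<inter> fst b"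
  obtains d where "d > 0" "\<And>y. y \<in> {0..1} \<Longrightarrow> dist y \<tau> < d \<Longrightarrow> p (\<gamma> y) \<in> fst c \<inter> fst b"
  by (rule continuous_on_real_nhd[OF path_continuous open_Int[OF chart_open[OF rs cb(1)] triv_open[OF rs hb cb(2)]] \<tau>])
    (rule that)

lemma parallel_along_iff:
  "parallel_along A pr B p (\<alpha>, \<lambda>c b x. 0) \<gamma> s \<longleftrightarrow> 
    (\<forall>\<tau> \<in> {0..1}. pr (s \<tau>) = p (\<gamma> \<tau>)) \<and>
    (\<forall>c \<in> A. \<forall>b \<in> B. \<forall>\<tau> \<in> {0..1}. p (\<gamma> \<tau>) \<in> fst c \<inter> fst b \<longrightarrow>
      ((\<lambda>\<tau>. snd b (s \<tau>)) has_vector_derivative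
         - (path_speed p c \<gamma> \<tau> *s (\<alpha> c b (p (\<gamma> \<tau>)) *v snd b (s \<tau>)))) (at \<tau> within {0..1}))"
proof -
  have "mat z ** (0 :: complex ^ 'r ^ 'r) = 0" for z
    by (simp add: vec_eq_iff matrix_matrix_mult_def)
  then show ?thesis
    unfolding parallel_along_def fst_conv snd_conv o_def
    by (simp add: matrix_vector_mul_assoc[symmetric] mat_vector_mult)
qed

text \<open>Near each time the lift is a flat section composed with the path, so the parallel
  equation is the chain rule.\<close>

lemma lift_parallel:
  assumes \<alpha>: "holomorphic_connection A pr B \<alpha>"
    and \<sigma>: "local_system.is_lift (flat_section A pr B \<alpha>) {0..1} (\<lambda>\<tau>. p (\<gamma> \<tau>)) \<sigma>"
  shows "parallel_along A pr B p (\<alpha>, \<lambda>c b x. 0) \<gamma> \<sigma>"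
proof -
  interpret local_system pr "flat_section A pr B \<alpha>"
    by (rule flat_local_system[OF rs hb \<alpha>])
  show ?thesis
    unfolding parallel_along_iff
  proof (intro conjI ballI impI)
    show "pr (\<sigma> \<tau>) = p (\<gamma> \<tau>)" if "\<tau> \<in> {0..1}" for \<tau>
      by (rule lift_projection[OF \<sigma> that])
    fix c b \<tau> assume cb: "c \<in> A" "b \<in> B" and \<tau>: "\<tau> \<in> {0..1}" "p (\<gamma> \<tau>) \<in> fst c \<inter> fst b"
    obtain V g N where N: "flat_section A pr B \<alpha> V g" "open N" "\<tau> \<in> N"
        "\<And>y. y \<in> N \<Longrightarrow> y \<in> {0..1} \<Longrightarrow> p (\<gamma> y) \<in> V" "\<And>y. y \<in> N \<Longrightarrow> y \<in> {0..1} \<Longrightarrow> \<sigma> y = g (p (\<gamma> y))"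
      by (rule is_liftE[OF \<sigma> \<tau>(1)]) (rule that)
    obtain d1 where d1: "d1 > 0" "\<And>y. dist y \<tau> < d1 \<Longrightarrow> y \<in> N"
      using N(2,3) unfolding open_dist by blast
    obtain d2 where d2: "d2 > 0" "\<And>y. y \<in> {0..1} \<Longrightarrow> dist y \<tau> < d2 \<Longrightarrow> p (\<gamma> y) \<in> fst c \<inter> fst b"
      by (rule chart_nhd_along[OF cb \<tau>]) (rule that)
    let ?x = "p (\<gamma> \<tau>)" and ?d = "min d1 d2"
    have \<sigma>\<tau>: "\<sigma> \<tau> = g ?x" by (rule N(5)[OF N(3) \<tau>(1)])
    show "((\<lambda>\<tau>. snd b (\<sigma> \<tau>)) has_vector_derivative
         - (path_speed p c \<gamma> \<tau> *s (\<alpha> c b ?x *v snd b (\<sigma> \<tau>)))) (at \<tau> within {0..1})"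
    proof (rule has_vector_derivative_vecI)
      fix i
      have "((\<lambda>w. snd b (g (chart_inv c w)) $ i) has_field_derivative (- (\<alpha> c b ?x *v snd b (g ?x))) $ i)
          (at (snd c ?x))"
        using N(1) N(4)[OF N(3) \<tau>(1)] cb \<tau>(2) unfolding flat_section_def[OF rs hb] by blast
      from field_vector_diff_chain_within[OF path_speed_derivative[OF \<gamma> cb(1) \<tau>(1) IntD1[OF \<tau>(2)]]
          has_field_derivative_at_within[OF this]]
      have D: "((\<lambda>y. snd b (g (chart_inv c (snd c (p (\<gamma> y))))) $ i) has_vector_derivative
          path_speed p c \<gamma> \<tau> * (- (\<alpha> c b ?x *v snd b (g ?x))) $ i) (at \<tau> within {0..1})"
        unfolding o_def .
      have "((\<lambda>y. snd b (\<sigma> y) $ i) has_vector_derivative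
          path_speed p c \<gamma> \<tau> * (- (\<alpha> c b ?x *v snd b (g ?x))) $ i) (at \<tau> within {0..1})"
      proof (rule has_vector_derivative_transform_within[OF D])
        show "0 < ?d" using d1 d2 by simp
        fix y assume y: "y \<in> {0..1}" "dist y \<tau> < ?d"
        have "chart_inv c (snd c (p (\<gamma> y))) = p (\<gamma> y)"
          by (rule chart_inv_chart[OF rs cb(1)]) (use d2(2)[of y] y in simp)
        moreover have "\<sigma> y = g (p (\<gamma> y))" by (rule N(5)) (use d1(2)[of y] y in simp_all)
        ultimately show "snd b (g (chart_inv c (snd c (p (\<gamma> y))))) $ i = snd b (\<sigma> y) $ i" by simp
      qed (rule \<tau>)
      then show "((\<lambda>y. snd b (\<sigma> y) $ i) has_vector_derivative
          (- (path_speed p c \<gamma> \<tau> *s (\<alpha> c b ?x *v snd b (\<sigma> \<tau>)))) $ i) (at \<tau> within {0..1})"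
        unfolding \<sigma>\<tau> by simp
    qed
  qed
qed

text \<open>A parallel section is not known to be a lift, so \<open>lift_unique\<close> does not
  apply. Uniqueness for the linear equation settles one chart and trivialisation, and connectedness
  of the interval links them.\<close>

lemma parallel_unique:
  assumes \<alpha>: "holomorphic_coeffs A B \<alpha>"
    and s: "parallel_along A pr B p (\<alpha>, \<lambda>c b x. 0) \<gamma> s" and s': "parallel_along A pr B p (\<alpha>, \<lambda>c b x. 0) \<gamma> s'"
    and "s 0 = s' 0" and \<tau>: "\<tau> \<in> {0..1}"
  shows "s \<tau> = s' \<tau>"
proof (rule connected_induction_simple[where S = "{0..1}" and a = 0 and P = "\<lambda>\<tau>. s \<tau> = s' \<tau>"])
  fix \<tau> :: real assume \<tau>: "\<tau> \<in> {0..1}"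
  obtain c where c: "c \<in> A" "p (\<gamma> \<tau>) \<in> fst c" by (rule chart_exists[OF rs])
  obtain b where b: "b \<in> B" "p (\<gamma> \<tau>) \<in> fst b" by (rule triv_exists[OF rs hb])
  let ?I = "{\<tau> \<in> {0..1}. p (\<gamma> \<tau>) \<in> fst c \<inter> fst b}"
  \<comment> \<open>The growth constant of the linear equation at time \<open>y\<close>; by
    continuity it is at most \<open>k \<tau> + 1\<close> near \<tau>.\<close>
  define k where "k y = norm (path_speed p c \<gamma> y) * entry_sum (\<alpha> c b (p (\<gamma> y)))" for y
  have "continuous_on ?I k"
    unfolding k_def
    by (intro continuous_on_mult continuous_on_norm continuous_on_entry_sum
        coeffs_along_continuous[OF \<alpha> c(1) b(1)] continuous_on_subset[OF path_speed_continuous[OF \<gamma> c(1)]]) auto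
  then obtain d1 where d1: "d1 > 0" "\<And>y. y \<in> ?I \<Longrightarrow> dist y \<tau> < d1 \<Longrightarrow> k y \<in> {..<k \<tau> + 1}"
    by (rule continuous_on_real_nhd[of ?I k "{..<k \<tau> + 1}" \<tau>]) (use \<tau> c b in auto)
  obtain d2 where d2: "d2 > 0" "\<And>y. y \<in> {0..1} \<Longrightarrow> dist y \<tau> < d2 \<Longrightarrow> p (\<gamma> y) \<in> fst c \<inter> fst b"
    by (rule chart_nhd_along[OF c(1) b(1) \<tau> IntI[OF c(2) b(2)]]) (rule that)
  define d where "d = min d1 d2"
  have d: "p (\<gamma> y) \<in> fst c \<inter> fst b" "k y \<le> k \<tau> + 1" if "y \<in> {0..1}" "dist y \<tau> < d" for y
  proof -
    show *: "p (\<gamma> y) \<in> fst c \<inter> fst b" by (rule d2(2)[OF that(1)]) (use that in \<open>simp add: d_def\<close>)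
    show "k y \<le> k \<tau> + 1" using d1(2)[of y] that * by (simp add: d_def)
  qed
  define \<phi> where "\<phi> y = snd b (s y) - snd b (s' y)" for y
  have "s y = s' y" if x: "x \<in> {0..1}" "dist x \<tau> < d" and eq: "s x = s' x" and y: "y \<in> {0..1}" "dist y \<tau> < d" for x y
  proof -
    have J: "z \<in> {0..1} \<and> dist z \<tau> < d" if "z \<in> {min x y..max x y}" for z
      using x y that by (auto simp: dist_real_def)
    have "\<phi> y = 0"
    proof (rule linear_ode_zero)
      fix z assume z: "z \<in> {min x y..max x y}"
      have sub: "{min x y..max x y} \<subseteq> {0..1}" using x y by auto
      have zI: "z \<in> {0..1}" "p (\<gamma> z) \<in> fst c \<inter> fst b" using J[OF z] d(1) by blast+
      have "((\<lambda>\<tau>. snd b (s \<tau>)) has_vector_derivative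
         - (path_speed p c \<gamma> z *s (\<alpha> c b (p (\<gamma> z)) *v snd b (s z)))) (at z within {0..1})"
        "((\<lambda>\<tau>. snd b (s' \<tau>)) has_vector_derivative
         - (path_speed p c \<gamma> z *s (\<alpha> c b (p (\<gamma> z)) *v snd b (s' z)))) (at z within {0..1})"
        using s s' c b zI unfolding parallel_along_iff by blast+
      from has_vector_derivative_diff[OF this]
      have "(\<phi> has_vector_derivative - (path_speed p c \<gamma> z *s (\<alpha> c b (p (\<gamma> z)) *v \<phi> z))) (at z within {0..1})"
        unfolding \<phi>_def by (simp add: matrix_vector_mult_diff_distrib vector_sub_rdistrib algebra_simps)
      then show "(\<phi> has_vector_derivative - (path_speed p c \<gamma> z *s (\<alpha> c b (p (\<gamma> z)) *v \<phi> z)))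
          (at z within {min x y..max x y})"
        by (rule has_vector_derivative_within_subset[OF _ sub])
      have "norm (path_speed p c \<gamma> z *s (\<alpha> c b (p (\<gamma> z)) *v \<phi> z)) \<le> k z * norm (\<phi> z)"
        unfolding norm_vector_scalar_mult k_def mult.assoc
        by (intro mult_left_mono norm_matrix_vector_le norm_ge_zero)
      also have "\<dots> \<le> (k \<tau> + 1) * norm (\<phi> z)"
        using d(2) J[OF z] by (intro mult_right_mono) auto
      finally show "norm (- (path_speed p c \<gamma> z *s (\<alpha> c b (p (\<gamma> z)) *v \<phi> z))) \<le> (k \<tau> + 1) * norm (\<phi> z)"
        by simp
    next
      show "\<phi> x = 0" by (simp add: \<phi>_def eq)
    qed auto
    then have "snd b (s y) = snd b (s' y)" by (simp add: \<phi>_def)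
    moreover have "pr (s y) = p (\<gamma> y)" "pr (s' y) = p (\<gamma> y)"
      using s s' y(1) unfolding parallel_along_iff by blast+
    ultimately show ?thesis using d(1)[OF y] by (intro triv_inj[OF rs hb b(1)]) simp_all
  qed
  note agree = this
  have "\<forall>x \<in> {0..1} \<inter> ball \<tau> d. \<forall>y \<in> {0..1} \<inter> ball \<tau> d. s x = s' x \<longrightarrow> s y = s' y"
  proof (intro ballI impI)
    fix x y assume *: "x \<in> {0..1} \<inter> ball \<tau> d" "y \<in> {0..1} \<inter> ball \<tau> d" "s x = s' x"
    show "s y = s' y"
      by (rule agree[of x y]) (use * in \<open>simp_all add: dist_commute\<close>)
  qed
  moreover have "\<tau> \<in> {0..1} \<inter> ball \<tau> d" using \<tau> d1(1) d2(1) by (simp add: d_def)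
  ultimately show "\<exists>T. openin (top_of_set {0..1}) T \<and> \<tau> \<in> T \<and> (\<forall>x \<in> T. \<forall>y \<in> T. s x = s' x \<longrightarrow> s y = s' y)"
    using openin_open_Int[OF open_ball] by blast
qed (use assms(4) \<tau> in simp_all)

lemma parallel_exists:
  assumes \<alpha>: "holomorphic_connection A pr B \<alpha>" and e: "pr e = p (\<gamma> 0)"
  obtains s where "parallel_along A pr B p (\<alpha>, \<lambda>c b x. 0) \<gamma> s" "s 0 = e"
    "local_system.is_lift (flat_section A pr B \<alpha>) {0..1} (\<lambda>\<tau>. p (\<gamma> \<tau>)) s"
proof -
  interpret local_system pr "flat_section A pr B \<alpha>"
    by (rule flat_local_system[OF rs hb \<alpha>])
  obtain s where s: "is_lift {0..1} (\<lambda>\<tau>. p (\<gamma> \<tau>)) s" "s 0 = e"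
    by (rule path_lift_exists[OF path_continuous e]) (rule that)
  show ?thesis by (rule that[OF lift_parallel[OF \<alpha> s(1)] s(2) s(1)])
qed

end

text \<open>Gives the definite description in \<open>transport\<close> its value. By uniqueness for
  the equation, a parallel section along any competing path ends where a lift in the local system of
  flat sections ends, and those ends depend only on the end points of the path because the cover is
  simply connected.\<close>

theorem transport_eq:
  fixes A :: "'x::t2_space chart set" and pr :: "'e \<Rightarrow> 'x" and B :: "('x, 'e, 'r::finite) triv set"
    and p :: "'y::topological_space \<Rightarrow> 'x" and \<gamma> :: "real \<Rightarrow> 'y"
  assumes rs: "riemann_surface A" and hb: "holomorphic_bundle A pr B" and uc: "universal_cover p"
    and \<alpha>: "holomorphic_connection A pr B \<alpha>" and \<gamma>: "C1_path A p \<gamma>"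
    and s: "parallel_along A pr B p (\<alpha>, \<lambda>c b x. 0) \<gamma> s"
  shows "transport A pr B p (\<alpha>, \<lambda>c b x. 0) (\<gamma> 0) (\<gamma> 1) (s 0) = s 1"
proof -
  interpret local_system pr "flat_section A pr B \<alpha>"
    by (rule flat_local_system[OF rs hb \<alpha>])
  have p: "continuous_on UNIV p" and sc: "simply_connected (UNIV :: 'y set)"
    using uc by (auto simp: universal_cover_def covering_space_def)
  have hol: "holomorphic_coeffs A B \<alpha>" using \<alpha> by (simp add: holomorphic_connection_def)
  let ?par = "parallel_along A pr B p (\<alpha>, \<lambda>c b x. 0)"
  have lift: "\<exists>\<sigma>. is_lift {0..1} (p \<circ> \<gamma>') \<sigma> \<and> \<sigma> 0 = s' 0 \<and> \<sigma> 1 = s' 1"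
    if \<gamma>': "C1_path A p \<gamma>'" and s': "?par \<gamma>' s'" for \<gamma>' s'
  proof -
    have "pr (s' 0) = p (\<gamma>' 0)" using s' by (simp add: parallel_along_def)
    then obtain \<sigma> where \<sigma>: "?par \<gamma>' \<sigma>" "\<sigma> 0 = s' 0" "is_lift {0..1} (\<lambda>\<tau>. p (\<gamma>' \<tau>)) \<sigma>"
      by (rule parallel_exists[OF rs hb p \<gamma>' \<alpha>]) (rule that)
    have "\<sigma> 1 = s' 1"
      by (rule parallel_unique[OF rs hb p \<gamma>' hol \<sigma>(1) s' \<sigma>(2)]) simp
    with \<sigma> show ?thesis by (auto simp: o_def)
  qed
  have unique: "s' 1 = s 1"
    if \<gamma>': "C1_path A p \<gamma>'" "\<gamma>' 0 = \<gamma> 0" "\<gamma>' 1 = \<gamma> 1" and s': "?par \<gamma>' s'" "s' 0 = s 0" for \<gamma>' s'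
  proof -
    obtain \<sigma> where \<sigma>: "is_lift {0..1} (p \<circ> \<gamma>) \<sigma>" "\<sigma> 0 = s 0" "\<sigma> 1 = s 1" using lift[OF \<gamma> s] by blast
    obtain \<sigma>' where \<sigma>': "is_lift {0..1} (p \<circ> \<gamma>') \<sigma>'" "\<sigma>' 0 = s' 0" "\<sigma>' 1 = s' 1" using lift[OF \<gamma>'(1) s'(1)] by blast
    have "path \<gamma>" "path \<gamma>'" using \<gamma> \<gamma>'(1) unfolding C1_path_def path_def by blast+
    then have "\<sigma>' 1 = \<sigma> 1"
      using lift_homotopy_invariant[OF sc p _ _ _ _ _ _ \<sigma>'(1) \<sigma>(1)] \<gamma>'(2,3) s'(2) \<sigma>(2) \<sigma>'(2) by simp
    then show ?thesis using \<sigma> \<sigma>' by simp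
  qed
  show ?thesis unfolding transport_def
  proof (rule the_equality)
    show "\<exists>\<gamma>' s'. C1_path A p \<gamma>' \<and> \<gamma>' 0 = \<gamma> 0 \<and> \<gamma>' 1 = \<gamma> 1 \<and> ?par \<gamma>' s' \<and> s' 0 = s 0 \<and> s' 1 = s 1"
      using \<gamma> s by blast
  qed (use unique in blast)
qed

section \<open>Matrices with simple spectrum\<close>

lemma matrix_vector_mult_sum_right: "(A::complex^'n^'m) *v (\<Sum>i\<in>I. f i) = (\<Sum>i\<in>I. A *v f i)"
  by (simp add: vec_eq_iff matrix_vector_mult_component sum_distrib_left) (intro allI sum.swap)

text \<open>Applying \<open>M\<close> and subtracting \<open>l k\<close> times the relation removes
  the \<open>k\<close>-th vector and multiplies the other coefficients by the nonzero numbers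
  \<open>l i - l k\<close>.\<close>

lemma eigenvectors_independent:
  fixes M :: "complex ^ 'r ^ 'r"
  assumes "finite I" "inj_on l I" "\<And>i. i \<in> I \<Longrightarrow> M *v v i = l i *s v i" "\<And>i. i \<in> I \<Longrightarrow> v i \<noteq> 0"
    and "(\<Sum>i\<in>I. x i *s v i) = 0"
  shows "\<forall>i\<in>I. x i = 0"
  using assms
proof (induction I arbitrary: x rule: finite_induct)
  case (insert k I)
  have s: "x k *s v k + (\<Sum>i\<in>I. x i *s v i) = 0" using insert by simp
  then have "M *v (x k *s v k + (\<Sum>i\<in>I. x i *s v i)) = 0" by simp
  then have 1: "(x k * l k) *s v k + (\<Sum>i\<in>I. (x i * l i) *s v i) = 0"
    using insert.prems(2)
    by (simp add: matrix_vector_right_distrib matrix_vector_mult_sum_right vector_scalar_commute vector_smult_assoc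
        mult.commute)
  have 2: "(x k * l k) *s v k + (\<Sum>i\<in>I. (x i * l k) *s v i) = 0"
  proof -
    have "l k *s (x k *s v k + (\<Sum>i\<in>I. x i *s v i)) = 0" using s by simp
    then show ?thesis by (simp add: vec_eq_iff sum_distrib_left algebra_simps)
  qed
  have "(\<Sum>i\<in>I. (x i * (l i - l k)) *s v i) = 0"
  proof -
    have "(\<Sum>i\<in>I. (x i * (l i - l k)) *s v i) = (\<Sum>i\<in>I. (x i * l i) *s v i) - (\<Sum>i\<in>I. (x i * l k) *s v i)"
      unfolding sum_subtractf[symmetric] by (rule sum.cong) (simp_all add: vec_eq_iff right_diff_distrib left_diff_distrib)
    also have "\<dots> = 0" unfolding add_left_imp_eq[OF trans[OF 1 2[symmetric]]] by (rule diff_self)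
    finally show ?thesis .
  qed
  then have "\<forall>i\<in>I. x i * (l i - l k) = 0"
    by (intro insert.IH) (use insert.prems in \<open>auto simp: inj_on_def\<close>)
  moreover have "l i \<noteq> l k" if "i \<in> I" for i using insert.prems(1) insert.hyps(2) that by (auto simp: inj_on_def)
  ultimately have xI: "\<forall>i\<in>I. x i = 0" by auto
  then have "x k *s v k = 0" using s by simp
  then have "x k = 0" using insert.prems(3)[of k] by (auto simp: vector_mul_eq_0)
  with xI show ?case by simp
qed simp

text \<open>The columns of \<open>S\<close> are eigenvectors, and \<open>R\<close> sends a vector to
  its coordinates in them, where \<open>M\<close> acts diagonally.\<close>

definition eigenbasis :: "complex ^ 'r ^ 'r \<Rightarrow> ('r \<Rightarrow> complex) \<Rightarrow> complex ^ 'r ^ 'r \<Rightarrow> complex ^ 'r ^ 'r \<Rightarrow> bool" where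
  "eigenbasis M l R S \<longleftrightarrow> inj l \<and> range l = eigenvalues M \<and> R ** S = mat 1 \<and> S ** R = mat 1 \<and>
     (\<forall>v i. (R *v (M *v v)) $ i = l i * (R *v v) $ i)"

lemma eigenbasis_exists:
  fixes M :: "complex ^ 'r ^ 'r::finite"
  assumes "card (eigenvalues M) = CARD('r)"
  obtains l R S where "eigenbasis M l R S"
proof -
  have "CARD('r) > 0" by (rule zero_less_card_finite)
  then have fin: "finite (eigenvalues M)" using assms card_ge_0_finite by metis
  obtain l where l: "bij_betw l (UNIV :: 'r set) (eigenvalues M)"
    using finite_same_card_bij[OF finite fin] assms by metis
  have "\<forall>i. \<exists>v. v \<noteq> 0 \<and> M *v v = l i *s v"
    using l unfolding bij_betw_def eigenvalues_def by blast
  from choice[OF this] obtain v where v: "\<And>i. v i \<noteq> 0" "\<And>i. M *v v i = l i *s v i" by blast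
  define S :: "complex ^ 'r ^ 'r" where "S = (\<chi> k i. v i $ k)"
  have S: "S *v x = (\<Sum>i\<in>UNIV. x $ i *s v i)" for x
    by (simp add: vec_eq_iff matrix_vector_mult_component S_def mult.commute)
  have injl: "inj l" "range l = eigenvalues M" using l by (auto simp: bij_betw_def)
  have "\<forall>x. S *v x = 0 \<longrightarrow> x = 0"
  proof (intro allI impI)
    fix x assume "S *v x = 0"
    then have "(\<Sum>i\<in>UNIV. x $ i *s v i) = 0" unfolding S .
    then have "\<forall>i\<in>UNIV. x $ i = 0"
      by (rule eigenvectors_independent[of UNIV l M v, OF finite injl(1) v(2) v(1)])
    then show "x = 0" by (simp add: vec_eq_iff)
  qed
  then obtain R where R: "R ** S = mat 1" using matrix_left_invertible_ker[of S] by blast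
  then have SR: "S ** R = mat 1" by (simp add: matrix_left_right_inverse)
  have MS: "M *v (S *v x) = S *v (\<chi> i. l i * x $ i)" for x
    unfolding S matrix_vector_mult_sum_right
    by (simp add: vector_scalar_commute v(2) vector_smult_assoc mult.commute)
  have "(R *v (M *v w)) $ i = l i * (R *v w) $ i" for w i
  proof -
    have "w = S *v (R *v w)" by (simp add: matrix_vector_mul_assoc SR)
    then have "R *v (M *v w) = R *v (S *v (\<chi> i. l i * (R *v w) $ i))" by (metis MS)
    then show ?thesis by (simp add: matrix_vector_mul_assoc R)
  qed
  with injl R SR that show ?thesis unfolding eigenbasis_def by blast
qed

lemma det_eigenbasis:
  fixes M :: "complex ^ 'r ^ 'r::finite"
  assumes "eigenbasis M l R S"
  shows "det (mat z - M) = (\<Prod>i\<in>UNIV. z - l i)"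
proof -
  define Dg :: "complex ^ 'r ^ 'r" where "Dg = (\<chi> i j. if i = j then z - l i else 0)"
  have RS: "R ** S = mat 1" and R: "\<And>v i. (R *v (M *v v)) $ i = l i * (R *v v) $ i"
    using assms by (auto simp: eigenbasis_def)
  have "R ** (mat z - M) = Dg ** R"
  proof (subst matrix_eq, intro allI)
    fix v
    have "(R ** (mat z - M)) *v v = R *v (z *s v - M *v v)"
      by (simp add: matrix_vector_mul_assoc[symmetric] matrix_vector_mult_diff_rdistrib mat_vector_mult)
    also have "\<dots> = Dg *v (R *v v)"
      by (simp add: vec_eq_iff matrix_vector_mult_diff_distrib vector_scalar_commute R)
        (simp add: Dg_def matrix_vector_mult_component if_distrib if_distribR left_diff_distrib cong: if_cong)
    finally show "(R ** (mat z - M)) *v v = (Dg ** R) *v v" by (simp add: matrix_vector_mul_assoc)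
  qed
  then have "det R * det (mat z - M) = det Dg * det R" by (metis det_mul)
  moreover have "det R * det S = 1" using RS by (metis det_I det_mul)
  ultimately have "det (mat z - M) = det Dg" by (metis mult.commute mult_cancel_left mult_zero_left zero_neq_one)
  also have "\<dots> = (\<Prod>i\<in>UNIV. z - l i)" by (subst det_diagonal) (auto simp: Dg_def)
  finally show ?thesis .
qed

section \<open>Semicontinuity of the spectrum\<close>

lemma continuous_on_det:
  assumes "\<And>i j. continuous_on S (\<lambda>x. (F x :: complex ^ 'n ^ 'n::finite) $ i $ j)"
  shows "continuous_on S (\<lambda>x. det (F x))"
  unfolding det_def by (intro continuous_on_sum continuous_on_mult continuous_on_const continuous_on_prod assms)

text \<open>If all eigenvalues of \<open>M \<tau>\<close> were at distance at least \<open>\<epsilon>\<close> from the eigenvalue \<open>z\<close> of \<open>M x\<close>, then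
  the characteristic polynomial of \<open>M \<tau>\<close> at \<open>z\<close> would be bounded below by a power of \<open>\<epsilon>\<close>.\<close>

lemma eigenvalues_lower_semicontinuous:
  fixes M :: "real \<Rightarrow> complex ^ 'r ^ 'r::finite"
  assumes cont: "\<And>i j. continuous_on I (\<lambda>\<tau>. M \<tau> $ i $ j)"
    and card: "\<And>\<tau>. \<tau> \<in> I \<Longrightarrow> card (eigenvalues (M \<tau>)) = CARD('r)"
    and x: "x \<in> I" and z: "z \<in> eigenvalues (M x)" and \<epsilon>: "\<epsilon> > 0"
  shows "\<exists>d>0. \<forall>\<tau>\<in>I. dist \<tau> x < d \<longrightarrow> (\<exists>z'\<in>eigenvalues (M \<tau>). dist z z' < \<epsilon>)"
proof -
  let ?g = "\<lambda>\<tau>. det (mat z - M \<tau>)"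
  have "continuous_on I ?g"
    by (rule continuous_on_det, unfold vector_minus_component, intro continuous_on_diff continuous_on_const cont)
  then have cg: "continuous_on I (\<lambda>\<tau>. norm (?g \<tau>))" by (rule continuous_on_norm)
  have "?g x = 0"
  proof -
    obtain l R S where e: "eigenbasis (M x) l R S" using eigenbasis_exists[OF card[OF x]] by blast
    then obtain i where "z = l i" using z unfolding eigenbasis_def by blast
    then show ?thesis by (auto simp: det_eigenbasis[OF e])
  qed
  then have "norm (?g x) \<in> {..<\<epsilon> ^ CARD('r)}" using \<epsilon> by simp
  then obtain N where N: "open N" "x \<in> N" "\<And>\<tau>. \<tau> \<in> N \<Longrightarrow> \<tau> \<in> I \<Longrightarrow> norm (?g \<tau>) \<in> {..<\<epsilon> ^ CARD('r)}"
    by (rule continuous_on_nhd[OF cg open_lessThan x]) (rule that)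
  obtain d where d: "d > 0" "\<And>\<tau>. dist \<tau> x < d \<Longrightarrow> \<tau> \<in> N" using N(1,2) unfolding open_dist by blast
  have "\<exists>z'\<in>eigenvalues (M \<tau>). dist z z' < \<epsilon>" if \<tau>: "\<tau> \<in> I" "dist \<tau> x < d" for \<tau>
  proof (rule ccontr)
    assume no: "\<not> ?thesis"
    obtain l R S where e: "eigenbasis (M \<tau>) l R S" using eigenbasis_exists[OF card[OF \<tau>(1)]] by blast
    have "\<epsilon> ^ CARD('r) = (\<Prod>i\<in>(UNIV::'r set). \<epsilon>)" by simp
    also have "\<dots> \<le> (\<Prod>i\<in>UNIV. norm (z - l i))"
    proof (rule prod_mono)
      fix i :: 'r
      have "l i \<in> eigenvalues (M \<tau>)" using e unfolding eigenbasis_def by blast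
      then show "0 \<le> \<epsilon> \<and> \<epsilon> \<le> norm (z - l i)" using no \<epsilon> by (auto simp: dist_norm not_less)
    qed
    also have "\<dots> = norm (?g \<tau>)" by (simp add: det_eigenbasis[OF e] prod_norm)
    finally show False using N(3)[OF d(2)[OF \<tau>(2)] \<tau>(1)] by simp
  qed
  with d(1) show ?thesis by blast
qed

section \<open>The eigenvalue of largest real part\<close>

definition top_real :: "complex set \<Rightarrow> real" where
  "top_real E = Max (Re ` E)"

text \<open>Quantifies, for positive \<open>g\<close>, the uniqueness of the leading eigenvalue. A
  gap that is uniform along the path later limits the \<delta> allowed in the lower growth
  bound.\<close>

definition has_gap :: "real \<Rightarrow> complex set \<Rightarrow> bool" where
  "has_gap g E \<longleftrightarrow> (\<exists>z\<in>E. Re z = top_real E \<and> (\<forall>w\<in>E. w \<noteq> z \<longrightarrow> Re w \<le> top_real E - g))"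

lemma has_gapI:
  assumes "finite E" "z \<in> E" "g \<ge> 0" "\<And>w. w \<in> E \<Longrightarrow> w \<noteq> z \<Longrightarrow> Re w \<le> Re z - g"
  shows "has_gap g E" "top_real E = Re z"
proof -
  show "top_real E = Re z" unfolding top_real_def
  proof (rule Max_eqI)
    fix y assume "y \<in> Re ` E"
    then obtain w where "w \<in> E" "y = Re w" by blast
    then show "y \<le> Re z" using assms(3) assms(4)[of w] by (cases "w = z") auto
  qed (use assms in auto)
  then show "has_gap g E" unfolding has_gap_def using assms by (intro bexI[of _ z]) auto
qed

lemma has_gap_mono: "has_gap g E \<Longrightarrow> g' \<le> g \<Longrightarrow> has_gap g' E"
  unfolding has_gap_def by force

lemma has_gap_exists:
  assumes E: "finite E" "E \<noteq> {}" "inj_on Re E"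
  obtains g where "g > 0" "has_gap g E"
proof -
  have "Max (Re ` E) \<in> Re ` E" using E by (intro Max_in) auto
  then obtain z where z: "z \<in> E" "Re z = Max (Re ` E)" by auto
  have lt: "Re w < Re z" if "w \<in> E - {z}" for w
  proof -
    have "Re w \<le> Re z" using that E z by simp
    moreover have "Re w \<noteq> Re z" using E(3) that z(1) by (auto simp: inj_on_def)
    ultimately show ?thesis by simp
  qed
  \<comment> \<open>The element 1 keeps the minimum meaningful when \<open>E\<close> is a single
    point.\<close>
  define g where "g = Min (insert 1 ((\<lambda>w. Re z - Re w) ` (E - {z})))"
  have fin: "finite (insert 1 ((\<lambda>w. Re z - Re w) ` (E - {z})))" using E by simp
  have "g > 0" unfolding g_def using fin lt by (subst Min_gr_iff) auto
  moreover have "has_gap g E"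
  proof (rule has_gapI(1)[OF E(1) z(1)])
    fix w assume "w \<in> E" "w \<noteq> z"
    then have "g \<le> Re z - Re w" unfolding g_def using fin by (intro Min_le) auto
    then show "Re w \<le> Re z - g" by simp
  qed (use \<open>g > 0\<close> in simp)
  ultimately show ?thesis using that by blast
qed

text \<open>Lower semicontinuity alone would allow \<open>E\<close> to have further points far away.
  Separation makes the choice of near points injective, and equal cardinality makes it onto. Real
  parts then move by less than \<open>g / 4\<close> each, so half of the gap remains.\<close>

lemma spectrum_perturbation:
  assumes E0: "finite E0" "has_gap g E0" and E: "finite E" "card E = card E0"
    and \<epsilon>: "0 < \<epsilon>" "\<epsilon> \<le> g / 4" and sep: "\<And>x y. x \<in> E0 \<Longrightarrow> y \<in> E0 \<Longrightarrow> x \<noteq> y \<Longrightarrow> 2 * \<epsilon> \<le> dist x y"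
    and near: "\<And>z. z \<in> E0 \<Longrightarrow> \<exists>z'\<in>E. dist z z' < \<epsilon>"
  shows "\<bar>top_real E - top_real E0\<bar> < \<epsilon>" "has_gap (g/2) E"
proof -
  have "\<forall>z\<in>E0. \<exists>z'. z' \<in> E \<and> dist z z' < \<epsilon>" using near by blast
  from bchoice[OF this] obtain f where f: "\<And>z. z \<in> E0 \<Longrightarrow> f z \<in> E" "\<And>z. z \<in> E0 \<Longrightarrow> dist z (f z) < \<epsilon>" by blast
  have "inj_on f E0"
  proof (rule inj_onI, rule ccontr)
    fix x y assume *: "x \<in> E0" "y \<in> E0" "f x = f y" "x \<noteq> y"
    have "dist x y \<le> dist x (f x) + dist y (f y)" using dist_triangle2[of x y "f x"] *(3) by simp
    then show False using sep[OF *(1,2,4)] f(2)[OF *(1)] f(2)[OF *(2)] by simp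
  qed
  then have fE: "f ` E0 = E"
    using f(1) E by (intro card_subset_eq) (auto simp: card_image)
  obtain z where z: "z \<in> E0" "Re z = top_real E0" "\<And>w. w \<in> E0 \<Longrightarrow> w \<noteq> z \<Longrightarrow> Re w \<le> Re z - g"
    using E0(2) unfolding has_gap_def by force
  have re: "\<bar>Re w - Re (f w)\<bar> < \<epsilon>" if "w \<in> E0" for w
    using f(2)[OF that] abs_Re_le_cmod[of "w - f w"] by (simp add: dist_norm)
  have g: "Re y \<le> Re (f z) - g / 2" if y: "y \<in> E" "y \<noteq> f z" for y
  proof -
    obtain w where w: "w \<in> E0" "y = f w" using y(1) fE by blast
    then have "w \<noteq> z" using y(2) by blast
    from z(3)[OF w(1) this] re[OF w(1)] re[OF z(1)] \<epsilon> w(2) show ?thesis by (auto simp: abs_real_def split: if_splits)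
  qed
  have fz: "f z \<in> E" using f(1) z(1) by blast
  have g0: "0 \<le> g / 2" using \<epsilon> by simp
  show "has_gap (g/2) E" by (rule has_gapI(1)[OF E(1) fz g0 g])
  have "top_real E = Re (f z)" by (rule has_gapI(2)[OF E(1) fz g0 g])
  then show "\<bar>top_real E - top_real E0\<bar> < \<epsilon>" using re[OF z(1)] z(2) by simp
qed

lemma spectrum_along_path:
  fixes E :: "real \<Rightarrow> complex set"
  assumes E: "\<And>\<tau>. \<tau> \<in> {0..1} \<Longrightarrow> card (E \<tau>) = N" "N > 0" "\<And>\<tau>. \<tau> \<in> {0..1} \<Longrightarrow> inj_on Re (E \<tau>)"
    and lsc: "\<And>x z \<epsilon>. x \<in> {0..1} \<Longrightarrow> z \<in> E x \<Longrightarrow> \<epsilon> > 0 \<Longrightarrow>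
       \<exists>d>0. \<forall>\<tau>\<in>{0..1}. dist \<tau> x < d \<longrightarrow> (\<exists>z'\<in>E \<tau>. dist z z' < \<epsilon>)"
  shows "continuous_on {0..1} (\<lambda>\<tau>. top_real (E \<tau>))"
    and "\<exists>g>0. \<forall>\<tau>\<in>{0..1}. has_gap g (E \<tau>)"
proof -
  have fin: "finite (E \<tau>)" "E \<tau> \<noteq> {}" if "\<tau> \<in> {0..1}" for \<tau>
    using E(1)[OF that] E(2) by (auto intro: card_ge_0_finite)
  \<comment> \<open>The gap is chosen before \<eta>: one statement thus yields continuity, with
    \<eta> arbitrary, and a gap that is uniform near \<open>x\<close>.\<close>
  have loc: "\<exists>g>0. \<forall>\<eta>>0. \<exists>d>0. \<forall>\<tau>\<in>{0..1}. dist \<tau> x < d \<longrightarrow>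
      \<bar>top_real (E \<tau>) - top_real (E x)\<bar> < \<eta> \<and> has_gap g (E \<tau>)" if x: "x \<in> {0..1}" for x
  proof -
    obtain g where g: "g > 0" "has_gap g (E x)" by (rule has_gap_exists[OF fin[OF x] E(3)[OF x]]) (rule that)
    have "\<exists>d>0. \<forall>\<tau>\<in>{0..1}. dist \<tau> x < d \<longrightarrow> \<bar>top_real (E \<tau>) - top_real (E x)\<bar> < \<eta> \<and> has_gap (g/2) (E \<tau>)"
      if \<eta>: "\<eta> > 0" for \<eta>
    proof -
      \<comment> \<open>At most half the smallest distance between distinct points of
        \<open>E x\<close>; the 1 covers the case of a single point.\<close>
      define m where "m = Min (insert 1 ((\<lambda>(y,z). dist y z / 2) ` {(y,z). y \<in> E x \<and> z \<in> E x \<and> y \<noteq> z}))"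
      have "{(y,z). y \<in> E x \<and> z \<in> E x \<and> y \<noteq> z} \<subseteq> E x \<times> E x" by auto
      then have fm: "finite (insert 1 ((\<lambda>(y,z). dist y z / 2) ` {(y,z). y \<in> E x \<and> z \<in> E x \<and> y \<noteq> z}))"
        using fin(1)[OF x] finite_subset by fastforce
      have m0: "m > 0" unfolding m_def using fm by (subst Min_gr_iff) auto
      have msep: "2 * m \<le> dist y z" if "y \<in> E x" "z \<in> E x" "y \<noteq> z" for y z
      proof -
        have "m \<le> dist y z / 2" unfolding m_def using fm that by (intro Min_le) auto
        then show ?thesis by simp
      qed
      define \<epsilon> where "\<epsilon> = min m (min (g/4) \<eta>)"
      have \<epsilon>: "\<epsilon> > 0" "\<epsilon> \<le> g/4" "\<epsilon> \<le> m" "\<epsilon> \<le> \<eta>" using m0 g \<eta> by (auto simp: \<epsilon>_def)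
      have "\<forall>z\<in>E x. \<exists>d. d > 0 \<and> (\<forall>\<tau>\<in>{0..1}. dist \<tau> x < d \<longrightarrow> (\<exists>z'\<in>E \<tau>. dist z z' < \<epsilon>))"
        using lsc[OF x _ \<epsilon>(1)] by blast
      from bchoice[OF this] obtain d where d: "\<And>z. z \<in> E x \<Longrightarrow> d z > 0"
        "\<And>z \<tau>. z \<in> E x \<Longrightarrow> \<tau> \<in> {0..1} \<Longrightarrow> dist \<tau> x < d z \<Longrightarrow> \<exists>z'\<in>E \<tau>. dist z z' < \<epsilon>" by blast
      define d0 where "d0 = Min (d ` E x)"
      have d0: "d0 > 0" "\<And>z. z \<in> E x \<Longrightarrow> d0 \<le> d z"
        unfolding d0_def using fin[OF x] d(1) by (auto simp: Min_gr_iff)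
      have "\<bar>top_real (E \<tau>) - top_real (E x)\<bar> < \<eta> \<and> has_gap (g/2) (E \<tau>)"
        if \<tau>: "\<tau> \<in> {0..1}" "dist \<tau> x < d0" for \<tau>
      proof -
        have "card (E \<tau>) = card (E x)" using E(1) x \<tau>(1) by simp
        moreover have "2 * \<epsilon> \<le> dist y z" if "y \<in> E x" "z \<in> E x" "y \<noteq> z" for y z
          using msep[OF that] \<epsilon>(3) by simp
        moreover have "\<exists>z'\<in>E \<tau>. dist z z' < \<epsilon>" if "z \<in> E x" for z
          using d(2)[OF that \<tau>(1)] d0(2)[OF that] \<tau>(2) by simp
        ultimately have "\<bar>top_real (E \<tau>) - top_real (E x)\<bar> < \<epsilon>" "has_gap (g/2) (E \<tau>)"
          using spectrum_perturbation[OF fin(1)[OF x] g(2) fin(1)[OF \<tau>(1)] _ \<epsilon>(1,2)] by blast+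
        with \<epsilon>(4) show ?thesis by simp
      qed
      with d0(1) show ?thesis by blast
    qed
    with g(1) show ?thesis by (intro exI[of _ "g/2"]) simp
  qed
  show "continuous_on {0..1} (\<lambda>\<tau>. top_real (E \<tau>))"
    unfolding continuous_on_iff
  proof (intro ballI allI impI)
    fix x \<eta> :: real assume x: "x \<in> {0..1}" and \<eta>: "0 < \<eta>"
    obtain d where "d > 0" "\<And>\<tau>. \<tau> \<in> {0..1} \<Longrightarrow> dist \<tau> x < d \<Longrightarrow> \<bar>top_real (E \<tau>) - top_real (E x)\<bar> < \<eta>"
      using loc[OF x] \<eta> by metis
    then show "\<exists>d>0. \<forall>\<tau>\<in>{0..1}. dist \<tau> x < d \<longrightarrow> dist (top_real (E \<tau>)) (top_real (E x)) < \<eta>"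
      unfolding dist_real_def[of "top_real _"] by blast
  qed
  define P where "P a b \<longleftrightarrow> (\<exists>g>0. \<forall>\<tau>\<in>{a..b} \<inter> {0..1}. has_gap g (E \<tau>))" for a b :: real
  have "P 0 1"
  proof (rule Bolzano)
    fix a b c assume ab: "P a b" and bc: "P b c" and "a \<le> b" "b \<le> c"
    obtain g where g: "g > 0" "\<And>\<tau>. \<tau> \<in> {a..b} \<inter> {0..1} \<Longrightarrow> has_gap g (E \<tau>)"
      using ab unfolding P_def by metis
    obtain g' where g': "g' > 0" "\<And>\<tau>. \<tau> \<in> {b..c} \<inter> {0..1} \<Longrightarrow> has_gap g' (E \<tau>)"
      using bc unfolding P_def by metis
    have "has_gap (min g g') (E \<tau>)" if "\<tau> \<in> {a..c} \<inter> {0..1}" for \<tau>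
    proof (cases "\<tau> \<le> b")
      case True
      then show ?thesis using that by (intro has_gap_mono[OF g(2)]) auto
    next
      case False
      then show ?thesis using that by (intro has_gap_mono[OF g'(2)]) auto
    qed
    moreover have "min g g' > 0" using g g' by simp
    ultimately show "P a c" unfolding P_def by blast
  next
    fix x :: real assume "0 \<le> x" "x \<le> 1"
    then have x: "x \<in> {0..1}" by simp
    obtain g d where gd: "g > 0" "d > 0" "\<And>\<tau>. \<tau> \<in> {0..1} \<Longrightarrow> dist \<tau> x < d \<Longrightarrow> has_gap g (E \<tau>)"
    proof -
      obtain g where g: "g > 0" and *: "\<forall>\<eta>>0. \<exists>d>0. \<forall>\<tau>\<in>{0..1}. dist \<tau> x < d \<longrightarrow>
          \<bar>top_real (E \<tau>) - top_real (E x)\<bar> < \<eta> \<and> has_gap g (E \<tau>)"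
        using loc[OF x] by metis
      obtain d where "d > 0" "\<forall>\<tau>\<in>{0..1}. dist \<tau> x < d \<longrightarrow> \<bar>top_real (E \<tau>) - top_real (E x)\<bar> < 1 \<and> has_gap g (E \<tau>)"
        using *[rule_format, OF zero_less_one] by metis
      with g that show ?thesis by metis
    qed
    have "P a b" if "a \<le> x \<and> x \<le> b \<and> b - a < d" for a b
      unfolding P_def
    proof (intro exI[of _ g] conjI ballI gd)
      fix \<tau> assume "\<tau> \<in> {a..b} \<inter> {0..1}"
      then show "\<tau> \<in> {0..1}" "dist \<tau> x < d" using that by (auto simp: dist_real_def)
    qed
    with gd(2) show "\<exists>d>0. \<forall>a b. a \<le> x \<and> x \<le> b \<and> b - a < d \<longrightarrow> P a b" by blast
  qed simp
  then show "\<exists>g>0. \<forall>\<tau>\<in>{0..1}. has_gap g (E \<tau>)" unfolding P_def by (simp add: Int_absorb)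
qed

section \<open>Diagonal quadratic forms\<close>

text \<open>The real part of a Hermitian form that is diagonal, with entries \<sigma>, in the
  coordinates given by \<open>R\<close>; on complex numbers \<open>\<bullet>\<close> is the real
  inner product.\<close>

definition diag_form :: "complex ^ 'r ^ 'r \<Rightarrow> ('r::finite \<Rightarrow> real) \<Rightarrow> complex ^ 'r \<Rightarrow> complex ^ 'r \<Rightarrow> real" where
  "diag_form R \<sigma> v w = (\<Sum>i\<in>UNIV. \<sigma> i * ((R *v v) $ i \<bullet> (R *v w) $ i))"

lemma diag_form_diff_right: "diag_form R \<sigma> v (w - w') = diag_form R \<sigma> v w - diag_form R \<sigma> v w'"
  by (simp add: diag_form_def matrix_vector_mult_diff_distrib inner_diff_right right_diff_distrib sum_subtractf)

lemma diag_form_scaleR_right: "diag_form R \<sigma> v (t *\<^sub>R w) = t * diag_form R \<sigma> v w"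
proof -
  have "R *v (t *\<^sub>R w) = t *\<^sub>R (R *v w)"
    by (simp add: vec_eq_iff matrix_vector_mult_component scaleR_sum_right)
  then show ?thesis by (simp add: diag_form_def sum_distrib_left mult.left_commute)
qed

lemma diag_form_bound: "\<exists>C\<ge>0. \<forall>v w. \<bar>diag_form R \<sigma> v w\<bar> \<le> C * norm v * norm w"
proof (intro exI conjI allI)
  let ?C = "(\<Sum>i\<in>UNIV. \<bar>\<sigma> i\<bar>) * (entry_sum R * entry_sum R)"
  show "?C \<ge> 0" by (simp add: sum_nonneg entry_sum_nonneg)
  fix v w
  have n: "norm ((R *v x) $ i) \<le> entry_sum R * norm x" for x i
    using norm_matrix_vector_component[of x "norm x" R i] Finite_Cartesian_Product.norm_nth_le[of x] by blast
  have "\<bar>diag_form R \<sigma> v w\<bar> \<le> (\<Sum>i\<in>UNIV. \<bar>\<sigma> i\<bar> * ((entry_sum R * norm v) * (entry_sum R * norm w)))"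
    unfolding diag_form_def
  proof (intro order_trans[OF sum_abs] sum_mono)
    fix i
    have "\<bar>(R *v v) $ i \<bullet> (R *v w) $ i\<bar> \<le> norm ((R *v v) $ i) * norm ((R *v w) $ i)"
      by (rule Cauchy_Schwarz_ineq2)
    also have "\<dots> \<le> (entry_sum R * norm v) * (entry_sum R * norm w)"
      by (intro mult_mono n) (simp_all add: entry_sum_nonneg)
    finally show "\<bar>\<sigma> i * ((R *v v) $ i \<bullet> (R *v w) $ i)\<bar> \<le> \<bar>\<sigma> i\<bar> * ((entry_sum R * norm v) * (entry_sum R * norm w))"
      by (simp add: abs_mult mult_left_mono)
  qed
  also have "\<dots> = ?C * norm v * norm w"
    unfolding sum_distrib_right[symmetric] by (simp only: mult.assoc mult.left_commute)
  finally show "\<bar>diag_form R \<sigma> v w\<bar> \<le> ?C * norm v * norm w" .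
qed

lemma diag_form_self: "diag_form R \<sigma> v v = (\<Sum>i\<in>UNIV. \<sigma> i * (norm ((R *v v) $ i))\<^sup>2)"
  by (simp add: diag_form_def dot_square_norm)

lemma diag_form_derivative:
  assumes "(v has_vector_derivative v') (at \<tau> within X)"
  shows "((\<lambda>\<tau>. diag_form R \<sigma> (v \<tau>) (v \<tau>)) has_real_derivative 2 * diag_form R \<sigma> (v \<tau>) v') (at \<tau> within X)"
proof -
  have "((\<lambda>\<tau>. (R *v v \<tau>) $ i) has_vector_derivative (R *v v') $ i) (at \<tau> within X)" for i
  proof -
    have "bounded_linear (\<lambda>x. (R *v x) $ i)"
      unfolding linear_linear
      by (rule linearI) (simp_all add: matrix_vector_right_distrib matrix_vector_mult_component scaleR_sum_right)
    from bounded_linear.has_vector_derivative[OF this assms] show ?thesis .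
  qed
  note d = this[unfolded has_vector_derivative_def]
  have "((\<lambda>\<tau>. (R *v v \<tau>) $ i \<bullet> (R *v v \<tau>) $ i) has_real_derivative 2 * ((R *v v \<tau>) $ i \<bullet> (R *v v') $ i)) (at \<tau> within X)" for i
    unfolding has_real_derivative_iff_has_vector_derivative has_vector_derivative_def
    by (rule has_derivative_eq_rhs[OF has_derivative_inner[OF d d]]) (auto simp: inner_commute algebra_simps)
  then have "((\<lambda>\<tau>. diag_form R \<sigma> (v \<tau>) (v \<tau>)) has_real_derivative
      (\<Sum>i\<in>UNIV. \<sigma> i * (2 * ((R *v v \<tau>) $ i \<bullet> (R *v v') $ i)))) (at \<tau> within X)"
    unfolding diag_form_def by (intro DERIV_sum DERIV_cmult)
  then show ?thesis by (simp add: diag_form_def sum_distrib_left mult.left_commute)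
qed

text \<open>In eigencoordinates \<open>y\<close> the left side is the sum of
  \<open>\<sigma> i * (Re (l i) - c) * (norm (y $ i))\<^sup>2\<close>, as imaginary parts of
  eigenvalues only rotate. Thus the signs \<sigma> must match the position of each real part
  relative to \<open>c\<close>.\<close>

lemma diag_form_eigenbasis:
  assumes e: "eigenbasis M l R S" and \<sigma>: "\<And>i. \<sigma> i * (Re (l i) - c) \<ge> k" "k > 0"
  shows "\<exists>\<kappa>>0. \<forall>v. diag_form R \<sigma> v (M *v v) - c * diag_form R \<sigma> v v \<ge> \<kappa> * (norm v)\<^sup>2"
proof -
  let ?m = "entry_sum S"
  have SR: "S ** R = mat 1" and R: "\<And>v i. (R *v (M *v v)) $ i = l i * (R *v v) $ i"
    using e by (auto simp: eigenbasis_def)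
  have nv: "norm v \<le> ?m * norm (R *v v)" for v
    using norm_matrix_vector_le[of S "R *v v"] by (simp add: matrix_vector_mul_assoc SR)
  \<comment> \<open>Adding 1 makes the divisor positive without a lower bound for
    \<open>?m\<close>.\<close>
  define K where "K = ?m\<^sup>2 + 1"
  have K: "K > 0" by (simp add: K_def add_nonneg_pos)
  have "k / K * (norm v)\<^sup>2 \<le> diag_form R \<sigma> v (M *v v) - c * diag_form R \<sigma> v v" for v
  proof -
    have "(norm v)\<^sup>2 \<le> (?m * norm (R *v v))\<^sup>2" using nv by (intro power_mono) auto
    also have "\<dots> \<le> K * (norm (R *v v))\<^sup>2" by (simp add: K_def power_mult_distrib mult_right_mono)
    finally have "k / K * (norm v)\<^sup>2 \<le> k / K * (K * (norm (R *v v))\<^sup>2)"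
      using \<sigma>(2) K by (intro mult_left_mono) auto
    also have "\<dots> = (\<Sum>i\<in>UNIV. k * (norm ((R *v v) $ i))\<^sup>2)"
      using K by (simp add: norm_vec_def L2_set_def sum_nonneg sum_distrib_left)
    also have "\<dots> \<le> (\<Sum>i\<in>UNIV. (\<sigma> i * (Re (l i) - c)) * (norm ((R *v v) $ i))\<^sup>2)"
      by (intro sum_mono mult_right_mono \<sigma>) simp
    also have "\<dots> = diag_form R \<sigma> v (M *v v) - c * diag_form R \<sigma> v v"
    proof -
      have y: "y \<bullet> (a * y) = Re a * (norm y)\<^sup>2" for a y :: complex
        unfolding cmod_power2 by (simp add: inner_complex_def algebra_simps power2_eq_square)
      show ?thesis
        unfolding diag_form_self unfolding diag_form_def R y sum_distrib_left sum_subtractf[symmetric]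
        by (rule sum.cong) (simp_all add: algebra_simps)
    qed
    finally show ?thesis .
  qed
  moreover have "k / K > 0" using \<sigma>(2) K by simp
  ultimately show ?thesis by blast
qed

text \<open>The strict inequality at \<open>x\<close> is an open condition. The form stays frozen at
  \<open>x\<close>, and the variation of \<open>M\<close> and \<open>c\<close> consumes at most half
  of \<kappa>, so no continuous choice of eigenvectors is needed.\<close>

lemma diag_form_near:
  fixes M :: "real \<Rightarrow> complex ^ 'r ^ 'r::finite"
  assumes cont: "\<And>i j. continuous_on I (\<lambda>\<tau>. M \<tau> $ i $ j)" and c: "continuous_on I c" and x: "x \<in> I"
    and e: "eigenbasis (M x) l R S" and \<sigma>: "\<And>i. \<sigma> i * (Re (l i) - c x) \<ge> k" "k > 0"
  shows "\<exists>\<kappa>>0. \<exists>d>0. \<forall>\<tau>\<in>I. dist \<tau> x < d \<longrightarrow>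
    (\<forall>v. diag_form R \<sigma> v (M \<tau> *v v) - c \<tau> * diag_form R \<sigma> v v \<ge> \<kappa> * (norm v)\<^sup>2)"
proof -
  obtain \<kappa> where \<kappa>: "\<kappa> > 0" "\<And>v. diag_form R \<sigma> v (M x *v v) - c x * diag_form R \<sigma> v v \<ge> \<kappa> * (norm v)\<^sup>2"
    using diag_form_eigenbasis[OF e \<sigma>] by blast
  obtain C where C: "C \<ge> 0" "\<And>v w. \<bar>diag_form R \<sigma> v w\<bar> \<le> C * norm v * norm w"
    using diag_form_bound by blast
  define f where "f \<tau> = C * (entry_sum (M \<tau> - M x) + \<bar>c \<tau> - c x\<bar>)" for \<tau>
  have "continuous_on I f"
    unfolding f_def
    by ((intro continuous_on_mult continuous_on_add continuous_on_const continuous_on_entry_sum continuous_on_rabs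
        continuous_on_diff c), unfold vector_minus_component, intro continuous_on_diff continuous_on_const cont)
  moreover have "f x \<in> {..<\<kappa> / 2}" using \<kappa>(1) by (simp add: f_def entry_sum_def)
  ultimately obtain N where N: "open N" "x \<in> N" "\<And>\<tau>. \<tau> \<in> N \<Longrightarrow> \<tau> \<in> I \<Longrightarrow> f \<tau> \<in> {..<\<kappa> / 2}"
    using continuous_on_nhd[OF _ open_lessThan x] by metis
  obtain d where d: "d > 0" "\<And>\<tau>. dist \<tau> x < d \<Longrightarrow> \<tau> \<in> N" using N(1,2) unfolding open_dist by blast
  have "diag_form R \<sigma> v (M \<tau> *v v) - c \<tau> * diag_form R \<sigma> v v \<ge> \<kappa> / 2 * (norm v)\<^sup>2"
    if \<tau>: "\<tau> \<in> I" "dist \<tau> x < d" for \<tau> v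
  proof -
    have "\<bar>diag_form R \<sigma> v ((M \<tau> - M x) *v v)\<bar> \<le> C * norm v * norm ((M \<tau> - M x) *v v)" by (rule C(2))
    also have "\<dots> \<le> C * norm v * (entry_sum (M \<tau> - M x) * norm v)"
      using C(1) by (intro mult_left_mono norm_matrix_vector_le) simp
    finally have 1: "\<bar>diag_form R \<sigma> v ((M \<tau> - M x) *v v)\<bar> \<le> C * entry_sum (M \<tau> - M x) * (norm v)\<^sup>2"
      by (simp add: power2_eq_square algebra_simps)
    have "\<bar>(c \<tau> - c x) * diag_form R \<sigma> v v\<bar> \<le> \<bar>c \<tau> - c x\<bar> * (C * norm v * norm v)"
      unfolding abs_mult by (intro mult_left_mono C(2)) simp
    then have 2: "\<bar>(c \<tau> - c x) * diag_form R \<sigma> v v\<bar> \<le> C * \<bar>c \<tau> - c x\<bar> * (norm v)\<^sup>2"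
      by (simp add: power2_eq_square algebra_simps)
    have "f \<tau> * (norm v)\<^sup>2 \<le> \<kappa> / 2 * (norm v)\<^sup>2"
      using N(3)[OF d(2)[OF \<tau>(2)] \<tau>(1)] by (intro mult_right_mono) auto
    then have 3: "C * entry_sum (M \<tau> - M x) * (norm v)\<^sup>2 + C * \<bar>c \<tau> - c x\<bar> * (norm v)\<^sup>2 \<le> \<kappa> / 2 * (norm v)\<^sup>2"
      by (simp add: f_def algebra_simps)
    have "diag_form R \<sigma> v (M \<tau> *v v) - c \<tau> * diag_form R \<sigma> v v
      = (diag_form R \<sigma> v (M x *v v) - c x * diag_form R \<sigma> v v)
        + diag_form R \<sigma> v ((M \<tau> - M x) *v v) - (c \<tau> - c x) * diag_form R \<sigma> v v"
      by (simp add: matrix_vector_mult_diff_rdistrib diag_form_diff_right algebra_simps)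
    with \<kappa>(2)[of v] 1 2 3 show ?thesis by linarith
  qed
  with \<kappa>(1) d(1) show ?thesis by (intro exI[of _ "\<kappa>/2"] conjI exI[of _ d]) auto
qed

section \<open>Gluing of local Lyapunov functions\<close>

text \<open>Squaring the positive part gives a continuous derivative, which lets the error terms in
  the gluing be bounded on the compact interval.\<close>

definition bump :: "real \<Rightarrow> real \<Rightarrow> real \<Rightarrow> real" where
  "bump x r \<tau> = (max 0 (r\<^sup>2 - (\<tau> - x)\<^sup>2))\<^sup>2"

definition bump' :: "real \<Rightarrow> real \<Rightarrow> real \<Rightarrow> real" where
  "bump' x r \<tau> = 2 * max 0 (r\<^sup>2 - (\<tau> - x)\<^sup>2) * (- 2 * (\<tau> - x))"

lemma square_pos_part_derivative: "((\<lambda>u::real. (max 0 u)\<^sup>2) has_real_derivative 2 * max 0 u) (at u)"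
proof -
  consider "u > 0" | "u < 0" | "u = 0" by linarith
  then show ?thesis
  proof cases
    case 1
    have "((\<lambda>u. u\<^sup>2) has_real_derivative 2 * u) (at u)" by (auto intro!: derivative_eq_intros)
    then have "((\<lambda>u. (max 0 u)\<^sup>2) has_real_derivative 2 * u) (at u)"
      by (rule has_field_derivative_transform_within[of _ _ _ _ u]) (use 1 in \<open>auto simp: dist_real_def\<close>)
    then show ?thesis using 1 by simp
  next
    case 2
    have "((\<lambda>u. 0) has_real_derivative 0) (at u)" by simp
    then have "((\<lambda>u::real. (max 0 u)\<^sup>2) has_real_derivative 0) (at u)"
      by (rule has_field_derivative_transform_within[of _ _ _ _ "-u"]) (use 2 in \<open>auto simp: dist_real_def\<close>)
    then show ?thesis using 2 by simp
  next
    case 3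
    have "((\<lambda>h::real. (max 0 h)\<^sup>2 / h) \<longlongrightarrow> 0) (at 0)"
    proof (rule Lim_null_comparison[where g = "\<lambda>h. \<bar>h\<bar>"])
      show "\<forall>\<^sub>F h in at (0::real). norm ((max 0 h)\<^sup>2 / h) \<le> \<bar>h\<bar>"
        by (rule always_eventually) (auto simp: max_def power2_eq_square)
    qed (auto intro!: tendsto_eq_intros)
    then show ?thesis using 3 by (simp add: DERIV_def)
  qed
qed

lemma bump_derivative: "(bump x r has_real_derivative bump' x r \<tau>) (at \<tau> within S)"
proof -
  have "((\<lambda>\<tau>. r\<^sup>2 - (\<tau> - x)\<^sup>2) has_real_derivative - 2 * (\<tau> - x)) (at \<tau>)"
    by (auto intro!: derivative_eq_intros)
  from DERIV_chain2[OF square_pos_part_derivative this] show ?thesis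
    unfolding bump_def[abs_def] bump'_def by (rule has_field_derivative_at_within)
qed

lemma bump_nonneg: "bump x r \<tau> \<ge> 0"
  by (simp add: bump_def)

lemma bump_pos:
  assumes "\<bar>\<tau> - x\<bar> < r" shows "bump x r \<tau> > 0"
proof -
  have "(\<tau> - x)\<^sup>2 < r\<^sup>2" using assms by (simp add: abs_square_less_1 power2_strict_mono flip: abs_le_square_iff)
  then show ?thesis by (simp add: bump_def)
qed

lemma bump_zero:
  assumes "\<bar>\<tau> - x\<bar> \<ge> r" "r \<ge> 0" shows "bump x r \<tau> = 0" "bump' x r \<tau> = 0"
proof -
  have "r\<^sup>2 \<le> (\<tau> - x)\<^sup>2" using assms by (metis abs_le_square_iff abs_of_nonneg)
  then show "bump x r \<tau> = 0" "bump' x r \<tau> = 0" by (simp_all add: bump_def bump'_def)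
qed

lemma continuous_on_bump: "continuous_on S (bump x r)" "continuous_on S (bump' x r)"
  unfolding bump_def[abs_def] bump'_def[abs_def] by (intro continuous_intros)+

text \<open>The bump attached to a point other than \<open>0\<close> and \<open>1\<close> vanishes at both end points, so that the
  glued function is there a multiple of the local ones.\<close>

lemma lyapunov_gluing:
  fixes sol :: "real \<Rightarrow> (real \<Rightarrow> 'e) \<Rightarrow> bool" and n :: "'e \<Rightarrow> real" and \<psi> :: "real \<Rightarrow> 'e \<Rightarrow> real"
  assumes c: "continuous_on {0..1} c"
    and n: "\<And>t s \<tau>. sol t s \<Longrightarrow> \<tau> \<in> {0..1} \<Longrightarrow> n (s \<tau>) \<ge> 0"
    and loc: "\<And>x. x \<in> {0..1} \<Longrightarrow> \<exists>r>0. \<exists>\<kappa>>0. \<exists>C. \<forall>t>0. \<forall>s. sol t s \<longrightarrow> (\<forall>\<tau>\<in>{0..1}. \<bar>\<tau> - x\<bar> < r \<longrightarrow>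
       \<bar>\<psi> x (s \<tau>)\<bar> \<le> C * n (s \<tau>) \<and>
       (\<exists>D. ((\<lambda>\<tau>. \<psi> x (s \<tau>)) has_real_derivative D) (at \<tau> within {0..1}) \<and>
            D \<ge> 2 * t * c \<tau> * \<psi> x (s \<tau>) + (t * \<kappa> - C) * n (s \<tau>)))"
  shows "\<exists>a>0. \<exists>b>0. \<exists>T. \<forall>t\<ge>T. \<forall>s. sol t s \<longrightarrow>
    exp (2 * t * integral {0..1} c) * (a * \<psi> 0 (s 0)) \<le> b * \<psi> 1 (s 1)"
proof -
  obtain r \<kappa> C where r0: "\<And>x. x \<in> {0..1} \<Longrightarrow> r x > (0::real)" and \<kappa>: "\<And>x. x \<in> {0..1} \<Longrightarrow> \<kappa> x > (0::real)"
    and loc': "\<And>x t s \<tau>. x \<in> {0..1} \<Longrightarrow> t > 0 \<Longrightarrow> sol t s \<Longrightarrow> \<tau> \<in> {0..1} \<Longrightarrow> \<bar>\<tau> - x\<bar> < r x \<Longrightarrow>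
       \<bar>\<psi> x (s \<tau>)\<bar> \<le> C x * n (s \<tau>) \<and>
       (\<exists>D. ((\<lambda>\<tau>. \<psi> x (s \<tau>)) has_real_derivative D) (at \<tau> within {0..1}) \<and>
            D \<ge> 2 * t * c \<tau> * \<psi> x (s \<tau>) + (t * \<kappa> x - C x) * n (s \<tau>))"
    using loc by metis
  \<comment> \<open>Half of \<open>r x\<close> leaves a margin between the support of the bump and
    the end of the domain where \<open>\<psi> x\<close> is controlled. The remaining bounds make
    each bump vanish at the end points other than its own centre.\<close>
  define \<rho> where "\<rho> x = (if x = 0 \<or> x = 1 then min (r x / 2) 1 else min (r x / 2) (min x (1 - x)))" for x
  have \<rho>: "\<rho> x > 0" "\<rho> x < r x" if "x \<in> {0..1}" for x
    using r0[OF that] that by (auto simp: \<rho>_def)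
  have \<rho>0: "\<bar>0 - x\<bar> \<ge> \<rho> x" if "x \<in> {0..1}" "x \<noteq> 0" for x using that by (auto simp: \<rho>_def)
  have \<rho>1: "\<bar>1 - x\<bar> \<ge> \<rho> x" if "x \<in> {0..1}" "x \<noteq> 1" for x using that by (auto simp: \<rho>_def)
  have cover: "{0..1} \<subseteq> (\<Union>x\<in>{0..1}. ball x (\<rho> x))" using \<rho>(1) by fastforce
  obtain F where F: "F \<subseteq> {0..1}" "finite F" "{0..1} \<subseteq> (\<Union>x\<in>F. ball x (\<rho> x))"
    by (rule compactE_image[OF compact_Icc _ cover]) (auto intro: that)
  let ?b = "\<lambda>x. bump x (\<rho> x)" and ?b' = "\<lambda>x. bump' x (\<rho> x)"
  \<comment> \<open>\<open>M\<close> collects the gains, which get multiplied by \<open>t\<close>;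
    \<open>B\<close> collects the losses, from the local constants and from differentiating the
    bumps.\<close>
  define M where "M \<tau> = (\<Sum>x\<in>F. ?b x \<tau> * \<kappa> x)" for \<tau>
  define B where "B \<tau> = (\<Sum>x\<in>F. (\<bar>?b' x \<tau>\<bar> + ?b x \<tau>) * \<bar>C x\<bar>)" for \<tau>
  have "continuous_on {0..1} M" "continuous_on {0..1} B"
    unfolding M_def B_def by (intro continuous_intros continuous_on_bump)+
  note cont = this
  have ne: "{0..1::real} \<noteq> {}" by simp
  obtain \<tau>m where \<tau>m: "\<tau>m \<in> {0..1}" "\<And>\<tau>. \<tau> \<in> {0..1} \<Longrightarrow> M \<tau>m \<le> M \<tau>"
    using continuous_attains_inf[OF compact_Icc ne cont(1)] by blast
  obtain \<tau>b where \<tau>b: "\<And>\<tau>. \<tau> \<in> {0..1} \<Longrightarrow> B \<tau> \<le> B \<tau>b"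
    using continuous_attains_sup[OF compact_Icc ne cont(2)] by blast
  have M0: "M \<tau>m > 0"
  proof -
    obtain x where x: "x \<in> F" "\<bar>\<tau>m - x\<bar> < \<rho> x"
      using F(3) \<tau>m(1) by (auto simp: dist_real_def abs_minus_commute)
    show ?thesis unfolding M_def
    proof (rule sum_pos2[OF F(2) x(1)])
      show "0 < ?b x \<tau>m * \<kappa> x" using bump_pos[OF x(2)] \<kappa> F(1) x(1) by (auto intro!: mult_pos_pos)
      show "0 \<le> ?b i \<tau>m * \<kappa> i" if "i \<in> F" for i
        by (rule mult_nonneg_nonneg[OF bump_nonneg less_imp_le[OF \<kappa>]]) (use that F(1) in blast)
    qed
  qed
  \<comment> \<open>Beyond \<open>T\<close> the smallest gain, times \<open>t\<close>, outweighs the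
    largest loss; the 1 ensures \<open>t > 0\<close>.\<close>
  define T where "T = max 1 (B \<tau>b / M \<tau>m)"
  define I where "I \<tau> = integral {0..\<tau>} c" for \<tau>
  have I: "(I has_real_derivative c \<tau>) (at \<tau> within {0..1})" if "\<tau> \<in> {0..1}" for \<tau>
    unfolding I_def by (rule integral_has_real_derivative[OF c that])
  have main: "exp (2 * t * integral {0..1} c) * (?b 0 0 * \<psi> 0 (s 0)) \<le> ?b 1 1 * \<psi> 1 (s 1)"
    if t: "t \<ge> T" and s: "sol t s" for t s
  proof -
    have t0: "t > 0" using t by (simp add: T_def)
    define q where "q \<tau> = (\<Sum>x\<in>F. ?b x \<tau> * \<psi> x (s \<tau>))" for \<tau>
    have "\<exists>D. (q has_real_derivative D) (at \<tau> within {0..1}) \<and> D \<ge> 2 * t * c \<tau> * q \<tau>" if \<tau>: "\<tau> \<in> {0..1}" for \<tau>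
    proof -
      have "\<exists>D. ((\<lambda>\<tau>. ?b x \<tau> * \<psi> x (s \<tau>)) has_real_derivative D) (at \<tau> within {0..1}) \<and>
          D \<ge> 2 * t * c \<tau> * (?b x \<tau> * \<psi> x (s \<tau>)) +
            (t * (?b x \<tau> * \<kappa> x) - (\<bar>?b' x \<tau>\<bar> + ?b x \<tau>) * \<bar>C x\<bar>) * n (s \<tau>)"
        if "x \<in> F" for x
      proof (cases "\<bar>\<tau> - x\<bar> < r x")
        case True
        have x: "x \<in> {0..1}" using that F(1) by blast
        obtain D where D: "((\<lambda>\<tau>. \<psi> x (s \<tau>)) has_real_derivative D) (at \<tau> within {0..1})"
            "D \<ge> 2 * t * c \<tau> * \<psi> x (s \<tau>) + (t * \<kappa> x - C x) * n (s \<tau>)" "\<bar>\<psi> x (s \<tau>)\<bar> \<le> C x * n (s \<tau>)"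
          using loc'[OF x t0 s \<tau> True] by blast
        have n0: "n (s \<tau>) \<ge> 0" by (rule n[OF s \<tau>])
        have "- (?b' x \<tau> * \<psi> x (s \<tau>)) \<le> \<bar>?b' x \<tau>\<bar> * \<bar>\<psi> x (s \<tau>)\<bar>"
          by (metis abs_ge_minus_self abs_mult)
        also have "\<dots> \<le> \<bar>?b' x \<tau>\<bar> * (\<bar>C x\<bar> * n (s \<tau>))"
          by (intro mult_left_mono order_trans[OF D(3)] mult_right_mono n0) auto
        finally have 1: "?b' x \<tau> * \<psi> x (s \<tau>) \<ge> - (\<bar>?b' x \<tau>\<bar> * (\<bar>C x\<bar> * n (s \<tau>)))" by linarith
        have "(t * \<kappa> x - \<bar>C x\<bar>) * n (s \<tau>) \<le> (t * \<kappa> x - C x) * n (s \<tau>)"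
          using n0 by (intro mult_right_mono) auto
        then have "2 * t * c \<tau> * \<psi> x (s \<tau>) + (t * \<kappa> x - \<bar>C x\<bar>) * n (s \<tau>) \<le> D" using D(2) by linarith
        then have 2: "?b x \<tau> * (2 * t * c \<tau> * \<psi> x (s \<tau>) + (t * \<kappa> x - \<bar>C x\<bar>) * n (s \<tau>)) \<le> ?b x \<tau> * D"
          using bump_nonneg by (intro mult_left_mono)
        show ?thesis
        proof (intro exI conjI)
          show "((\<lambda>\<tau>. ?b x \<tau> * \<psi> x (s \<tau>)) has_real_derivative (?b' x \<tau> * \<psi> x (s \<tau>) + D * ?b x \<tau>))
              (at \<tau> within {0..1})"
            by (rule DERIV_mult[OF bump_derivative D(1)])
          show "2 * t * c \<tau> * (?b x \<tau> * \<psi> x (s \<tau>)) +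
            (t * (?b x \<tau> * \<kappa> x) - (\<bar>?b' x \<tau>\<bar> + ?b x \<tau>) * \<bar>C x\<bar>) * n (s \<tau>)
            \<le> ?b' x \<tau> * \<psi> x (s \<tau>) + D * ?b x \<tau>"
            using 1 2 by (simp add: algebra_simps)
        qed
      next
        \<comment> \<open>Nothing is known about \<open>\<psi> x\<close> here, not even
          differentiability, but the bump vanishes on a whole neighbourhood of \<tau>.\<close>
        case False
        have x: "x \<in> {0..1}" using that F(1) by blast
        have z: "?b x \<tau> = 0" "?b' x \<tau> = 0" using bump_zero[of "\<rho> x" \<tau> x] False \<rho>[OF x] by auto
        have "((\<lambda>\<tau>. ?b x \<tau> * \<psi> x (s \<tau>)) has_real_derivative 0) (at \<tau> within {0..1})"
        proof (rule has_field_derivative_transform_within)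
          show "((\<lambda>\<tau>. 0) has_real_derivative 0) (at \<tau> within {0..1})" by simp
          show "0 < r x - \<rho> x" using \<rho>(2)[OF x] by simp
          fix y assume "dist y \<tau> < r x - \<rho> x"
          then have "\<bar>y - x\<bar> \<ge> \<rho> x" using False by (auto simp: dist_real_def)
          then show "0 = ?b x y * \<psi> x (s y)" using bump_zero(1) \<rho>(1)[OF x] by simp
        qed (rule \<tau>)
        then show ?thesis using z by (intro exI[of _ 0]) simp
      qed
      then have "\<forall>x\<in>F. \<exists>D. ((\<lambda>\<tau>. ?b x \<tau> * \<psi> x (s \<tau>)) has_real_derivative D) (at \<tau> within {0..1}) \<and>
          D \<ge> 2 * t * c \<tau> * (?b x \<tau> * \<psi> x (s \<tau>)) +
            (t * (?b x \<tau> * \<kappa> x) - (\<bar>?b' x \<tau>\<bar> + ?b x \<tau>) * \<bar>C x\<bar>) * n (s \<tau>)" by (rule ballI)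
      from bchoice[OF this] obtain D
        where D: "\<And>x. x \<in> F \<Longrightarrow> ((\<lambda>\<tau>. ?b x \<tau> * \<psi> x (s \<tau>)) has_real_derivative D x) (at \<tau> within {0..1})"
        "\<And>x. x \<in> F \<Longrightarrow> D x \<ge> 2 * t * c \<tau> * (?b x \<tau> * \<psi> x (s \<tau>)) +
            (t * (?b x \<tau> * \<kappa> x) - (\<bar>?b' x \<tau>\<bar> + ?b x \<tau>) * \<bar>C x\<bar>) * n (s \<tau>)"
        by blast
      have "(q has_real_derivative (\<Sum>x\<in>F. D x)) (at \<tau> within {0..1})"
        unfolding q_def by (rule DERIV_sum) (rule D(1))
      moreover have "2 * t * c \<tau> * q \<tau> \<le> (\<Sum>x\<in>F. D x)"
      proof -
        have "B \<tau> \<le> B \<tau>b" by (rule \<tau>b[OF \<tau>])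
        also have "\<dots> \<le> t * M \<tau>m" using t M0 by (simp add: T_def pos_divide_le_eq)
        also have "\<dots> \<le> t * M \<tau>" using t0 \<tau>m(2)[OF \<tau>] by simp
        finally have "0 \<le> (t * M \<tau> - B \<tau>) * n (s \<tau>)" using n[OF s \<tau>] by simp
        then have "2 * t * c \<tau> * q \<tau> \<le> 2 * t * c \<tau> * q \<tau> + (t * M \<tau> - B \<tau>) * n (s \<tau>)" by simp
        also have "\<dots> = (\<Sum>x\<in>F. 2 * t * c \<tau> * (?b x \<tau> * \<psi> x (s \<tau>)) +
            (t * (?b x \<tau> * \<kappa> x) - (\<bar>?b' x \<tau>\<bar> + ?b x \<tau>) * \<bar>C x\<bar>) * n (s \<tau>))"
          unfolding sum.distrib sum_distrib_left[symmetric] sum_distrib_right[symmetric] sum_subtractf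
            q_def M_def B_def ..
        also have "\<dots> \<le> (\<Sum>x\<in>F. D x)" by (rule sum_mono) (rule D(2))
        finally show ?thesis .
      qed
      ultimately show ?thesis by blast
    qed
    then obtain q' where q': "\<And>\<tau>. \<tau> \<in> {0..1} \<Longrightarrow> (q has_real_derivative q' \<tau>) (at \<tau> within {0..1})"
      "\<And>\<tau>. \<tau> \<in> {0..1} \<Longrightarrow> q' \<tau> \<ge> 2 * t * c \<tau> * q \<tau>"
      by metis
    have "q 0 * exp (- 2 * t * I 0) \<le> q 1 * exp (- 2 * t * I 1)"
    proof (rule mono_of_derivative_nonneg[where a = 0 and b = 1 and g = "\<lambda>\<tau>. q \<tau> * exp (- 2 * t * I \<tau>)"])
      fix \<tau> :: real assume \<tau>: "\<tau> \<in> {0..1}"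
      show "((\<lambda>\<tau>. q \<tau> * exp (- 2 * t * I \<tau>)) has_real_derivative
          (q' \<tau> - 2 * t * c \<tau> * q \<tau>) * exp (- 2 * t * I \<tau>)) (at \<tau> within {0..1})"
        by (rule derivative_eq_intros q'(1)[OF \<tau>] I[OF \<tau>] refl)+ (simp add: algebra_simps)
      show "(q' \<tau> - 2 * t * c \<tau> * q \<tau>) * exp (- 2 * t * I \<tau>) \<ge> 0" using q'(2)[OF \<tau>] by simp
    qed auto
    moreover have "I 0 = 0" by (simp add: I_def)
    ultimately have "q 0 \<le> q 1 * exp (- 2 * t * I 1)" by simp
    then have "exp (2 * t * I 1) * q 0 \<le> exp (2 * t * I 1) * (q 1 * exp (- 2 * t * I 1))"
      by (intro mult_left_mono) auto
    also have "\<dots> = q 1" by (simp add: exp_minus field_simps)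
    finally have "exp (2 * t * I 1) * q 0 \<le> q 1" .
    moreover have "q 0 = ?b 0 0 * \<psi> 0 (s 0)"
    proof -
      \<comment> \<open>No ball around another centre reaches 0, so the finite subcover has to
        contain the one centred there.\<close>
      have "0 \<in> F"
      proof -
        have "0 \<in> {0..1::real}" by simp
        then obtain x where x: "x \<in> F" "dist x 0 < \<rho> x" using F(3) by (meson UN_E mem_ball subsetD)
        moreover have "x \<in> {0..1}" using x(1) F(1) by blast
        ultimately have "x = 0" using \<rho>0[of x] by (auto simp: dist_real_def)
        with x(1) show ?thesis by simp
      qed
      moreover have "?b x 0 = 0" if "x \<in> F" "x \<noteq> 0" for x
      proof -
        have x: "x \<in> {0..1}" using that F(1) by blast
        show ?thesis by (rule bump_zero(1)[OF \<rho>0[OF x that(2)] less_imp_le[OF \<rho>(1)[OF x]]])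
      qed
      ultimately show ?thesis unfolding q_def using F(2) by (subst sum.remove[of F 0]) auto
    qed
    moreover have "q 1 = ?b 1 1 * \<psi> 1 (s 1)"
    proof -
      have "1 \<in> F"
      proof -
        have "1 \<in> {0..1::real}" by simp
        then obtain x where x: "x \<in> F" "dist x 1 < \<rho> x" using F(3) by (meson UN_E mem_ball subsetD)
        moreover have "x \<in> {0..1}" using x(1) F(1) by blast
        ultimately have "x = 1" using \<rho>1[of x] by (auto simp: dist_real_def)
        with x(1) show ?thesis by simp
      qed
      moreover have "?b x 1 = 0" if "x \<in> F" "x \<noteq> 1" for x
      proof -
        have x: "x \<in> {0..1}" using that F(1) by blast
        show ?thesis by (rule bump_zero(1)[OF \<rho>1[OF x that(2)] less_imp_le[OF \<rho>(1)[OF x]]])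
      qed
      ultimately show ?thesis unfolding q_def using F(2) by (subst sum.remove[of F 1]) auto
    qed
    ultimately show ?thesis by (simp add: I_def)
  qed
  have "?b 0 0 > 0" "?b 1 1 > 0" using \<rho>(1)[of 0] \<rho>(1)[of 1] by (auto intro!: bump_pos)
  with main show ?thesis by blast
qed

section \<open>Growth along a noncritical path\<close>

text \<open>The constants may depend on \<delta>, since dividing the logarithm by \<open>t\<close>
  removes them. Only \<delta> up to \<open>\<delta>0\<close> are asked for, because the lower growth
  bound is available up to half of the spectral gap.\<close>

lemma log_growth_limit:
  fixes \<delta>0 L :: real and F :: "real \<Rightarrow> real"
  assumes "\<delta>0 > 0"
    and bounds: "\<And>\<delta>. 0 < \<delta> \<Longrightarrow> \<delta> \<le> \<delta>0 \<Longrightarrow> \<exists>K1>0. \<exists>K2>0. \<exists>T. \<forall>t\<ge>T.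
      K1 * exp (t * (L - \<delta>)) \<le> F t \<and> F t \<le> K2 * exp (t * (L + \<delta>))"
  shows "((\<lambda>t. 1 / t * ln (F t)) \<longlongrightarrow> L) at_top"
proof (rule tendstoI)
  fix \<epsilon> :: real assume \<epsilon>: "\<epsilon> > 0"
  define \<delta> where "\<delta> = min \<delta>0 (\<epsilon> / 2)"
  have \<delta>: "0 < \<delta>" "\<delta> \<le> \<delta>0" "\<delta> \<le> \<epsilon> / 2" using assms(1) \<epsilon> by (auto simp: \<delta>_def)
  obtain K1 K2 T where K: "K1 > 0" "K2 > 0"
    and b: "\<And>t. t \<ge> T \<Longrightarrow> K1 * exp (t * (L - \<delta>)) \<le> F t" "\<And>t. t \<ge> T \<Longrightarrow> F t \<le> K2 * exp (t * (L + \<delta>))"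
    using bounds[OF \<delta>(1,2)] by metis
  define m where "m = max \<bar>ln K1\<bar> \<bar>ln K2\<bar>"
  \<comment> \<open>Half of \<epsilon> is spent on \<delta>, the other half on the logarithms of the
    constants, which are below \<open>t * (\<epsilon> / 2)\<close> once
    \<open>t > 2 * m / \<epsilon>\<close>.\<close>
  show "eventually (\<lambda>t. dist (1 / t * ln (F t)) L < \<epsilon>) at_top"
    using eventually_ge_at_top[of T] eventually_gt_at_top[of 0] eventually_gt_at_top[of "2 * m / \<epsilon>"]
  proof eventually_elim
    case (elim t)
    have m: "m < t * (\<epsilon> / 2)" using elim(3) \<epsilon> by (simp add: field_simps)
    have "0 < K1 * exp (t * (L - \<delta>))" using K by simp
    then have F: "F t > 0" using b(1)[OF elim(1)] by linarith
    have "ln (K1 * exp (t * (L - \<delta>))) \<le> ln (F t)"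
      using b(1)[OF elim(1)] K F by (subst ln_le_cancel_iff) auto
    then have 1: "ln K1 + t * (L - \<delta>) \<le> ln (F t)" using K by (simp add: ln_mult)
    have "ln (F t) \<le> ln (K2 * exp (t * (L + \<delta>)))"
      using b(2)[OF elim(1)] K F by (subst ln_le_cancel_iff) auto
    then have 2: "ln (F t) \<le> ln K2 + t * (L + \<delta>)" using K by (simp add: ln_mult)
    have t\<delta>: "t * \<delta> \<le> t * (\<epsilon> / 2)" using \<delta>(3) elim(2) by simp
    have "\<bar>ln (F t) - t * L\<bar> < t * \<epsilon>"
      using 1 2 t\<delta> m by (simp add: m_def algebra_simps abs_less_iff) linarith
    then have "\<bar>ln (F t) - t * L\<bar> / t < \<epsilon>" using elim(2) by (simp add: field_simps)
    moreover have "1 / t * ln (F t) - L = (ln (F t) - t * L) / t" using elim(2) by (simp add: field_simps)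
    ultimately show ?case using elim(2) by (simp add: dist_real_def abs_divide)
  qed
qed

section \<open>The Higgs field evaluated on the velocity of the path\<close>

lemma eigenvalues_scale:
  fixes M :: "complex ^ 'r ^ 'r::finite"
  assumes card: "card (eigenvalues M) = CARD('r)"
  shows "eigenvalues (\<chi> i j. a * M $ i $ j) = (\<lambda>l. a * l) ` eigenvalues M"
proof -
  let ?N = "\<chi> i j. a * M $ i $ j"
  have N: "?N *v v = a *s (M *v v)" for v
    by (simp add: vec_eq_iff matrix_vector_mult_component sum_distrib_left mult.assoc)
  show ?thesis
  proof (cases "a = 0")
    \<comment> \<open>In rank one a noncritical path may have zero speed. Both sides are then
      \<open>{0}\<close>, the right one because the cardinality makes the spectrum of
      \<open>M\<close> nonempty.\<close>
    case True
    have "eigenvalues M \<noteq> {}" using card zero_less_card_finite[where 'a = 'r] by force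
    moreover have "eigenvalues ?N = {0}"
    proof -
      have "?N *v v = 0" for v unfolding N using True by simp
      moreover have "axis undefined 1 \<noteq> (0 :: complex ^ 'r)" by (simp add: axis_eq_0_iff)
      ultimately show ?thesis unfolding eigenvalues_def by (auto simp: vector_mul_eq_0 simp del: axis_eq_0_iff)
    qed
    ultimately show ?thesis using True by auto
  next
    case False
    have "l \<in> eigenvalues ?N \<longleftrightarrow> l / a \<in> eigenvalues M" for l
    proof -
      have "?N *v v = l *s v \<longleftrightarrow> M *v v = (l / a) *s v" for v
        unfolding N vec_eq_iff vector_smult_component using False by (auto simp: field_simps)
      then show ?thesis unfolding eigenvalues_def by simp
    qed
    then show ?thesis using False by (force simp: image_iff)
  qed
qed

text \<open>The matrix multiplied by \<open>t\<close> in the equation of parallel transport, whence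
  the sign.\<close>

definition speed_matrix ::
  "('y \<Rightarrow> 'x) \<Rightarrow> ('x, 'e, 'r::finite) coeffs \<Rightarrow> (real \<Rightarrow> 'y) \<Rightarrow> 'x chart \<Rightarrow> ('x, 'e, 'r) triv \<Rightarrow> real
     \<Rightarrow> complex ^ 'r ^ 'r" where
  "speed_matrix p \<Phi> \<gamma> c b \<tau> = (\<chi> i j. - path_speed p c \<gamma> \<tau> * \<Phi> c b (p (\<gamma> \<tau>)) $ i $ j)"

text \<open>Taking the union over all frames avoids a choice; by \<open>path_spectrum_eq\<close>
  each frame contributes the same set.\<close>

definition path_spectrum ::
  "'x chart set \<Rightarrow> ('x, 'e, 'r::finite) triv set \<Rightarrow> ('y \<Rightarrow> 'x) \<Rightarrow> ('x, 'e, 'r) coeffs \<Rightarrow> (real \<Rightarrow> 'y) \<Rightarrow> real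
     \<Rightarrow> complex set" where
  "path_spectrum A B p \<Phi> \<gamma> \<tau> = {l. \<exists>c\<in>A. \<exists>b\<in>B. p (\<gamma> \<tau>) \<in> fst c \<inter> fst b \<and> l \<in> eigenvalues (speed_matrix p \<Phi> \<gamma> c b \<tau>)}"

lemma scaleR_matrix_vector_mult: "(t *\<^sub>R A) *v v = t *\<^sub>R (A *v (v :: complex ^ 'n))"
  by (simp add: vec_eq_iff matrix_vector_mult_component scaleR_sum_right)

lemma speed_matrix_mult: "speed_matrix p \<Phi> \<gamma> c b \<tau> *v v = - (path_speed p c \<gamma> \<tau> *s (\<Phi> c b (p (\<gamma> \<tau>)) *v v))"
  by (simp add: speed_matrix_def vec_eq_iff matrix_vector_mult_component sum_distrib_left mult.assoc sum_negf)

locale noncritical_path =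
  fixes A :: "'x::t2_space chart set" and pr :: "'e \<Rightarrow> 'x" and B :: "('x, 'e, 'r::finite) triv set"
    and p :: "'y::topological_space \<Rightarrow> 'x" and \<gamma> :: "real \<Rightarrow> 'y"
    and \<Phi> \<alpha>0 :: "('x, 'e, 'r) coeffs" and h :: "'e \<Rightarrow> 'e \<Rightarrow> complex"
  assumes rs: "riemann_surface A" and hb: "holomorphic_bundle A pr B" and uc: "universal_cover p"
    and higgs: "higgs_field A pr B \<Phi>" and conn: "holomorphic_connection A pr B \<alpha>0"
    and herm: "hermitian_metric A pr B h" and nc: "noncritical A B p \<Phi> \<gamma>"
begin

lemma path_C1: "C1_path A p \<gamma>"
  using nc by (simp add: noncritical_def)

lemma p_continuous: "continuous_on UNIV p"
  using uc by (simp add: universal_cover_def covering_space_def)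

lemma \<Phi>_holomorphic: "holomorphic_coeffs A B \<Phi>"
  using higgs by (simp add: higgs_field_def)

section \<open>Independence of charts and trivialisations\<close>

lemma path_speed_change:
  assumes c: "c \<in> A" "c' \<in> A" and \<tau>: "\<tau> \<in> {0..1}" "p (\<gamma> \<tau>) \<in> fst c \<inter> fst c'"
  shows "path_speed p c' \<gamma> \<tau> = chart_deriv c c' (p (\<gamma> \<tau>)) * path_speed p c \<gamma> \<tau>"
proof -
  let ?x = "p (\<gamma> \<tau>)"
  note chain = field_vector_diff_chain_within[OF path_speed_derivative[OF path_C1 c(1) \<tau>(1) IntD1[OF \<tau>(2)]]
      has_field_derivative_at_within[OF chart_change_derivative[OF rs c \<tau>(2)]]]
  obtain d where d: "d > 0" "\<And>y. y \<in> {0..1} \<Longrightarrow> dist y \<tau> < d \<Longrightarrow> p (\<gamma> y) \<in> fst c"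
    by (rule continuous_on_real_nhd[OF path_continuous[OF rs hb p_continuous path_C1] chart_open[OF rs c(1)] \<tau>(1) IntD1[OF \<tau>(2)]])
      (rule that)
  have "((snd c' \<circ> p \<circ> \<gamma>) has_vector_derivative path_speed p c \<gamma> \<tau> * chart_deriv c c' ?x) (at \<tau> within {0..1})"
  proof (rule has_vector_derivative_transform_within[OF chain d(1) \<tau>(1)])
    fix y assume y: "y \<in> {0..1}" "dist y \<tau> < d"
    show "((snd c' \<circ> chart_inv c) \<circ> (\<lambda>\<tau>. snd c (p (\<gamma> \<tau>)))) y = (snd c' \<circ> p \<circ> \<gamma>) y"
      using chart_inv_chart[OF rs c(1) d(2)[OF y]] unfolding o_apply by (rule arg_cong)
  qed
  then have "path_speed p c' \<gamma> \<tau> = path_speed p c \<gamma> \<tau> * chart_deriv c c' ?x"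
    unfolding path_speed_def[of p c'] using vector_derivative_within_cbox[of 0 1 \<tau>] \<tau>(1)
    by (simp add: cbox_interval)
  then show ?thesis by (simp add: mult.commute)
qed

text \<open>The chart factor in the speed is the one in the transformation law of the Higgs field,
  so only conjugation by the transition matrix remains. An inclusion is enough, since the two frames
  can be exchanged.\<close>

lemma speed_matrix_change:
  assumes c: "c \<in> A" "c' \<in> A" and b: "b \<in> B" "b' \<in> B" and \<tau>: "\<tau> \<in> {0..1}"
    and x: "p (\<gamma> \<tau>) \<in> fst c \<inter> fst b" "p (\<gamma> \<tau>) \<in> fst c' \<inter> fst b'"
  shows "eigenvalues (speed_matrix p \<Phi> \<gamma> c b \<tau>) \<subseteq> eigenvalues (speed_matrix p \<Phi> \<gamma> c' b' \<tau>)"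
proof
  let ?x = "p (\<gamma> \<tau>)" and ?T = "transition pr b b' (p (\<gamma> \<tau>))" and ?s = "path_speed p c \<gamma> \<tau>"
  have xs: "?x \<in> fst c \<inter> fst c'" "?x \<in> fst b \<inter> fst b'" "?x \<in> fst c \<inter> fst c' \<inter> fst b \<inter> fst b'" using x by auto
  have hig: "mat (chart_deriv c c' ?x) ** \<Phi> c' b' ?x ** ?T = ?T ** \<Phi> c b ?x"
    using higgs c b xs(3) unfolding higgs_field_def by blast
  have conj: "speed_matrix p \<Phi> \<gamma> c' b' \<tau> *v (?T *v v) = ?T *v (speed_matrix p \<Phi> \<gamma> c b \<tau> *v v)" for v
  proof -
    have "chart_deriv c c' ?x *s (\<Phi> c' b' ?x *v (?T *v v)) = (mat (chart_deriv c c' ?x) ** \<Phi> c' b' ?x ** ?T) *v v"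
      by (simp add: matrix_vector_mul_assoc[symmetric] mat_vector_mult)
    also have "\<dots> = ?T *v (\<Phi> c b ?x *v v)" unfolding hig by (simp add: matrix_vector_mul_assoc)
    finally have e: "chart_deriv c c' ?x *s (\<Phi> c' b' ?x *v (?T *v v)) = ?T *v (\<Phi> c b ?x *v v)" .
    have "speed_matrix p \<Phi> \<gamma> c' b' \<tau> *v (?T *v v) = - (?s *s (chart_deriv c c' ?x *s (\<Phi> c' b' ?x *v (?T *v v))))"
      unfolding speed_matrix_mult path_speed_change[OF c \<tau> xs(1)] by (simp add: vector_smult_assoc mult.commute)
    also have "\<dots> = - (?s *s (?T *v (\<Phi> c b ?x *v v)))" unfolding e ..
    also have "\<dots> = ?T *v (speed_matrix p \<Phi> \<gamma> c b \<tau> *v v)"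
      unfolding speed_matrix_mult vector_scalar_commute[symmetric]
      by (simp add: vec_eq_iff matrix_vector_mult_component sum_negf)
    finally show ?thesis .
  qed
  fix l assume "l \<in> eigenvalues (speed_matrix p \<Phi> \<gamma> c b \<tau>)"
  then obtain v where v: "v \<noteq> 0" "speed_matrix p \<Phi> \<gamma> c b \<tau> *v v = l *s v" unfolding eigenvalues_def by blast
  have "?T *v v \<noteq> 0"
  proof
    assume "?T *v v = 0"
    then have "(transition pr b' b ?x ** ?T) *v v = 0" by (simp add: matrix_vector_mul_assoc[symmetric])
    with v(1) show False unfolding transition_inverse[OF rs hb b xs(2)] by simp
  qed
  moreover have "speed_matrix p \<Phi> \<gamma> c' b' \<tau> *v (?T *v v) = l *s (?T *v v)"
    unfolding conj v(2) by (simp add: vector_scalar_commute)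
  ultimately show "l \<in> eigenvalues (speed_matrix p \<Phi> \<gamma> c' b' \<tau>)" unfolding eigenvalues_def by blast
qed

lemma path_spectrum_eq:
  assumes "c \<in> A" "b \<in> B" "\<tau> \<in> {0..1}" "p (\<gamma> \<tau>) \<in> fst c \<inter> fst b"
  shows "path_spectrum A B p \<Phi> \<gamma> \<tau> = eigenvalues (speed_matrix p \<Phi> \<gamma> c b \<tau>)"
  unfolding path_spectrum_def using speed_matrix_change assms by blast

lemma speed_matrix_spectrum:
  assumes cb: "c \<in> A" "b \<in> B" and \<tau>: "\<tau> \<in> {0..1}" "p (\<gamma> \<tau>) \<in> fst c \<inter> fst b"
  shows "card (eigenvalues (speed_matrix p \<Phi> \<gamma> c b \<tau>)) = CARD('r)"
    and "inj_on Re (eigenvalues (speed_matrix p \<Phi> \<gamma> c b \<tau>))"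
proof -
  let ?E = "eigenvalues (\<Phi> c b (p (\<gamma> \<tau>)))" and ?s = "path_speed p c \<gamma> \<tau>"
  have card: "card ?E = CARD('r)" and inj: "inj_on (\<lambda>l. Re (l * ?s)) ?E"
    using nc cb \<tau> unfolding noncritical_def by blast+
  have ev: "eigenvalues (speed_matrix p \<Phi> \<gamma> c b \<tau>) = (\<lambda>l. - ?s * l) ` ?E"
    unfolding speed_matrix_def by (rule eigenvalues_scale[OF card])
  have i: "inj_on (\<lambda>l. - ?s * l) ?E"
  proof (rule inj_onI)
    fix l l' assume l: "l \<in> ?E" "l' \<in> ?E" and eq: "- ?s * l = - ?s * l'"
    have "l * ?s = l' * ?s" using eq unfolding mult_minus_left neg_equal_iff_equal mult.commute[of ?s] .
    then have "Re (l * ?s) = Re (l' * ?s)" by (rule arg_cong)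
    from inj_onD[OF inj this l] show "l = l'" .
  qed
  show "card (eigenvalues (speed_matrix p \<Phi> \<gamma> c b \<tau>)) = CARD('r)" unfolding ev card_image[OF i] by (rule card)
  show "inj_on Re (eigenvalues (speed_matrix p \<Phi> \<gamma> c b \<tau>))"
  proof (rule inj_onI)
    fix y y' assume "y \<in> eigenvalues (speed_matrix p \<Phi> \<gamma> c b \<tau>)" "y' \<in> eigenvalues (speed_matrix p \<Phi> \<gamma> c b \<tau>)"
      and re: "Re y = Re y'"
    then obtain l l' where l: "l \<in> ?E" "y = - ?s * l" "l' \<in> ?E" "y' = - ?s * l'" unfolding ev by blast
    have "Re (l * ?s) = Re (l' * ?s)"
      using re unfolding l mult_minus_left uminus_complex.sel neg_equal_iff_equal mult.commute[of ?s] .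
    from inj_onD[OF inj this l(1,3)] show "y = y'" using l by simp
  qed
qed

lemma local_frame_exists:
  obtains c b where "c \<in> A" "b \<in> B" "p (\<gamma> \<tau>) \<in> fst c \<inter> fst b"
proof -
  obtain c where c: "c \<in> A" "p (\<gamma> \<tau>) \<in> fst c" by (rule chart_exists[OF rs])
  obtain b where b: "b \<in> B" "p (\<gamma> \<tau>) \<in> fst b" by (rule triv_exists[OF rs hb])
  from that[OF c(1) b(1)] c(2) b(2) show ?thesis by blast
qed

lemma speed_matrix_continuous:
  assumes cb: "c \<in> A" "b \<in> B"
  shows "continuous_on {\<tau> \<in> {0..1}. p (\<gamma> \<tau>) \<in> fst c \<inter> fst b} (\<lambda>\<tau>. speed_matrix p \<Phi> \<gamma> c b \<tau> $ i $ j)"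
proof -
  have "continuous_on {\<tau> \<in> {0..1}. p (\<gamma> \<tau>) \<in> fst c \<inter> fst b}
      (\<lambda>\<tau>. - (path_speed p c \<gamma> \<tau> * \<Phi> c b (p (\<gamma> \<tau>)) $ i $ j))"
    by (rule continuous_on_minus[OF speed_times_coeffs_continuous[OF rs hb p_continuous path_C1 \<Phi>_holomorphic cb]])
  then show ?thesis by (simp add: speed_matrix_def)
qed

lemma path_spectrum_top:
  shows "continuous_on {0..1} (\<lambda>\<tau>. top_real (path_spectrum A B p \<Phi> \<gamma> \<tau>))"
    and "\<exists>g>0. \<forall>\<tau>\<in>{0..1}. has_gap g (path_spectrum A B p \<Phi> \<gamma> \<tau>)"
proof -
  let ?E = "path_spectrum A B p \<Phi> \<gamma>"
  have E: "card (?E \<tau>) = CARD('r)" "inj_on Re (?E \<tau>)" if \<tau>: "\<tau> \<in> {0..1}" for \<tau>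
  proof -
    obtain c b where cb: "c \<in> A" "b \<in> B" "p (\<gamma> \<tau>) \<in> fst c \<inter> fst b" by (rule local_frame_exists)
    show "card (?E \<tau>) = CARD('r)" "inj_on Re (?E \<tau>)"
      unfolding path_spectrum_eq[OF cb(1,2) \<tau> cb(3)] by (rule speed_matrix_spectrum[OF cb(1,2) \<tau> cb(3)])+
  qed
  have lsc: "\<exists>d>0. \<forall>\<tau>\<in>{0..1}. dist \<tau> x < d \<longrightarrow> (\<exists>z'\<in>?E \<tau>. dist z z' < \<epsilon>)"
    if x: "x \<in> {0..1}" and z: "z \<in> ?E x" and \<epsilon>: "\<epsilon> > 0" for x z \<epsilon>
  proof -
    obtain c b where cb: "c \<in> A" "b \<in> B" "p (\<gamma> x) \<in> fst c \<inter> fst b" by (rule local_frame_exists)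
    let ?I = "{\<tau> \<in> {0..1}. p (\<gamma> \<tau>) \<in> fst c \<inter> fst b}"
    have xI: "x \<in> ?I" using x cb(3) by simp
    have cards: "card (eigenvalues (speed_matrix p \<Phi> \<gamma> c b \<tau>)) = CARD('r)" if "\<tau> \<in> ?I" for \<tau>
      by (rule speed_matrix_spectrum(1)[OF cb(1,2)]) (use that in simp_all)
    have zE: "z \<in> eigenvalues (speed_matrix p \<Phi> \<gamma> c b x)"
      using z unfolding path_spectrum_eq[OF cb(1,2) x cb(3)] .
    obtain d1 where d1: "d1 > 0" "\<forall>\<tau>\<in>?I. dist \<tau> x < d1 \<longrightarrow>
        (\<exists>z'\<in>eigenvalues (speed_matrix p \<Phi> \<gamma> c b \<tau>). dist z z' < \<epsilon>)"
      using eigenvalues_lower_semicontinuous[OF speed_matrix_continuous[OF cb(1,2)] cards xI zE \<epsilon>] by metis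
    obtain d2 where d2: "d2 > 0" "\<And>y. y \<in> {0..1} \<Longrightarrow> dist y x < d2 \<Longrightarrow> p (\<gamma> y) \<in> fst c \<inter> fst b"
      by (rule chart_nhd_along[OF rs hb p_continuous path_C1 cb(1,2) x cb(3)]) (rule that)
    show ?thesis
    proof (intro exI[of _ "min d1 d2"] conjI ballI impI)
      show "min d1 d2 > 0" using d1(1) d2(1) by simp
      fix \<tau> assume \<tau>: "\<tau> \<in> {0..1}" "dist \<tau> x < min d1 d2"
      have I: "p (\<gamma> \<tau>) \<in> fst c \<inter> fst b" by (rule d2(2)[OF \<tau>(1)]) (use \<tau>(2) in simp)
      show "\<exists>z'\<in>?E \<tau>. dist z z' < \<epsilon>"
        unfolding path_spectrum_eq[OF cb(1,2) \<tau>(1) I]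
        by (rule d1(2)[rule_format]) (use \<tau> I in simp_all)
    qed
  qed
  note * = spectrum_along_path[of ?E, OF E(1) zero_less_card_finite E(2) lsc]
  show "continuous_on {0..1} (\<lambda>\<tau>. top_real (?E \<tau>))" by (rule *(1))
  show "\<exists>g>0. \<forall>\<tau>\<in>{0..1}. has_gap g (?E \<tau>)" by (rule *(2))
qed

text \<open>Passes between \<open>h\<close> and the Euclidean norm of a trivialisation. At
  \<open>x\<close> the lower constant is the minimum \<open>m\<close> of the positive definite form
  on the unit sphere; nearby the Gram matrix has moved by at most \<open>m / 2\<close>.\<close>

lemma metric_comparison:
  assumes cb: "c \<in> A" "b \<in> B" and x: "x \<in> {0..1}" "p (\<gamma> x) \<in> fst c \<inter> fst b"
  shows "\<exists>k>0. \<exists>C>0. \<exists>d>0. \<forall>\<tau>\<in>{0..1}. dist \<tau> x < d \<longrightarrow> (\<forall>e. pr e = p (\<gamma> \<tau>) \<longrightarrow>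
    k * (norm (snd b e))\<^sup>2 \<le> Re (h e e) \<and> Re (h e e) \<le> C * (norm (snd b e))\<^sup>2)"
proof -
  let ?I = "{\<tau> \<in> {0..1}. p (\<gamma> \<tau>) \<in> fst c \<inter> fst b}"
  define G where "G \<tau> = gram pr h b (p (\<gamma> \<tau>))" for \<tau>
  have h: "Re (h e e) = snd b e \<bullet> (G \<tau> *v snd b e)" if "pr e = p (\<gamma> \<tau>)" "p (\<gamma> \<tau>) \<in> fst b" for e \<tau>
  proof -
    have "e \<in> fibre pr (p (\<gamma> \<tau>))" using that(1) by (simp add: fibre_def)
    then have "h e e = (\<Sum>i\<in>UNIV. \<Sum>j\<in>UNIV. cnj (snd b e $ i) * G \<tau> $ i $ j * snd b e $ j)"
      using conjunct1[OF bspec[OF bspec[OF conjunct1[OF herm[unfolded hermitian_metric_def]] cb(2)] that(2)]]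
      unfolding G_def by blast
    also have "\<dots> = (\<Sum>i\<in>UNIV. cnj (snd b e $ i) * (G \<tau> *v snd b e) $ i)"
      by (simp add: matrix_vector_mult_component sum_distrib_left mult.assoc)
    finally show ?thesis by (simp add: inner_vec_def inner_complex_def)
  qed
  have pos: "0 < v \<bullet> (G x *v v)" if "v \<noteq> 0" for v
  proof -
    have xb: "p (\<gamma> x) \<in> fst b" using x(2) by blast
    let ?e = "triv_inv pr b (p (\<gamma> x)) v"
    have e: "pr ?e = p (\<gamma> x)" "snd b ?e = v"
      using triv_inv[OF rs hb cb(2) xb] by blast+
    then have "?e \<in> fibre pr (p (\<gamma> x))" "snd b ?e \<noteq> 0" using that by (simp_all add: fibre_def)
    then have "Re (h ?e ?e) > 0"
      using conjunct2[OF bspec[OF bspec[OF conjunct1[OF herm[unfolded hermitian_metric_def]] cb(2)] xb]] by blast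
    then show ?thesis unfolding h[OF e(1) xb] e(2) .
  qed
  have Gc: "continuous_on ?I (\<lambda>\<tau>. G \<tau> $ i $ j)" for i j
  proof -
    have "smooth_on (snd c ` (fst c \<inter> fst b)) (\<lambda>w. gram pr h b (chart_inv c w) $ i $ j)"
      using bspec[OF bspec[OF conjunct2[OF herm[unfolded hermitian_metric_def case_prod_unfold]] cb(1)] cb(2)] by blast
    then have "continuous_on (snd c ` (fst c \<inter> fst b)) (\<lambda>w. gram pr h b (chart_inv c w) $ i $ j)"
      unfolding smooth_on_def using Ck_on.simps(1) by blast
    from continuous_on_compose2[OF this continuous_on_subset[OF chart_continuous[OF rs cb(1)] Int_lower1] order_refl]
    have "continuous_on (fst c \<inter> fst b) (\<lambda>y. gram pr h b (chart_inv c (snd c y)) $ i $ j)" .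
    then have "continuous_on (fst c \<inter> fst b) (\<lambda>y. gram pr h b y $ i $ j)"
      by (rule continuous_on_eq) (subst chart_inv_chart[OF rs cb(1) IntD1], auto)
    then show ?thesis unfolding G_def
      by (rule continuous_on_compose2[OF _ continuous_on_subset[OF path_continuous[OF rs hb p_continuous path_C1]]]) auto
  qed
  have cont: "continuous_on (sphere 0 1) (\<lambda>v. v \<bullet> (G x *v v))"
  proof -
    have "bounded_linear ((*v) (G x))"
      unfolding linear_linear
      by (rule linearI)
        (simp_all add: matrix_vector_right_distrib vec_eq_iff matrix_vector_mult_component scaleR_sum_right)
    then show ?thesis by (intro continuous_on_inner continuous_on_id linear_continuous_on)
  qed
  obtain u :: "complex ^ 'r" where "norm u = 1" using vector_choose_size[OF zero_le_one] by blast
  then have "u \<in> sphere 0 1" by simp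
  then have ne: "sphere (0 :: complex ^ 'r) 1 \<noteq> {}" by blast
  obtain v0 where v0: "v0 \<in> sphere 0 1" "\<And>v. v \<in> sphere 0 1 \<Longrightarrow> v0 \<bullet> (G x *v v0) \<le> v \<bullet> (G x *v v)"
    using continuous_attains_inf[OF compact_sphere ne cont] by blast
  define m where "m = v0 \<bullet> (G x *v v0)"
  have m: "m > 0" unfolding m_def by (rule pos) (use v0(1) in auto)
  have low: "m * (norm v)\<^sup>2 \<le> v \<bullet> (G x *v v)" for v
  proof (cases "v = 0")
    case False
    have "m \<le> ((1 / norm v) *\<^sub>R v) \<bullet> (G x *v ((1 / norm v) *\<^sub>R v))"
      unfolding m_def by (rule v0(2)) (use False in simp)
    also have "G x *v ((1 / norm v) *\<^sub>R v) = (1 / norm v) *\<^sub>R (G x *v v)"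
      by (simp add: vec_eq_iff matrix_vector_mult_component scaleR_sum_right)
    finally show ?thesis using False by (simp add: field_simps power2_eq_square)
  qed simp
  have ec: "continuous_on ?I (\<lambda>\<tau>. entry_sum (G \<tau> - G x))"
    by (rule continuous_on_entry_sum, unfold vector_minus_component, intro continuous_on_diff continuous_on_const Gc)
  have ex: "entry_sum (G x - G x) \<in> {..<m/2}" using m by (simp add: entry_sum_def)
  have xI: "x \<in> ?I" using x by simp
  obtain d1 where d1: "d1 > 0" "\<And>y. y \<in> ?I \<Longrightarrow> dist y x < d1 \<Longrightarrow> entry_sum (G y - G x) \<in> {..<m/2}"
    by (rule continuous_on_real_nhd[OF ec open_lessThan xI ex]) (rule that)
  obtain d2 where d2: "d2 > 0" "\<And>y. y \<in> {0..1} \<Longrightarrow> dist y x < d2 \<Longrightarrow> p (\<gamma> y) \<in> fst c \<inter> fst b"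
    by (rule chart_nhd_along[OF rs hb p_continuous path_C1 cb x]) (rule that)
  \<comment> \<open>The form at \<open>x\<close> is bounded by \<open>entry_sum (G x)\<close>, and
    \<open>m\<close> leaves ample room for its variation.\<close>
  define C where "C = entry_sum (G x) + m"
  have C: "C > 0" using m entry_sum_nonneg[of "G x"] by (simp add: C_def)
  have "m / 2 * (norm (snd b e))\<^sup>2 \<le> Re (h e e) \<and> Re (h e e) \<le> C * (norm (snd b e))\<^sup>2"
    if \<tau>: "\<tau> \<in> {0..1}" "dist \<tau> x < min d1 d2" and e: "pr e = p (\<gamma> \<tau>)" for \<tau> e
  proof -
    have I: "p (\<gamma> \<tau>) \<in> fst c \<inter> fst b" by (rule d2(2)[OF \<tau>(1)]) (use \<tau>(2) in simp)
    define v where "v = snd b e"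
    have inner: "\<bar>v \<bullet> (X *v v)\<bar> \<le> entry_sum X * (norm v)\<^sup>2" for X
    proof -
      have "\<bar>v \<bullet> (X *v v)\<bar> \<le> norm v * norm (X *v v)" by (rule Cauchy_Schwarz_ineq2)
      also have "\<dots> \<le> norm v * (entry_sum X * norm v)" by (intro mult_left_mono norm_matrix_vector_le) simp
      finally show ?thesis by (simp add: power2_eq_square algebra_simps)
    qed
    have "entry_sum (G \<tau> - G x) \<le> m/2" using d1(2)[of \<tau>] \<tau> I by simp
    then have "entry_sum (G \<tau> - G x) * (norm v)\<^sup>2 \<le> m / 2 * (norm v)\<^sup>2" by (rule mult_right_mono) simp
    with inner[of "G \<tau> - G x"] have d: "\<bar>v \<bullet> ((G \<tau> - G x) *v v)\<bar> \<le> m / 2 * (norm v)\<^sup>2" by linarith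
    have sp: "v \<bullet> (G \<tau> *v v) = v \<bullet> (G x *v v) + v \<bullet> ((G \<tau> - G x) *v v)"
      by (simp add: matrix_vector_mult_diff_rdistrib inner_diff_right)
    have up: "v \<bullet> (G x *v v) \<le> entry_sum (G x) * (norm v)\<^sup>2" using inner[of "G x"] by linarith
    have "C * (norm v)\<^sup>2 = entry_sum (G x) * (norm v)\<^sup>2 + m * (norm v)\<^sup>2" by (simp add: C_def distrib_right)
    moreover have "0 \<le> m * (norm v)\<^sup>2" using m by simp
    ultimately show ?thesis
      unfolding h[OF e IntD2[OF I]] v_def[symmetric] sp using d low[of v] up by (auto simp: abs_le_iff)
  qed
  moreover have "min d1 d2 > 0" using d1(1) d2(1) by simp
  ultimately show ?thesis using C m by (intro exI[of _ "m/2"] conjI exI[of _ C] exI[of _ "min d1 d2"]) auto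
qed

end

section \<open>Lyapunov functions along the path\<close>

context noncritical_path
begin

abbreviation sol :: "real \<Rightarrow> (real \<Rightarrow> 'e) \<Rightarrow> bool" where
  "sol t s \<equiv> parallel_along A pr B p (\<lambda>c b x. \<alpha>0 c b x + t *\<^sub>R \<Phi> c b x, \<lambda>c b x. 0) \<gamma> s"

text \<open>Along a solution the form has derivative
  \<open>2 * diag_form R \<sigma> v (t *\<^sub>R (M *v v) - w)\<close>, with \<open>w\<close> coming
  from the fixed connection. The first part is controlled by \<open>diag_form_near\<close>, the
  second is bounded independently of \<open>t\<close>. Everything is measured by \<open>h\<close>,
  which does not depend on the trivialisation, so that estimates around different points can be
  added.\<close>

lemma local_lyapunov:
  assumes cb: "c \<in> A" "b \<in> B" and x: "x \<in> {0..1}" "p (\<gamma> x) \<in> fst c \<inter> fst b"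
    and e: "eigenbasis (speed_matrix p \<Phi> \<gamma> c b x) l R S"
    and \<mu>: "continuous_on {0..1} \<mu>" and \<sigma>: "\<And>i. \<sigma> i * (Re (l i) - \<mu> x) \<ge> k" "k > 0"
  shows "\<exists>r>0. \<exists>\<kappa>>0. \<exists>C. \<forall>t>0. \<forall>s. sol t s \<longrightarrow> (\<forall>\<tau>\<in>{0..1}. \<bar>\<tau> - x\<bar> < r \<longrightarrow>
       \<bar>diag_form R \<sigma> (snd b (s \<tau>)) (snd b (s \<tau>))\<bar> \<le> C * Re (h (s \<tau>) (s \<tau>)) \<and>
       (\<exists>D. ((\<lambda>\<tau>. diag_form R \<sigma> (snd b (s \<tau>)) (snd b (s \<tau>))) has_real_derivative D) (at \<tau> within {0..1}) \<and>
            D \<ge> 2 * t * \<mu> \<tau> * diag_form R \<sigma> (snd b (s \<tau>)) (snd b (s \<tau>)) + (t * \<kappa> - C) * Re (h (s \<tau>) (s \<tau>))))"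
proof -
  let ?I = "{\<tau> \<in> {0..1}. p (\<gamma> \<tau>) \<in> fst c \<inter> fst b}" and ?M = "speed_matrix p \<Phi> \<gamma> c b"
  let ?q = "diag_form R \<sigma>"
  have xI: "x \<in> ?I" using x by simp
  have \<mu>I: "continuous_on ?I \<mu>" by (rule continuous_on_subset[OF \<mu>]) auto
  obtain \<kappa> d1 where \<kappa>: "\<kappa> > 0" "d1 > 0"
    "\<forall>\<tau>\<in>?I. dist \<tau> x < d1 \<longrightarrow> (\<forall>v. ?q v (?M \<tau> *v v) - \<mu> \<tau> * ?q v v \<ge> \<kappa> * (norm v)\<^sup>2)"
    by (rule exE[OF diag_form_near[OF speed_matrix_continuous[OF cb] \<mu>I xI e \<sigma>]])
      (elim exE conjE, rule that; assumption)
  obtain m C2 d2 where m: "m > 0" "C2 > 0" "d2 > 0" and cmp: "\<forall>\<tau>\<in>{0..1}. dist \<tau> x < d2 \<longrightarrow> (\<forall>e. pr e = p (\<gamma> \<tau>) \<longrightarrow>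
      m * (norm (snd b e))\<^sup>2 \<le> Re (h e e) \<and> Re (h e e) \<le> C2 * (norm (snd b e))\<^sup>2)"
    by (rule exE[OF metric_comparison[OF cb x]]) (elim exE conjE, rule that; assumption)
  obtain C1 where C1: "C1 \<ge> 0" "\<And>v w. \<bar>?q v w\<bar> \<le> C1 * norm v * norm w"
    using diag_form_bound[of R \<sigma>] by blast
  define f where "f \<tau> = norm (path_speed p c \<gamma> \<tau>) * entry_sum (\<alpha>0 c b (p (\<gamma> \<tau>)))" for \<tau>
  have hol: "holomorphic_coeffs A B \<alpha>0" using conn by (simp add: holomorphic_connection_def)
  have fc: "continuous_on ?I f"
    unfolding f_def
    by (intro continuous_on_mult continuous_on_norm continuous_on_entry_sum
        coeffs_along_continuous[OF rs hb p_continuous path_C1 hol cb] continuous_on_subset[OF path_speed_continuous[OF path_C1 cb(1)]]) auto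
  define K where "K = f x + 1"
  have "f x \<ge> 0" by (simp add: f_def entry_sum_nonneg)
  then have K0: "K > 0" by (simp add: K_def)
  have fx: "f x \<in> {..<K}" by (simp add: K_def)
  obtain d3 where d3: "d3 > 0" "\<And>y. y \<in> ?I \<Longrightarrow> dist y x < d3 \<Longrightarrow> f y \<in> {..<K}"
    by (rule continuous_on_real_nhd[OF fc open_lessThan xI fx]) (rule that)
  obtain d4 where d4: "d4 > 0" "\<And>y. y \<in> {0..1} \<Longrightarrow> dist y x < d4 \<Longrightarrow> p (\<gamma> y) \<in> fst c \<inter> fst b"
    by (rule chart_nhd_along[OF rs hb p_continuous path_C1 cb x]) (rule that)
  define r where "r = min (min d1 d2) (min d3 d4)"
  \<comment> \<open>The 2 is that of the derivative of a quadratic form, and \<open>C2\<close>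
    converts the Euclidean norm into \<open>h\<close>. In \<open>C\<close> below,
    \<open>2 * K\<close> pays for the fixed connection and 1 for the bound on the form
    itself.\<close>
  define \<kappa>' where "\<kappa>' = 2 * \<kappa> / C2"
  define C where "C = (2 * K + 1) * C1 / m"
  have main: "\<bar>?q (snd b (s \<tau>)) (snd b (s \<tau>))\<bar> \<le> C * Re (h (s \<tau>) (s \<tau>)) \<and>
       (\<exists>D. ((\<lambda>\<tau>. ?q (snd b (s \<tau>)) (snd b (s \<tau>))) has_real_derivative D) (at \<tau> within {0..1}) \<and>
            D \<ge> 2 * t * \<mu> \<tau> * ?q (snd b (s \<tau>)) (snd b (s \<tau>)) + (t * \<kappa>' - C) * Re (h (s \<tau>) (s \<tau>)))"
    if t: "t > 0" and s: "sol t s" and \<tau>: "\<tau> \<in> {0..1}" "\<bar>\<tau> - x\<bar> < r" for t s \<tau>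
  proof -
    have d: "dist \<tau> x < d1" "dist \<tau> x < d2" "dist \<tau> x < d3" "dist \<tau> x < d4"
      using \<tau>(2) by (simp_all add: r_def dist_real_def)
    have I: "p (\<gamma> \<tau>) \<in> fst c \<inter> fst b" by (rule d4(2)[OF \<tau>(1) d(4)])
    then have \<tau>I: "\<tau> \<in> ?I" using \<tau>(1) by simp
    note s' = s[unfolded parallel_along_iff[OF rs hb p_continuous path_C1]]
    have pr: "pr (s \<tau>) = p (\<gamma> \<tau>)" using s' \<tau>(1) by blast
    define v where "v = snd b (s \<tau>)"
    define n where "n = Re (h (s \<tau>) (s \<tau>))"
    define w where "w = path_speed p c \<gamma> \<tau> *s (\<alpha>0 c b (p (\<gamma> \<tau>)) *v v)"
    have n: "m * (norm v)\<^sup>2 \<le> n" "n \<le> C2 * (norm v)\<^sup>2"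
      using cmp \<tau>(1) d(2) pr unfolding v_def n_def by blast+
    have n1: "(norm v)\<^sup>2 \<le> n / m" using n(1) m(1) by (simp add: field_simps)
    have n2: "n / C2 \<le> (norm v)\<^sup>2" using n(2) m(2) by (simp add: field_simps)
    have n0: "n \<ge> 0" using n(1) m(1) by (meson less_imp_le mult_nonneg_nonneg order_trans zero_le_power2)
    have "((\<lambda>\<tau>. snd b (s \<tau>)) has_vector_derivative
         - (path_speed p c \<gamma> \<tau> *s ((\<alpha>0 c b (p (\<gamma> \<tau>)) + t *\<^sub>R \<Phi> c b (p (\<gamma> \<tau>))) *v snd b (s \<tau>)))) (at \<tau> within {0..1})"
      using s' cb \<tau>(1) I by blast
    moreover have "- (path_speed p c \<gamma> \<tau> *s ((\<alpha>0 c b (p (\<gamma> \<tau>)) + t *\<^sub>R \<Phi> c b (p (\<gamma> \<tau>))) *v snd b (s \<tau>)))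
        = t *\<^sub>R (?M \<tau> *v v) - w"
      unfolding speed_matrix_mult w_def v_def[symmetric] matrix_vector_mult_add_rdistrib scaleR_matrix_vector_mult
      by (simp add: vec_eq_iff algebra_simps)
    ultimately have "((\<lambda>\<tau>. snd b (s \<tau>)) has_vector_derivative t *\<^sub>R (?M \<tau> *v v) - w) (at \<tau> within {0..1})" by simp
    from diag_form_derivative[OF this, of R \<sigma>]
    have D: "((\<lambda>\<tau>. ?q (snd b (s \<tau>)) (snd b (s \<tau>))) has_real_derivative 2 * (t * ?q v (?M \<tau> *v v) - ?q v w)) (at \<tau> within {0..1})"
      unfolding v_def[symmetric] diag_form_diff_right diag_form_scaleR_right .
    have q1: "\<kappa> * (norm v)\<^sup>2 + \<mu> \<tau> * ?q v v \<le> ?q v (?M \<tau> *v v)" using bspec[OF \<kappa>(3) \<tau>I, rule_format, OF d(1), of v] by simp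
    have "norm w \<le> f \<tau> * norm v"
      unfolding w_def norm_vector_scalar_mult f_def mult.assoc
      by (intro mult_left_mono norm_matrix_vector_le norm_ge_zero)
    also have "\<dots> \<le> K * norm v" using d3(2)[OF \<tau>I d(3)] by (intro mult_right_mono) auto
    finally have "C1 * norm v * norm w \<le> C1 * norm v * (K * norm v)"
      using C1(1) by (intro mult_left_mono) auto
    then have q2: "\<bar>?q v w\<bar> \<le> K * C1 * (norm v)\<^sup>2"
      using C1(2)[of v w] by (simp add: power2_eq_square algebra_simps)
    have "K * C1 * (norm v)\<^sup>2 \<le> K * C1 * (n / m)" using n1 K0 C1(1) by (intro mult_left_mono) auto
    then have q3: "\<bar>?q v w\<bar> \<le> K * C1 * n / m" using q2 by simp
    have "C1 * (norm v)\<^sup>2 \<le> C1 * (n / m)" using n1 C1(1) by (intro mult_left_mono)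
    then have q4: "\<bar>?q v v\<bar> \<le> C1 * n / m" using C1(2)[of v v] by (simp add: power2_eq_square mult.assoc)
    have Cn: "C * n = 2 * (K * C1 * n / m) + C1 * n / m" by (simp add: C_def add_divide_distrib algebra_simps)
    have pos: "0 \<le> K * C1 * n / m" "0 \<le> C1 * n / m" using K0 C1(1) n0 m(1) by simp_all
    have "\<kappa> * (n / C2) \<le> \<kappa> * (norm v)\<^sup>2" using n2 \<kappa>(1) by (intro mult_left_mono) auto
    then have "\<kappa> * (n / C2) + \<mu> \<tau> * ?q v v \<le> ?q v (?M \<tau> *v v)" using q1 by linarith
    then have "t * (\<kappa> * (n / C2) + \<mu> \<tau> * ?q v v) \<le> t * ?q v (?M \<tau> *v v)" using t by (intro mult_left_mono) auto
    moreover have "2 * t * \<mu> \<tau> * ?q v v + t * \<kappa>' * n = 2 * (t * (\<kappa> * (n / C2) + \<mu> \<tau> * ?q v v))"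
      by (simp add: \<kappa>'_def algebra_simps)
    ultimately have "2 * t * \<mu> \<tau> * ?q v v + t * \<kappa>' * n \<le> 2 * (t * ?q v (?M \<tau> *v v))" by linarith
    then have "2 * t * \<mu> \<tau> * ?q v v + (t * \<kappa>' - C) * n \<le> 2 * (t * ?q v (?M \<tau> *v v) - ?q v w)"
      using abs_le_D1[OF q3] Cn pos unfolding left_diff_distrib right_diff_distrib by linarith
    with D have "\<exists>D. ((\<lambda>\<tau>. ?q (snd b (s \<tau>)) (snd b (s \<tau>))) has_real_derivative D) (at \<tau> within {0..1}) \<and>
            D \<ge> 2 * t * \<mu> \<tau> * ?q v v + (t * \<kappa>' - C) * n" by blast
    moreover have "\<bar>?q v v\<bar> \<le> C * n" using q4 Cn pos by linarith
    ultimately show ?thesis unfolding v_def n_def by blast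
  qed
  have "r > 0" using \<kappa> m d3 d4 by (simp add: r_def)
  moreover have "\<kappa>' > 0" using \<kappa>(1) m(2) by (simp add: \<kappa>'_def)
  ultimately show ?thesis using main by blast
qed

lemma metric_at:
  assumes cb: "c \<in> A" "b \<in> B" and x: "x \<in> {0..1}" "p (\<gamma> x) \<in> fst c \<inter> fst b"
  obtains k C where "k > 0" "C > 0" "\<And>e. pr e = p (\<gamma> x) \<Longrightarrow> k * (norm (snd b e))\<^sup>2 \<le> Re (h e e)"
    "\<And>e. pr e = p (\<gamma> x) \<Longrightarrow> Re (h e e) \<le> C * (norm (snd b e))\<^sup>2"
proof -
  obtain k C d where k: "k > 0" "C > 0" "d > 0" and *: "\<forall>\<tau>\<in>{0..1}. dist \<tau> x < d \<longrightarrow> (\<forall>e. pr e = p (\<gamma> \<tau>) \<longrightarrow>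
      k * (norm (snd b e))\<^sup>2 \<le> Re (h e e) \<and> Re (h e e) \<le> C * (norm (snd b e))\<^sup>2)"
    by (rule exE[OF metric_comparison[OF cb x]]) (elim exE conjE, rule that; assumption)
  have "dist x x < d" using k(3) by simp
  from *[rule_format, OF x(1) this] that[OF k(1,2)] show ?thesis by blast
qed

lemma metric_nonneg:
  assumes "x \<in> {0..1}" "pr e = p (\<gamma> x)"
  shows "Re (h e e) \<ge> 0"
proof -
  obtain c b where cb: "c \<in> A" "b \<in> B" "p (\<gamma> x) \<in> fst c \<inter> fst b" by (rule local_frame_exists)
  obtain k C where k: "k > 0" "\<And>e. pr e = p (\<gamma> x) \<Longrightarrow> k * (norm (snd b e))\<^sup>2 \<le> Re (h e e)"
    by (rule metric_at[OF cb(1,2) assms(1) cb(3)]) (rule that)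
  have "0 \<le> k * (norm (snd b e))\<^sup>2" using k(1) by simp
  also have "\<dots> \<le> Re (h e e)" by (rule k(2)[OF assms(2)])
  finally show ?thesis .
qed

text \<open>Frames and eigenbases are chosen separately at every time, with no continuity in
  \<open>x\<close>.\<close>

definition eigenframe_at where
  "eigenframe_at x c b l R S \<longleftrightarrow> c \<in> A \<and> b \<in> B \<and> p (\<gamma> x) \<in> fst c \<inter> fst b \<and>
     eigenbasis (speed_matrix p \<Phi> \<gamma> c b x) l R S"

lemma eigenframe_exists:
  obtains c b l R S where "\<And>x. x \<in> {0..1} \<Longrightarrow> eigenframe_at x (c x) (b x) (l x) (R x) (S x)"
proof -
  have "\<exists>c b l R S. eigenframe_at x c b l R S" if x: "x \<in> {0..1}" for x
  proof -
    obtain c b where cb: "c \<in> A" "b \<in> B" "p (\<gamma> x) \<in> fst c \<inter> fst b" by (rule local_frame_exists)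
    obtain l R S where "eigenbasis (speed_matrix p \<Phi> \<gamma> c b x) l R S"
      by (rule eigenbasis_exists[OF speed_matrix_spectrum(1)[OF cb(1,2) x cb(3)]]) (rule that)
    with cb show ?thesis unfolding eigenframe_at_def by blast
  qed
  then show ?thesis using that by metis
qed

text \<open>No sign of the forms is assumed: positive values yield growth from below, negative
  definite forms an upper bound.\<close>

lemma lyapunov_along_path:
  assumes F: "\<And>x. x \<in> {0..1} \<Longrightarrow> eigenframe_at x (c x) (b x) (l x) (R x) (S x)"
    and \<mu>: "continuous_on {0..1} \<mu>" and k: "k > 0"
    and \<sigma>: "\<And>x i. x \<in> {0..1} \<Longrightarrow> \<sigma> x i * (Re (l x i) - \<mu> x) \<ge> k"
  shows "\<exists>a>0. \<exists>a'>0. \<exists>T. \<forall>t\<ge>T. \<forall>s. sol t s \<longrightarrow>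
    exp (2 * t * integral {0..1} \<mu>) * (a * diag_form (R 0) (\<sigma> 0) (snd (b 0) (s 0)) (snd (b 0) (s 0)))
      \<le> a' * diag_form (R 1) (\<sigma> 1) (snd (b 1) (s 1)) (snd (b 1) (s 1))"
proof (rule lyapunov_gluing[where sol = sol and n = "\<lambda>e. Re (h e e)"
      and \<psi> = "\<lambda>x e. diag_form (R x) (\<sigma> x) (snd (b x) e) (snd (b x) e)", OF \<mu>])
  show "Re (h (s \<tau>) (s \<tau>)) \<ge> 0" if "sol t s" "\<tau> \<in> {0..1}" for t s \<tau>
    by (rule metric_nonneg[OF that(2)]) (use that in \<open>simp add: parallel_along_def\<close>)
  fix x :: real assume x: "x \<in> {0..1}"
  have f: "c x \<in> A" "b x \<in> B" "p (\<gamma> x) \<in> fst (c x) \<inter> fst (b x)"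
    "eigenbasis (speed_matrix p \<Phi> \<gamma> (c x) (b x) x) (l x) (R x) (S x)"
    using F[OF x] unfolding eigenframe_at_def by blast+
  show "\<exists>r>0. \<exists>\<kappa>>0. \<exists>C. \<forall>t>0. \<forall>s. sol t s \<longrightarrow> (\<forall>\<tau>\<in>{0..1}. \<bar>\<tau> - x\<bar> < r \<longrightarrow>
       \<bar>diag_form (R x) (\<sigma> x) (snd (b x) (s \<tau>)) (snd (b x) (s \<tau>))\<bar> \<le> C * Re (h (s \<tau>) (s \<tau>)) \<and>
       (\<exists>D. ((\<lambda>\<tau>. diag_form (R x) (\<sigma> x) (snd (b x) (s \<tau>)) (snd (b x) (s \<tau>))) has_real_derivative D) (at \<tau> within {0..1}) \<and>
            D \<ge> 2 * t * \<mu> \<tau> * diag_form (R x) (\<sigma> x) (snd (b x) (s \<tau>)) (snd (b x) (s \<tau>)) + (t * \<kappa> - C) * Re (h (s \<tau>) (s \<tau>))))"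
    by (rule local_lyapunov[OF f(1,2) x f(3,4) \<mu> \<sigma>[OF x] k])
qed

section \<open>The growth rate and its two-sided bounds\<close>

definition "top_growth \<tau> = top_real (path_spectrum A B p \<Phi> \<gamma> \<tau>)"

lemma top_growth_integral: "integral {0..1} (\<lambda>\<tau>. top_growth \<tau> + d) = integral {0..1} top_growth + d"
proof -
  have "top_growth integrable_on {0..1}"
    unfolding top_growth_def[abs_def] by (rule integrable_continuous_interval[OF path_spectrum_top(1)])
  then show ?thesis by (subst integral_add) auto
qed

lemma eigenframe_gap:
  assumes F: "eigenframe_at x c b l R S" and x: "x \<in> {0..1}"
    and g: "has_gap g (path_spectrum A B p \<Phi> \<gamma> x)" "g \<ge> 0"
  shows "Re (l i) \<le> top_growth x" "Re (l i) \<noteq> top_growth x \<Longrightarrow> Re (l i) \<le> top_growth x - g"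
    "\<exists>i. Re (l i) = top_growth x"
proof -
  have f: "c \<in> A" "b \<in> B" "p (\<gamma> x) \<in> fst c \<inter> fst b" "range l = eigenvalues (speed_matrix p \<Phi> \<gamma> c b x)"
    using F unfolding eigenframe_at_def eigenbasis_def by blast+
  have E: "path_spectrum A B p \<Phi> \<gamma> x = range l"
    unfolding f(4) by (rule path_spectrum_eq[OF f(1,2) x f(3)])
  have "\<exists>z\<in>range l. Re z = top_growth x \<and> (\<forall>w\<in>range l. w \<noteq> z \<longrightarrow> Re w \<le> top_growth x - g)"
    using g(1) unfolding has_gap_def top_growth_def E .
  then obtain z where z: "z \<in> range l" "Re z = top_growth x" "\<forall>w\<in>range l. w \<noteq> z \<longrightarrow> Re w \<le> top_growth x - g"
    by (elim bexE conjE) (rule that)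
  show le: "Re (l i) \<le> top_growth x - g" if "Re (l i) \<noteq> top_growth x"
  proof -
    have "l i \<noteq> z" using that z(2) by metis
    then show ?thesis using z(3) by simp
  qed
  show "Re (l i) \<le> top_growth x" using le g(2) by linarith
  obtain j where "z = l j" using z(1) by blast
  then show "\<exists>i. Re (l i) = top_growth x" using z(2) by (intro exI[of _ j]) simp
qed

text \<open>With all signs -1 the form is minus a squared norm. A lower bound for its final value is
  then an upper bound for the norm, and every eigenvalue lies at least \<delta> below the threshold
  \<open>top_growth x + \<delta>\<close>.\<close>

lemma growth_upper:
  assumes \<delta>: "\<delta> > 0"
  shows "\<exists>K>0. \<exists>T. \<forall>t\<ge>T. \<forall>s. sol t s \<longrightarrow>
    Re (h (s 1) (s 1)) \<le> K * exp (2 * t * (integral {0..1} top_growth + \<delta>)) * Re (h (s 0) (s 0))"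
proof -
  obtain c b l R S where F: "\<And>x. x \<in> {0..1} \<Longrightarrow> eigenframe_at x (c x) (b x) (l x) (R x) (S x)"
    by (rule eigenframe_exists) (rule that)
  obtain g where g: "g > 0" "\<And>\<tau>. \<tau> \<in> {0..1} \<Longrightarrow> has_gap g (path_spectrum A B p \<Phi> \<gamma> \<tau>)"
    using path_spectrum_top(2) by blast
  have \<mu>: "continuous_on {0..1} (\<lambda>\<tau>. top_growth \<tau> + \<delta>)"
    unfolding top_growth_def by (intro continuous_on_add path_spectrum_top(1) continuous_on_const)
  have \<sigma>: "- 1 * (Re (l x i) - (top_growth x + \<delta>)) \<ge> \<delta>" if x: "x \<in> {0..1}" for x i
    using eigenframe_gap(1)[OF F[OF x] x g(2)[OF x] less_imp_le[OF g(1)], of i] by simp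
  have q: "diag_form Q (\<lambda>_. - 1) v v = - (norm (Q *v v))\<^sup>2" for Q :: "complex ^ 'r ^ 'r" and v
    by (simp add: diag_form_self norm_vec_def L2_set_def sum_nonneg sum_negf)
  obtain a a' T where a: "a > 0" "a' > 0" and T: "\<And>t s. t \<ge> T \<Longrightarrow> sol t s \<Longrightarrow>
      exp (2 * t * (integral {0..1} top_growth + \<delta>)) * (a * - (norm (R 0 *v snd (b 0) (s 0)))\<^sup>2)
      \<le> a' * - (norm (R 1 *v snd (b 1) (s 1)))\<^sup>2"
    using lyapunov_along_path[where \<sigma> = "\<lambda>x i. - 1", OF F \<mu> \<delta> \<sigma>] unfolding q top_growth_integral by blast
  have x01: "0 \<in> {0..1::real}" "1 \<in> {0..1::real}" by simp_all
  have f0: "c 0 \<in> A" "b 0 \<in> B" "p (\<gamma> 0) \<in> fst (c 0) \<inter> fst (b 0)"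
    using F[OF x01(1)] unfolding eigenframe_at_def by blast+
  have f1: "c 1 \<in> A" "b 1 \<in> B" "p (\<gamma> 1) \<in> fst (c 1) \<inter> fst (b 1)" "S 1 ** R 1 = mat 1"
    using F[OF x01(2)] unfolding eigenframe_at_def eigenbasis_def by blast+
  obtain k where k: "k > 0" "\<And>e. pr e = p (\<gamma> 0) \<Longrightarrow> k * (norm (snd (b 0) e))\<^sup>2 \<le> Re (h e e)"
    by (rule metric_at[OF f0(1,2) x01(1) f0(3)]) (rule that)
  obtain C where C: "C > 0" "\<And>e. pr e = p (\<gamma> 1) \<Longrightarrow> Re (h e e) \<le> C * (norm (snd (b 1) e))\<^sup>2"
    by (rule metric_at[OF f1(1,2) x01(2) f1(3)]) (rule that)
  let ?s1 = "(entry_sum (S 1))\<^sup>2" and ?r0 = "(entry_sum (R 0))\<^sup>2"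
  \<comment> \<open>The product of the comparison constants at both ends; adding 1 makes it positive
    in any case.\<close>
  define K where "K = C * ?s1 * a * ?r0 / (a' * k) + 1"
  have "K > 0" using a k(1) C(1) by (simp add: K_def add_nonneg_pos)
  moreover have "Re (h (s 1) (s 1)) \<le> K * exp (2 * t * (integral {0..1} top_growth + \<delta>)) * Re (h (s 0) (s 0))"
    if t: "t \<ge> T" and s: "sol t s" for t s
  proof -
    define E where "E = exp (2 * t * (integral {0..1} top_growth + \<delta>))"
    have E: "E > 0" by (simp add: E_def)
    have pr: "pr (s 0) = p (\<gamma> 0)" "pr (s 1) = p (\<gamma> 1)" using s by (simp_all add: parallel_along_def)
    define v0 v1 where "v0 = snd (b 0) (s 0)" and "v1 = snd (b 1) (s 1)"
    have n0: "Re (h (s 0) (s 0)) \<ge> 0" by (rule metric_nonneg[OF x01(1) pr(1)])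
    have 1: "a' * (norm (R 1 *v v1))\<^sup>2 \<le> E * (a * (norm (R 0 *v v0))\<^sup>2)"
      using T[OF t s] unfolding E_def v0_def v1_def by simp
    have "(norm (R 0 *v v0))\<^sup>2 \<le> (entry_sum (R 0) * norm v0)\<^sup>2"
      by (intro power_mono norm_matrix_vector_le) simp
    also have "\<dots> = ?r0 * (norm v0)\<^sup>2" by (rule power_mult_distrib)
    also have "\<dots> \<le> ?r0 * (Re (h (s 0) (s 0)) / k)"
      using k(2)[OF pr(1)] k(1) by (intro mult_left_mono) (simp_all add: v0_def field_simps)
    finally have 2: "E * (a * (norm (R 0 *v v0))\<^sup>2) \<le> E * (a * (?r0 * (Re (h (s 0) (s 0)) / k)))"
      using E a(1) by (intro mult_left_mono) auto
    have 3: "(norm (R 1 *v v1))\<^sup>2 \<le> E * (a * (?r0 * (Re (h (s 0) (s 0)) / k))) / a'"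
      unfolding pos_le_divide_eq[OF a(2)] mult.commute[of _ a'] by (rule order_trans[OF 1 2])
    have "norm v1 \<le> entry_sum (S 1) * norm (R 1 *v v1)"
      using norm_matrix_vector_le[of "S 1" "R 1 *v v1"] by (simp add: matrix_vector_mul_assoc f1(4))
    then have "(norm v1)\<^sup>2 \<le> (entry_sum (S 1) * norm (R 1 *v v1))\<^sup>2" by (intro power_mono) auto
    also have "\<dots> = ?s1 * (norm (R 1 *v v1))\<^sup>2" by (rule power_mult_distrib)
    also have "\<dots> \<le> ?s1 * (E * (a * (?r0 * (Re (h (s 0) (s 0)) / k))) / a')"
      by (intro mult_left_mono 3) simp
    finally have "C * (norm v1)\<^sup>2 \<le> C * (?s1 * (E * (a * (?r0 * (Re (h (s 0) (s 0)) / k))) / a'))"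
      using C(1) by (intro mult_left_mono) auto
    also have "\<dots> = (C * ?s1 * a * ?r0 / (a' * k)) * E * Re (h (s 0) (s 0))" using a(2) k(1) by (simp add: field_simps)
    also have "\<dots> \<le> K * E * Re (h (s 0) (s 0))"
      using E n0 by (intro mult_right_mono) (auto simp: K_def)
    finally show ?thesis using C(2)[OF pr(2)] unfolding v1_def E_def by linarith
  qed
  ultimately show ?thesis by blast
qed

text \<open>A single vector in the leading eigenline at time 0, the same for all \<open>t\<close>,
  has positive value under the indefinite form. The form grows along the solution and at time 1 is
  at most a multiple of \<open>h\<close>, so \<open>h\<close> has to grow as well.\<close>

lemma growth_lower:
  assumes \<delta>: "\<delta> > 0" "\<delta> \<le> g / 2" and g: "\<And>\<tau>. \<tau> \<in> {0..1} \<Longrightarrow> has_gap g (path_spectrum A B p \<Phi> \<gamma> \<tau>)"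
  shows "\<exists>K>0. \<exists>T. \<exists>e. pr e = p (\<gamma> 0) \<and> Re (h e e) \<le> 1 \<and> (\<forall>t\<ge>T. \<forall>s. sol t s \<longrightarrow> s 0 = e \<longrightarrow>
    K * exp (2 * t * (integral {0..1} top_growth - \<delta>)) \<le> Re (h (s 1) (s 1)))"
proof -
  have g0: "g \<ge> 0" using \<delta> by simp
  obtain c b l R S where F: "\<And>x. x \<in> {0..1} \<Longrightarrow> eigenframe_at x (c x) (b x) (l x) (R x) (S x)"
    by (rule eigenframe_exists) (rule that)
  \<comment> \<open>The threshold \<open>top_growth x - \<delta>\<close> separates the leading
    eigenvalue from the others: it lies \<delta> below the former and at least
    \<open>g - \<delta> \<ge> \<delta>\<close> above the latter, which is where
    \<open>\<delta> \<le> g / 2\<close> enters.\<close>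
  define \<sigma> :: "real \<Rightarrow> 'r \<Rightarrow> real" where "\<sigma> x i = (if Re (l x i) = top_growth x then 1 else - 1)" for x i
  have \<mu>: "continuous_on {0..1} (\<lambda>\<tau>. top_growth \<tau> + - \<delta>)"
    unfolding top_growth_def by (intro continuous_on_add path_spectrum_top(1) continuous_on_const)
  have \<sigma>: "\<sigma> x i * (Re (l x i) - (top_growth x + - \<delta>)) \<ge> \<delta>" if x: "x \<in> {0..1}" for x i
    using eigenframe_gap(2)[OF F[OF x] x g[OF x] g0, of i] \<delta> unfolding \<sigma>_def by auto
  obtain a a' T where a: "a > 0" "a' > 0" and T: "\<And>t s. t \<ge> T \<Longrightarrow> sol t s \<Longrightarrow>
      exp (2 * t * (integral {0..1} top_growth + - \<delta>)) *
        (a * diag_form (R 0) (\<sigma> 0) (snd (b 0) (s 0)) (snd (b 0) (s 0)))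
      \<le> a' * diag_form (R 1) (\<sigma> 1) (snd (b 1) (s 1)) (snd (b 1) (s 1))"
    using lyapunov_along_path[where \<sigma> = \<sigma>, OF F \<mu> \<delta>(1) \<sigma>] unfolding top_growth_integral by blast
  have x01: "0 \<in> {0..1::real}" "1 \<in> {0..1::real}" by simp_all
  have f0: "c 0 \<in> A" "b 0 \<in> B" "p (\<gamma> 0) \<in> fst (c 0) \<inter> fst (b 0)" "R 0 ** S 0 = mat 1"
    using F[OF x01(1)] unfolding eigenframe_at_def eigenbasis_def by blast+
  have f1: "c 1 \<in> A" "b 1 \<in> B" "p (\<gamma> 1) \<in> fst (c 1) \<inter> fst (b 1)"
    using F[OF x01(2)] unfolding eigenframe_at_def by blast+
  obtain C where C: "C > 0" "\<And>e. pr e = p (\<gamma> 0) \<Longrightarrow> Re (h e e) \<le> C * (norm (snd (b 0) e))\<^sup>2"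
    by (rule metric_at[OF f0(1,2) x01(1) f0(3)]) (rule that)
  obtain k where k: "k > 0" "\<And>e. pr e = p (\<gamma> 1) \<Longrightarrow> k * (norm (snd (b 1) e))\<^sup>2 \<le> Re (h e e)"
    by (rule metric_at[OF f1(1,2) x01(2) f1(3)]) (rule that)
  obtain i where i: "Re (l 0 i) = top_growth 0" using eigenframe_gap(3)[OF F[OF x01(1)] x01(1) g[OF x01(1)] g0] by blast
  obtain C1 where C1: "C1 \<ge> 0" "\<And>v w. \<bar>diag_form (R 1) (\<sigma> 1) v w\<bar> \<le> C1 * norm v * norm w"
    using diag_form_bound[of "R 1" "\<sigma> 1"] by blast
  \<comment> \<open>A leading eigenvector, as a column of \<open>S 0\<close>. The factor
    \<open>r\<close> brings it into the unit ball of \<open>h\<close>, and the form then takes the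
    value \<open>r\<^sup>2\<close> on it.\<close>
  define u where "u = S 0 *v axis i 1"
  define r where "r = 1 / (1 + C * (norm u)\<^sup>2)"
  have Cu: "0 \<le> C * (norm u)\<^sup>2" using C(1) by simp
  have r: "r > 0" "r \<le> 1" "C * (norm u)\<^sup>2 * r \<le> 1" using Cu by (simp_all add: r_def field_simps)
  define e where "e = triv_inv pr (b 0) (p (\<gamma> 0)) (r *\<^sub>R u)"
  have e: "pr e = p (\<gamma> 0)" "snd (b 0) e = r *\<^sub>R u"
    unfolding e_def using triv_inv[OF rs hb f0(2) IntD2[OF f0(3)]] by blast+
  have ne: "Re (h e e) \<le> 1"
  proof -
    have "Re (h e e) \<le> C * (norm (r *\<^sub>R u))\<^sup>2" using C(2)[OF e(1)] unfolding e(2) .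
    also have "\<dots> = (C * (norm u)\<^sup>2 * r) * r" by (simp add: power2_eq_square)
    also have "\<dots> \<le> 1 * 1" using r Cu by (intro mult_mono) auto
    finally show ?thesis by simp
  qed
  have qe: "diag_form (R 0) (\<sigma> 0) (snd (b 0) e) (snd (b 0) e) = r\<^sup>2"
  proof -
    have "R 0 *v (r *\<^sub>R u) = r *\<^sub>R axis i 1"
    proof -
      have "R 0 *v (r *\<^sub>R u) = r *\<^sub>R (R 0 *v u)"
        by (simp add: vec_eq_iff matrix_vector_mult_component scaleR_sum_right)
      also have "R 0 *v u = axis i 1" by (simp add: u_def matrix_vector_mul_assoc f0(4))
      finally show ?thesis .
    qed
    then have "diag_form (R 0) (\<sigma> 0) (snd (b 0) e) (snd (b 0) e)
        = (\<Sum>j\<in>UNIV. if j = i then \<sigma> 0 j * r\<^sup>2 else 0)"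
      unfolding diag_form_self e(2) by (intro sum.cong) (auto simp: axis_def)
    also have "\<dots> = r\<^sup>2" using i by (simp add: \<sigma>_def)
    finally show ?thesis .
  qed
  \<comment> \<open>\<open>C1 / k\<close> compares the form with \<open>h\<close> at time 1; adding
    1 keeps the denominator positive.\<close>
  define K where "K = a * r\<^sup>2 / (a' * (C1 / k + 1))"
  have den: "a' * (C1 / k + 1) > 0" using a(2) C1(1) k(1) by (intro mult_pos_pos add_nonneg_pos) auto
  have "K > 0" unfolding K_def by (rule divide_pos_pos[OF _ den]) (use a(1) r(1) in simp)
  moreover have "K * exp (2 * t * (integral {0..1} top_growth - \<delta>)) \<le> Re (h (s 1) (s 1))"
    if t: "t \<ge> T" and s: "sol t s" and s0: "s 0 = e" for t s
  proof -
    define E where "E = exp (2 * t * (integral {0..1} top_growth - \<delta>))"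
    have pr: "pr (s 1) = p (\<gamma> 1)" using s by (simp add: parallel_along_def)
    define v1 where "v1 = snd (b 1) (s 1)"
    define n where "n = Re (h (s 1) (s 1))"
    have n0: "n \<ge> 0" unfolding n_def by (rule metric_nonneg[OF x01(2) pr])
    have "(norm v1)\<^sup>2 \<le> n / k" using k(2)[OF pr] k(1) by (simp add: v1_def n_def field_simps)
    then have "C1 * (norm v1)\<^sup>2 \<le> C1 * (n / k)" using C1(1) by (intro mult_left_mono)
    moreover have "diag_form (R 1) (\<sigma> 1) v1 v1 \<le> C1 * (norm v1)\<^sup>2"
      using C1(2)[of v1 v1] by (simp add: power2_eq_square mult.assoc)
    ultimately have "diag_form (R 1) (\<sigma> 1) v1 v1 \<le> (C1 / k + 1) * n" using n0 by (simp add: algebra_simps)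
    then have "a' * diag_form (R 1) (\<sigma> 1) v1 v1 \<le> a' * ((C1 / k + 1) * n)" using a(2) by (intro mult_left_mono) auto
    moreover have "E * (a * r\<^sup>2) \<le> a' * diag_form (R 1) (\<sigma> 1) v1 v1"
      using T[OF t s] unfolding s0 qe E_def v1_def by simp
    ultimately have "E * (a * r\<^sup>2) \<le> (a' * (C1 / k + 1)) * n" by (simp only: mult.assoc)
    then have "(a * r\<^sup>2 * E) / (a' * (C1 / k + 1)) \<le> n" using den by (simp add: pos_divide_le_eq mult.commute)
    then show ?thesis unfolding K_def E_def n_def by simp
  qed
  ultimately show ?thesis using e(1) ne by blast
qed

text \<open>The upper bound applies to every vector of the unit ball, the lower one to a single
  vector of it. Square roots turn \<open>2 * t\<close> into \<open>t\<close>, since the growth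
  bounds concern squared norms.\<close>

theorem growth_limit:
  "((\<lambda>t. 1 / t * ln (op_norm pr p h (\<gamma> 0)
      (transport A pr B p (\<lambda>c b x. \<alpha>0 c b x + t *\<^sub>R \<Phi> c b x, \<lambda>c b x. 0) (\<gamma> 0) (\<gamma> 1))))
    \<longlongrightarrow> integral {0..1} top_growth) at_top"
proof -
  let ?L = "integral {0..1} top_growth"
  let ?T = "\<lambda>t. transport A pr B p (\<lambda>c b x. \<alpha>0 c b x + t *\<^sub>R \<Phi> c b x, \<lambda>c b x. 0) (\<gamma> 0) (\<gamma> 1)"
  let ?W = "{e \<in> fibre pr (p (\<gamma> 0)). hnorm h e \<le> 1}"
  have tr: "\<exists>s. sol t s \<and> s 0 = e \<and> ?T t e = s 1" if e: "pr e = p (\<gamma> 0)" for t e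
  proof -
    note ct = holomorphic_connection_add_higgs[OF rs hb conn higgs, of t]
    obtain s where s: "sol t s" "s 0 = e"
      by (rule parallel_exists[OF rs hb p_continuous path_C1 ct e]) (rule that)
    have "?T t (s 0) = s 1" by (rule transport_eq[OF rs hb uc ct path_C1 s(1)])
    with s show ?thesis by blast
  qed
  obtain g where g: "g > 0" "\<And>\<tau>. \<tau> \<in> {0..1} \<Longrightarrow> has_gap g (path_spectrum A B p \<Phi> \<gamma> \<tau>)"
    using path_spectrum_top(2) by blast
  show ?thesis
  proof (rule log_growth_limit)
    show "g / 2 > 0" using g(1) by simp
    fix \<delta> :: real assume \<delta>: "0 < \<delta>" "\<delta> \<le> g / 2"
    obtain K2 T2 where K2: "K2 > 0" and up: "\<And>t s. t \<ge> T2 \<Longrightarrow> sol t s \<Longrightarrow>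
        Re (h (s 1) (s 1)) \<le> K2 * exp (2 * t * (?L + \<delta>)) * Re (h (s 0) (s 0))"
      using growth_upper[OF \<delta>(1)] by blast
    obtain K1 T1 e0 where K1: "K1 > 0" and e0: "pr e0 = p (\<gamma> 0)" "Re (h e0 e0) \<le> 1"
      and lo: "\<And>t s. t \<ge> T1 \<Longrightarrow> sol t s \<Longrightarrow> s 0 = e0 \<Longrightarrow> K1 * exp (2 * t * (?L - \<delta>)) \<le> Re (h (s 1) (s 1))"
      using growth_lower[OF \<delta> g(2)] by blast
    have sq: "sqrt (K * exp (2 * t * y)) = sqrt K * exp (t * y)" for K t y :: real
    proof -
      have "exp (2 * t * y) = (exp (t * y))\<^sup>2" by (simp add: power2_eq_square exp_add[symmetric])
      then show ?thesis by (simp add: real_sqrt_mult)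
    qed
    have "sqrt K1 * exp (t * (?L - \<delta>)) \<le> op_norm pr p h (\<gamma> 0) (?T t) \<and>
        op_norm pr p h (\<gamma> 0) (?T t) \<le> sqrt K2 * exp (t * (?L + \<delta>))" if t: "t \<ge> max T1 T2" for t
    proof -
      have e0W: "e0 \<in> ?W" using e0 by (simp add: fibre_def hnorm_def)
      have bound: "hnorm h (?T t e) \<le> sqrt K2 * exp (t * (?L + \<delta>))" if e: "e \<in> ?W" for e
      proof -
        have pe: "pr e = p (\<gamma> 0)" and ne: "Re (h e e) \<le> 1" using e by (simp_all add: fibre_def hnorm_def)
        obtain s where s: "sol t s" "s 0 = e" "?T t e = s 1" using tr[OF pe] by blast
        have "Re (h (s 1) (s 1)) \<le> K2 * exp (2 * t * (?L + \<delta>)) * Re (h (s 0) (s 0))" by (rule up[OF _ s(1)]) (use t in simp)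
        also have "\<dots> \<le> K2 * exp (2 * t * (?L + \<delta>)) * 1" using ne K2 unfolding s(2) by (intro mult_left_mono) auto
        finally have "sqrt (Re (h (s 1) (s 1))) \<le> sqrt (K2 * exp (2 * t * (?L + \<delta>)))" by simp
        then show ?thesis unfolding hnorm_def s(3) sq .
      qed
      have "op_norm pr p h (\<gamma> 0) (?T t) \<le> sqrt K2 * exp (t * (?L + \<delta>))"
        unfolding op_norm_def by (rule cSUP_least) (use e0W bound in blast)+
      moreover have "sqrt K1 * exp (t * (?L - \<delta>)) \<le> op_norm pr p h (\<gamma> 0) (?T t)"
      proof -
        obtain s where s: "sol t s" "s 0 = e0" "?T t e0 = s 1" using tr[OF e0(1)] by blast
        have "K1 * exp (2 * t * (?L - \<delta>)) \<le> Re (h (s 1) (s 1))" by (rule lo[OF _ s(1,2)]) (use t in simp)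
        then have "sqrt (K1 * exp (2 * t * (?L - \<delta>))) \<le> sqrt (Re (h (s 1) (s 1)))" by simp
        then have "sqrt K1 * exp (t * (?L - \<delta>)) \<le> hnorm h (?T t e0)" unfolding hnorm_def s(3) sq .
        \<comment> \<open>A supremum of reals dominates the members of the set only when the set is
          bounded above, which \<open>bound\<close> provides.\<close>
        also have "\<dots> \<le> op_norm pr p h (\<gamma> 0) (?T t)"
          unfolding op_norm_def by (rule cSUP_upper[OF e0W]) (use bound in \<open>auto intro!: bdd_aboveI\<close>)
        finally show ?thesis .
      qed
      ultimately show ?thesis by blast
    qed
    moreover have "sqrt K1 > 0" "sqrt K2 > 0" using K1 K2 by simp_all
    ultimately show "\<exists>K1>0. \<exists>K2>0. \<exists>T. \<forall>t\<ge>T. K1 * exp (t * (?L - \<delta>)) \<le> op_norm pr p h (\<gamma> 0) (?T t) \<and>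
        op_norm pr p h (\<gamma> 0) (?T t) \<le> K2 * exp (t * (?L + \<delta>))" by blast
  qed
qed

end

theorem proposition1p5:
  fixes A :: "'x::t2_space chart set"
    and p :: "'y::topological_space \<Rightarrow> 'x"
    and pr :: "'e \<Rightarrow> 'x"
    and B :: "('x, 'e, 'r::finite) triv set"
    and \<Phi> :: "('x, 'e, 'r) coeffs"
    and D :: "real \<Rightarrow> ('x, 'e, 'r) conn"
    and m :: "real \<Rightarrow> 'e \<Rightarrow> 'e \<Rightarrow> complex"
  defines "f \<equiv> log_growth A pr B p D m"
  assumes "riemann_surface A" and "universal_cover p"
    and "holomorphic_bundle A pr B" and "trivial_determinant A pr B"
    and "higgs_field A pr B \<Phi>" and "trace_zero A B \<Phi>" and "reduced_spectral_curve A B \<Phi>"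
    and "complex_wkb A pr B \<Phi> D m \<or> hitchin_wkb A pr B \<Phi> D m"
  shows "(\<forall>P Q \<omega>. wkb_ultrafilter \<omega> \<longrightarrow> ultrafilter_exponent \<omega> (f P Q) \<le> wkb_exponent (f P Q)) \<and>
    (\<forall>P Q. \<exists>\<omega>. wkb_ultrafilter \<omega> \<and> ultrafilter_exponent \<omega> (f P Q) = wkb_exponent (f P Q)) \<and>
    (\<forall>P Q L. ((\<lambda>t. ereal (f P Q t)) \<longlongrightarrow> L) at_top \<longrightarrow>
       (\<forall>\<omega>. wkb_ultrafilter \<omega> \<longrightarrow>
          ultrafilter_exponent \<omega> (f P Q) = L \<and>
          ultrafilter_exponent \<omega> (f P Q) = wkb_exponent (f P Q))) \<and>
    (complex_wkb A pr B \<Phi> D m \<longrightarrow>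
       (\<forall>\<gamma>. noncritical A B p \<Phi> \<gamma> \<longrightarrow>
          (\<exists>L :: real. (f (\<gamma> 0) (\<gamma> 1) \<longlongrightarrow> L) at_top \<and>
             (\<forall>\<omega>. wkb_ultrafilter \<omega> \<longrightarrow>
                ultrafilter_exponent \<omega> (f (\<gamma> 0) (\<gamma> 1)) = ereal L \<and>
                ultrafilter_exponent \<omega> (f (\<gamma> 0) (\<gamma> 1)) = wkb_exponent (f (\<gamma> 0) (\<gamma> 1))))))"
proof (intro conjI allI impI)
  show "ultrafilter_exponent \<omega> (f P Q) \<le> wkb_exponent (f P Q)" if "wkb_ultrafilter \<omega>" for P Q \<omega>
    by (rule ultrafilter_exponent_le[OF that])
  show "\<exists>\<omega>. wkb_ultrafilter \<omega> \<and> ultrafilter_exponent \<omega> (f P Q) = wkb_exponent (f P Q)" for P Q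
    by (rule ultrafilter_exponent_attained)
  fix P Q L \<omega> assume L: "((\<lambda>t. ereal (f P Q t)) \<longlongrightarrow> L) at_top" and \<omega>: "wkb_ultrafilter \<omega>"
  show "ultrafilter_exponent \<omega> (f P Q) = L" by (rule ultrafilter_exponent_eqI(1)[OF \<omega> L])
  show "ultrafilter_exponent \<omega> (f P Q) = wkb_exponent (f P Q)"
    unfolding ultrafilter_exponent_eqI[OF \<omega> L] ..
next
  fix \<gamma> assume "complex_wkb A pr B \<Phi> D m" and nc: "noncritical A B p \<Phi> \<gamma>"
  then obtain \<alpha>0 h where \<alpha>0: "holomorphic_connection A pr B \<alpha>0" "hermitian_metric A pr B h"
    and D: "\<And>t. t \<ge> 0 \<Longrightarrow> D t = ((\<lambda>c b x. \<alpha>0 c b x + t *\<^sub>R \<Phi> c b x), (\<lambda>c b x. 0)) \<and> m t = h"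
    unfolding complex_wkb_def by blast
  interpret noncritical_path A pr B p \<gamma> \<Phi> \<alpha>0 h
    by unfold_locales (fact assms \<alpha>0 nc)+
  let ?L = "integral {0..1} top_growth"
  have lim: "(f (\<gamma> 0) (\<gamma> 1) \<longlongrightarrow> ?L) at_top"
  proof (rule Lim_transform_eventually[OF growth_limit])
    \<comment> \<open>The family \<open>D\<close> is prescribed for nonnegative parameters
      only.\<close>
    show "eventually (\<lambda>t. 1 / t * ln (op_norm pr p h (\<gamma> 0)
        (transport A pr B p (\<lambda>c b x. \<alpha>0 c b x + t *\<^sub>R \<Phi> c b x, \<lambda>c b x. 0) (\<gamma> 0) (\<gamma> 1))) = f (\<gamma> 0) (\<gamma> 1) t) at_top"
      using eventually_ge_at_top[of 0] by eventually_elim (simp add: f_def log_growth_def D)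
  qed
  then have elim: "((\<lambda>t. ereal (f (\<gamma> 0) (\<gamma> 1) t)) \<longlongrightarrow> ereal ?L) at_top" by simp
  show "\<exists>L :: real. (f (\<gamma> 0) (\<gamma> 1) \<longlongrightarrow> L) at_top \<and>
     (\<forall>\<omega>. wkb_ultrafilter \<omega> \<longrightarrow>
        ultrafilter_exponent \<omega> (f (\<gamma> 0) (\<gamma> 1)) = ereal L \<and>
        ultrafilter_exponent \<omega> (f (\<gamma> 0) (\<gamma> 1)) = wkb_exponent (f (\<gamma> 0) (\<gamma> 1)))"
    using lim ultrafilter_exponent_eqI[OF _ elim] by (intro exI[of _ ?L]) simp
qed

end
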